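(* Let $k$ be an algebraically closed field and let $H$ be a semisimple and cosemisimple Hopf algebra over $k$ which is commutative or cocommutative. Let $R$ be a unital $k$-algebra which is a twisted $H$-module algebra with map $\sigma:H\otimes H\to R$, such that the crossed product $R\#_\sigma H$ is an (associative) algebra with unit. Then $$r_j(R)=r_{Hj}(R)=r_{jH}(R)\quad\text{and}\quad r_j(R\#_\sigma H)=r_{Hj}(R)\#_\sigma H.$$
   Context: $r_j(A)$ denotes the Jacobson radical of a $k$-algebra $A$. Sweedler notation $\Delta(h)=\sum h_1\otimes h_2$ is used. A Hopf algebra $H$ weakly acts on $R$ if there is a $k$-linear map $H\otimes R\to R$, $h\otimes r\mapsto h\cdot r$, with $h\cdot(rs)=\sum (h_1\cdot r)(h_2\cdot s)$ and $1_H\cdot r=r$. $R$ is a twisted $H$-module algebra if $H$ weakly acts on $R$ and there is a convolution-invertible $\sigma\in \mathrm{Hom}_k(H\otimes H,R)$ with $h\cdot(g\cdot r)=\sum\sigma(h_1,g_1)(h_2g_2\cdot r)\sigma^{-1}(h_3,g_3)$ for all $h,g\in H$, $r\in R$. The crossed product $R\#_\sigma H$ is the vector space $R\otimes H$ (elements $a\# h$) with multiplication $(a\# h)(b\# g)=\sum a(h_1\cdot b)\sigma(h_2,g_1)\# h_3g_2$; it is assumed to be associative with unit $1\#1$. For an ideal $I$ of $R$, $(I:H)=\{x\in R\mid h\cdot x\in I \text{ for all } h\in H\}$. Put $r_{jH}(R)=(r_j(R):H)$. An $R$-$H$-module is a left $R$-module $M$ with a $k$-linear map $H\otimes M\to M$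 satisfying $1_Hm=m$, $h(am)=\sum(h_1\cdot a)(h_2m)$ and $h(gm)=\sum\sigma(h_1,g_1)(h_2g_2m)$ for $h,g\in H$, $a\in R$, $m\in M$. It is $R$-$H$-irreducible if $RM\neq0$ and $M$ has no $R$-$H$-submodules other than $0$ and $M$. The $H$-Jacobson radical $r_{Hj}(R)$ is the intersection of the annihilators in $R$ of all $R$-$H$-irreducible modules (equal to $R$ if there are none). For a subspace $I\subseteq R$, $I\#_\sigma H$ denotes the image of $I\otimes H$ in $R\#_\sigma H$. *)

theory Defs
  imports
    "HOL-Algebra.Ideal"
    "HOL-Computational_Algebra.Polynomial"
    "HOL-Library.Poly_Mapping"
begin

section \<open>Algebras over a field\<close>

text \<open>
  The sort \<open>{ring, monoid_mult}\<close> is that of associative rings with \<open>1\<close> in which \<open>0 = 1\<close> is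
  allowed, so the zero algebra is included.
\<close>

locale k_algebra = vector_space scale
  for scale :: "'k::field \<Rightarrow> 'a::{ring, monoid_mult} \<Rightarrow> 'a" +
  assumes scale_mult_left: "scale c x * y = scale c (x * y)"
    and scale_mult_right: "x * scale c y = scale c (x * y)"

definition bilinear_map ::
    "('k::field \<Rightarrow> 'u::ab_group_add \<Rightarrow> 'u) \<Rightarrow> ('k \<Rightarrow> 'v::ab_group_add \<Rightarrow> 'v) \<Rightarrow>
     ('k \<Rightarrow> 'w::ab_group_add \<Rightarrow> 'w) \<Rightarrow> ('u \<Rightarrow> 'v \<Rightarrow> 'w) \<Rightarrow> bool"
  where "bilinear_map sU sV sW f \<longleftrightarrow>
    (\<forall>u. Vector_Spaces.linear sV sW (f u)) \<and> (\<forall>v. Vector_Spaces.linear sU sW (\<lambda>u. f u v))"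

definition type_ring :: "'a::{ring, monoid_mult} ring"
  where "type_ring = \<lparr>carrier = UNIV, monoid.mult = (*), one = 1, ring.zero = 0, add = (+)\<rparr>"

definition left_ideal :: "('a, 'b) ring_scheme \<Rightarrow> 'a set \<Rightarrow> bool"
  where "left_ideal A I \<longleftrightarrow>
    additive_subgroup I A \<and> (\<forall>a \<in> carrier A. \<forall>x \<in> I. a \<otimes>\<^bsub>A\<^esub> x \<in> I)"

definition maximal_left_ideal :: "('a, 'b) ring_scheme \<Rightarrow> 'a set \<Rightarrow> bool"
  where "maximal_left_ideal A I \<longleftrightarrow>
    left_ideal A I \<and> I \<noteq> carrier A \<and>
    (\<forall>J. left_ideal A J \<longrightarrow> I \<subseteq> J \<longrightarrow> J = I \<or> J = carrier A)"

definition jacobson_radical :: "('a, 'b) ring_scheme \<Rightarrow> 'a set"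
  where "jacobson_radical A = carrier A \<inter> \<Inter>{I. maximal_left_ideal A I}"

text \<open>Semisimplicity of the left regular module: every left ideal has a complement.\<close>

definition semisimple_ring :: "('a, 'b) ring_scheme \<Rightarrow> bool"
  where "semisimple_ring A \<longleftrightarrow>
    (\<forall>I. left_ideal A I \<longrightarrow>
      (\<exists>J. left_ideal A J \<and> I \<inter> J = {\<zero>\<^bsub>A\<^esub>} \<and> I <+>\<^bsub>A\<^esub> J = carrier A))"


section \<open>Tensor products\<close>

text \<open>
  The tensor product \<open>U \<otimes> V\<close> is the free vector space on \<open>U \<times> V\<close> modulo the usual relations. As
  every tensor is a finite sum of pure tensors, an element is encoded as the set of all lists
  \<open>[(u\<^sub>1, v\<^sub>1), \<dots>, (u\<^sub>n, v\<^sub>n)]\<close> whose sum \<open>u\<^sub>1 \<otimes> v\<^sub>1 + \<dots> + u\<^sub>n \<otimes> v\<^sub>n\<close> is that element. Accordingly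
  \<open>tensor sU sV xs\<close> denotes \<open>\<Sum>(u,v)\<leftarrow>xs. u \<otimes> v\<close>, and lists are added by concatenation.
\<close>

definition free_scale :: "'k::field \<Rightarrow> ('x \<Rightarrow>\<^sub>0 'k) \<Rightarrow> ('x \<Rightarrow>\<^sub>0 'k)"
  where "free_scale c f = Poly_Mapping.map ((*) c) f"

definition formal_sum :: "'x list \<Rightarrow> ('x \<Rightarrow>\<^sub>0 'k::field)"
  where "formal_sum xs = (\<Sum>x\<leftarrow>xs. Poly_Mapping.single x 1)"

definition tensor_relations ::
    "('k::field \<Rightarrow> 'u::ab_group_add \<Rightarrow> 'u) \<Rightarrow> ('k \<Rightarrow> 'v::ab_group_add \<Rightarrow> 'v) \<Rightarrow>
     ('u \<times> 'v \<Rightarrow>\<^sub>0 'k) set"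
  where "tensor_relations sU sV = module.span free_scale
    ({formal_sum [(u + u', v)] - formal_sum [(u, v), (u', v)] | u u' v. True} \<union>
     {formal_sum [(u, v + v')] - formal_sum [(u, v), (u, v')] | u v v'. True} \<union>
     {formal_sum [(sU c u, v)] - free_scale c (formal_sum [(u, v)]) | c u v. True} \<union>
     {formal_sum [(u, sV c v)] - free_scale c (formal_sum [(u, v)]) | c u v. True})"

definition tensor ::
    "('k::field \<Rightarrow> 'u::ab_group_add \<Rightarrow> 'u) \<Rightarrow> ('k \<Rightarrow> 'v::ab_group_add \<Rightarrow> 'v) \<Rightarrow>
     ('u \<times> 'v) list \<Rightarrow> ('u \<times> 'v) list set"
  where "tensor sU sV xs = {ys. formal_sum ys - formal_sum xs \<in> tensor_relations sU sV}"

definition tensor_product ::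
    "('k::field \<Rightarrow> 'u::ab_group_add \<Rightarrow> 'u) \<Rightarrow> ('k \<Rightarrow> 'v::ab_group_add \<Rightarrow> 'v) \<Rightarrow>
     ('u \<times> 'v) list set set"
  where "tensor_product sU sV = range (tensor sU sV)"

text \<open>A representation of a tensor as a finite sum of pure tensors.\<close>

definition tensor_rep :: "('u \<times> 'v) list set \<Rightarrow> ('u \<times> 'v) list"
  where "tensor_rep X = (SOME xs. xs \<in> X)"

text \<open>The threefold tensor product, likewise as the multilinear quotient of a free vector space.\<close>

definition tensor3_relations ::
    "('k::field \<Rightarrow> 'u::ab_group_add \<Rightarrow> 'u) \<Rightarrow> ('k \<Rightarrow> 'v::ab_group_add \<Rightarrow> 'v) \<Rightarrow>
     ('k \<Rightarrow> 'w::ab_group_add \<Rightarrow> 'w) \<Rightarrow> ('u \<times> 'v \<times> 'w \<Rightarrow>\<^sub>0 'k) set"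
  where "tensor3_relations sU sV sW = module.span free_scale
    ({formal_sum [(u + u', v, w)] - formal_sum [(u, v, w), (u', v, w)] | u u' v w. True} \<union>
     {formal_sum [(u, v + v', w)] - formal_sum [(u, v, w), (u, v', w)] | u v v' w. True} \<union>
     {formal_sum [(u, v, w + w')] - formal_sum [(u, v, w), (u, v, w')] | u v w w'. True} \<union>
     {formal_sum [(sU c u, v, w)] - free_scale c (formal_sum [(u, v, w)]) | c u v w. True} \<union>
     {formal_sum [(u, sV c v, w)] - free_scale c (formal_sum [(u, v, w)]) | c u v w. True} \<union>
     {formal_sum [(u, v, sW c w)] - free_scale c (formal_sum [(u, v, w)]) | c u v w. True})"

definition tensor3 ::
    "('k::field \<Rightarrow> 'u::ab_group_add \<Rightarrow> 'u) \<Rightarrow> ('k \<Rightarrow> 'v::ab_group_add \<Rightarrow> 'v) \<Rightarrow>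
     ('k \<Rightarrow> 'w::ab_group_add \<Rightarrow> 'w) \<Rightarrow> ('u \<times> 'v \<times> 'w) list \<Rightarrow> ('u \<times> 'v \<times> 'w) list set"
  where "tensor3 sU sV sW xs = {ys. formal_sum ys - formal_sum xs \<in> tensor3_relations sU sV sW}"


section \<open>Hopf algebras\<close>

text \<open>
  Sweedler notation: \<open>\<Sum>(h\<^sub>1,h\<^sub>2)\<leftarrow>sweedler \<Delta> h. f h\<^sub>1 h\<^sub>2\<close> is \<open>\<Sum> f(h\<^sub>1, h\<^sub>2)\<close>. For bilinear \<open>f\<close> it does
  not depend on the chosen representation of \<open>\<Delta> h\<close>; similarly for \<open>sweedler3\<close>, which represents
  \<open>(id \<otimes> \<Delta>) (\<Delta> h)\<close>.
\<close>

definition sweedler :: "('h \<Rightarrow> ('h \<times> 'h) list set) \<Rightarrow> 'h \<Rightarrow> ('h \<times> 'h) list"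
  where "sweedler \<Delta> h = tensor_rep (\<Delta> h)"

definition sweedler3 :: "('h \<Rightarrow> ('h \<times> 'h) list set) \<Rightarrow> 'h \<Rightarrow> ('h \<times> 'h \<times> 'h) list"
  where "sweedler3 \<Delta> h = [(h1, h2, h3). (h1, h') \<leftarrow> sweedler \<Delta> h, (h2, h3) \<leftarrow> sweedler \<Delta> h']"

locale hopf_algebra = k_algebra scale
  for scale :: "'k::field \<Rightarrow> 'h::ring_1 \<Rightarrow> 'h"
    and \<Delta> :: "'h \<Rightarrow> ('h \<times> 'h) list set"
    and \<epsilon> :: "'h \<Rightarrow> 'k"
    and S :: "'h \<Rightarrow> 'h" +
  assumes comult_closed: "\<Delta> h \<in> tensor_product scale scale"
    and comult_add: "\<Delta> (g + h) = tensor scale scale (sweedler \<Delta> g @ sweedler \<Delta> h)"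
    and comult_scale: "\<Delta> (scale c h) = tensor scale scale [(scale c h1, h2). (h1, h2) \<leftarrow> sweedler \<Delta> h]"
    and coassoc:
      "tensor3 scale scale scale [(h1, h2, h3). (h', h3) \<leftarrow> sweedler \<Delta> h, (h1, h2) \<leftarrow> sweedler \<Delta> h'] =
       tensor3 scale scale scale [(h1, h2, h3). (h1, h') \<leftarrow> sweedler \<Delta> h, (h2, h3) \<leftarrow> sweedler \<Delta> h']"
    and counit_linear: "Vector_Spaces.linear scale (*) \<epsilon>"
    and counit_left: "(\<Sum>(h1, h2) \<leftarrow> sweedler \<Delta> h. scale (\<epsilon> h1) h2) = h"
    and counit_right: "(\<Sum>(h1, h2) \<leftarrow> sweedler \<Delta> h. scale (\<epsilon> h2) h1) = h"
    and comult_mult: "\<Delta> (g * h) =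
      tensor scale scale [(g1 * h1, g2 * h2). (g1, g2) \<leftarrow> sweedler \<Delta> g, (h1, h2) \<leftarrow> sweedler \<Delta> h]"
    and comult_one: "\<Delta> 1 = tensor scale scale [(1, 1)]"
    and counit_mult: "\<epsilon> (g * h) = \<epsilon> g * \<epsilon> h"
    and counit_one: "\<epsilon> 1 = 1"
    and antipode_linear: "Vector_Spaces.linear scale scale S"
    and antipode_left: "(\<Sum>(h1, h2) \<leftarrow> sweedler \<Delta> h. S h1 * h2) = scale (\<epsilon> h) 1"
    and antipode_right: "(\<Sum>(h1, h2) \<leftarrow> sweedler \<Delta> h. h1 * S h2) = scale (\<epsilon> h) 1"

definition cocommutative ::
    "('k::field \<Rightarrow> 'h::ab_group_add \<Rightarrow> 'h) \<Rightarrow> ('h \<Rightarrow> ('h \<times> 'h) list set) \<Rightarrow> bool"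
  where "cocommutative sH \<Delta> \<longleftrightarrow> (\<forall>h. \<Delta> h = tensor sH sH [(h2, h1). (h1, h2) \<leftarrow> sweedler \<Delta> h])"

definition subcoalgebra ::
    "('k::field \<Rightarrow> 'h::ab_group_add \<Rightarrow> 'h) \<Rightarrow> ('h \<Rightarrow> ('h \<times> 'h) list set) \<Rightarrow> 'h set \<Rightarrow> bool"
  where "subcoalgebra sH \<Delta> C \<longleftrightarrow>
    module.subspace sH C \<and> (\<forall>h \<in> C. \<exists>xs. set xs \<subseteq> C \<times> C \<and> \<Delta> h = tensor sH sH xs)"

definition simple_subcoalgebra ::
    "('k::field \<Rightarrow> 'h::ab_group_add \<Rightarrow> 'h) \<Rightarrow> ('h \<Rightarrow> ('h \<times> 'h) list set) \<Rightarrow> 'h set \<Rightarrow> bool"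
  where "simple_subcoalgebra sH \<Delta> C \<longleftrightarrow>
    subcoalgebra sH \<Delta> C \<and> C \<noteq> {0} \<and>
    (\<forall>D. subcoalgebra sH \<Delta> D \<longrightarrow> D \<subseteq> C \<longrightarrow> D = {0} \<or> D = C)"

definition cosemisimple ::
    "('k::field \<Rightarrow> 'h::ab_group_add \<Rightarrow> 'h) \<Rightarrow> ('h \<Rightarrow> ('h \<times> 'h) list set) \<Rightarrow> bool"
  where "cosemisimple sH \<Delta> \<longleftrightarrow> module.span sH (\<Union>{C. simple_subcoalgebra sH \<Delta> C}) = UNIV"


section \<open>Twisted module algebras and crossed products\<close>

text \<open>Linear maps out of \<open>H \<otimes> R\<close> and \<open>H \<otimes> H\<close> are given as curried bilinear maps.\<close>

definition weak_action ::
    "('k::field \<Rightarrow> 'h::ring_1 \<Rightarrow> 'h) \<Rightarrow> ('h \<Rightarrow> ('h \<times> 'h) list set) \<Rightarrow>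
     ('k \<Rightarrow> 'r::{ring, monoid_mult} \<Rightarrow> 'r) \<Rightarrow> ('h \<Rightarrow> 'r \<Rightarrow> 'r) \<Rightarrow> bool"
  where "weak_action sH \<Delta> sR act \<longleftrightarrow>
    bilinear_map sH sR sR act \<and>
    (\<forall>h r s. act h (r * s) = (\<Sum>(h1, h2) \<leftarrow> sweedler \<Delta> h. act h1 r * act h2 s)) \<and>
    (\<forall>r. act 1 r = r)"

definition convolution_inverse ::
    "('h \<Rightarrow> ('h \<times> 'h) list set) \<Rightarrow> ('h \<Rightarrow> 'k::field) \<Rightarrow>
     ('k \<Rightarrow> 'r::{ring, monoid_mult} \<Rightarrow> 'r) \<Rightarrow> ('h \<Rightarrow> 'h \<Rightarrow> 'r) \<Rightarrow> ('h \<Rightarrow> 'h \<Rightarrow> 'r) \<Rightarrow> bool"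
  where "convolution_inverse \<Delta> \<epsilon> sR \<sigma> \<tau> \<longleftrightarrow>
    (\<forall>h g. (\<Sum>(h1, h2) \<leftarrow> sweedler \<Delta> h. \<Sum>(g1, g2) \<leftarrow> sweedler \<Delta> g. \<sigma> h1 g1 * \<tau> h2 g2) =
             sR (\<epsilon> h * \<epsilon> g) 1 \<and>
           (\<Sum>(h1, h2) \<leftarrow> sweedler \<Delta> h. \<Sum>(g1, g2) \<leftarrow> sweedler \<Delta> g. \<tau> h1 g1 * \<sigma> h2 g2) =
             sR (\<epsilon> h * \<epsilon> g) 1)"

definition twisted_module_algebra ::
    "('k::field \<Rightarrow> 'h::ring_1 \<Rightarrow> 'h) \<Rightarrow> ('h \<Rightarrow> ('h \<times> 'h) list set) \<Rightarrow> ('h \<Rightarrow> 'k) \<Rightarrow>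
     ('k \<Rightarrow> 'r::{ring, monoid_mult} \<Rightarrow> 'r) \<Rightarrow> ('h \<Rightarrow> 'r \<Rightarrow> 'r) \<Rightarrow> ('h \<Rightarrow> 'h \<Rightarrow> 'r) \<Rightarrow> bool"
  where "twisted_module_algebra sH \<Delta> \<epsilon> sR act \<sigma> \<longleftrightarrow>
    weak_action sH \<Delta> sR act \<and> bilinear_map sH sH sR \<sigma> \<and>
    (\<exists>\<tau>. bilinear_map sH sH sR \<tau> \<and> convolution_inverse \<Delta> \<epsilon> sR \<sigma> \<tau> \<and>
      (\<forall>h g r. act h (act g r) =
        (\<Sum>(h1, h2, h3) \<leftarrow> sweedler3 \<Delta> h. \<Sum>(g1, g2, g3) \<leftarrow> sweedler3 \<Delta> g.
          \<sigma> h1 g1 * act (h2 * g2) r * \<tau> h3 g3)))"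

text \<open>
  The crossed product on \<open>R \<otimes> H\<close>, with candidate unit \<open>1 # 1\<close>. It need not be a ring: associativity
  and the unit laws are properties of \<open>act\<close> and \<open>\<sigma>\<close>.
\<close>

definition crossed_product ::
    "('k::field \<Rightarrow> 'h::ring_1 \<Rightarrow> 'h) \<Rightarrow> ('h \<Rightarrow> ('h \<times> 'h) list set) \<Rightarrow>
     ('k \<Rightarrow> 'r::{ring, monoid_mult} \<Rightarrow> 'r) \<Rightarrow> ('h \<Rightarrow> 'r \<Rightarrow> 'r) \<Rightarrow> ('h \<Rightarrow> 'h \<Rightarrow> 'r) \<Rightarrow>
     ('r \<times> 'h) list set ring"
  where "crossed_product sH \<Delta> sR act \<sigma> =
    \<lparr>carrier = tensor_product sR sH,
     monoid.mult = (\<lambda>X Y. tensor sR sH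
       [(a * act h1 b * \<sigma> h2 g1, h3 * g2).
         (a, h) \<leftarrow> tensor_rep X, (b, g) \<leftarrow> tensor_rep Y,
         (h1, h2, h3) \<leftarrow> sweedler3 \<Delta> h, (g1, g2) \<leftarrow> sweedler \<Delta> g]),
     one = tensor sR sH [(1, 1)],
     ring.zero = tensor sR sH [],
     add = (\<lambda>X Y. tensor sR sH (tensor_rep X @ tensor_rep Y))\<rparr>"

text \<open>The image of \<open>I \<otimes> H\<close> in \<open>R \<otimes> H\<close>.\<close>

definition crossed_subspace ::
    "('k::field \<Rightarrow> 'h::ring_1 \<Rightarrow> 'h) \<Rightarrow> ('k \<Rightarrow> 'r::{ring, monoid_mult} \<Rightarrow> 'r) \<Rightarrow>
     'r set \<Rightarrow> ('r \<times> 'h) list set set"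
  where "crossed_subspace sH sR I = tensor sR sH ` {xs. set xs \<subseteq> I \<times> UNIV}"


section \<open>Radicals\<close>

definition stable_part :: "('h \<Rightarrow> 'r \<Rightarrow> 'r) \<Rightarrow> 'r set \<Rightarrow> 'r set"
  where "stable_part act I = {x. \<forall>h. act h x \<in> I}"

definition r_jH :: "('h \<Rightarrow> 'r::{ring, monoid_mult} \<Rightarrow> 'r) \<Rightarrow> 'r set"
  where "r_jH act = stable_part act (jacobson_radical type_ring)"

text \<open>
  The underlying vector space of an \<open>R\<close>-\<open>H\<close>-module is a subspace \<open>M\<close> of an ambient vector space;
  \<open>rmul\<close> and \<open>hmul\<close> are only relevant on \<open>M\<close>.
\<close>

locale RH_module = vector_space sM
  for sH :: "'k::field \<Rightarrow> 'h::ring_1 \<Rightarrow> 'h"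
    and \<Delta> :: "'h \<Rightarrow> ('h \<times> 'h) list set"
    and sR :: "'k \<Rightarrow> 'r::{ring, monoid_mult} \<Rightarrow> 'r"
    and act :: "'h \<Rightarrow> 'r \<Rightarrow> 'r"
    and \<sigma> :: "'h \<Rightarrow> 'h \<Rightarrow> 'r"
    and sM :: "'k \<Rightarrow> 'm::ab_group_add \<Rightarrow> 'm"
    and M :: "'m set"
    and rmul :: "'r \<Rightarrow> 'm \<Rightarrow> 'm"
    and hmul :: "'h \<Rightarrow> 'm \<Rightarrow> 'm" +
  assumes subspace_M: "subspace M"
    and rmul_closed: "m \<in> M \<Longrightarrow> rmul a m \<in> M"
    and rmul_add_left: "m \<in> M \<Longrightarrow> rmul (a + b) m = rmul a m + rmul b m"
    and rmul_add_right: "m \<in> M \<Longrightarrow> n \<in> M \<Longrightarrow> rmul a (m + n) = rmul a m + rmul a n"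
    and rmul_scale_left: "m \<in> M \<Longrightarrow> rmul (sR c a) m = sM c (rmul a m)"
    and rmul_scale_right: "m \<in> M \<Longrightarrow> rmul a (sM c m) = sM c (rmul a m)"
    and rmul_mult: "m \<in> M \<Longrightarrow> rmul (a * b) m = rmul a (rmul b m)"
    and hmul_closed: "m \<in> M \<Longrightarrow> hmul h m \<in> M"
    and hmul_add_left: "m \<in> M \<Longrightarrow> hmul (h + g) m = hmul h m + hmul g m"
    and hmul_add_right: "m \<in> M \<Longrightarrow> n \<in> M \<Longrightarrow> hmul h (m + n) = hmul h m + hmul h n"
    and hmul_scale_left: "m \<in> M \<Longrightarrow> hmul (sH c h) m = sM c (hmul h m)"
    and hmul_scale_right: "m \<in> M \<Longrightarrow> hmul h (sM c m) = sM c (hmul h m)"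
    and hmul_one: "m \<in> M \<Longrightarrow> hmul 1 m = m"
    and hmul_rmul: "m \<in> M \<Longrightarrow>
      hmul h (rmul a m) = (\<Sum>(h1, h2) \<leftarrow> sweedler \<Delta> h. rmul (act h1 a) (hmul h2 m))"
    and hmul_hmul: "m \<in> M \<Longrightarrow>
      hmul h (hmul g m) = (\<Sum>(h1, h2) \<leftarrow> sweedler \<Delta> h. \<Sum>(g1, g2) \<leftarrow> sweedler \<Delta> g.
        rmul (\<sigma> h1 g1) (hmul (h2 * g2) m))"
begin

definition RH_submodule :: "'m set \<Rightarrow> bool"
  where "RH_submodule N \<longleftrightarrow> subspace N \<and> N \<subseteq> M \<and>
    (\<forall>a. \<forall>m \<in> N. rmul a m \<in> N) \<and> (\<forall>h. \<forall>m \<in> N. hmul h m \<in> N)"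

end

locale RH_irreducible = RH_module +
  assumes rmul_nonzero: "\<exists>a. \<exists>m \<in> M. rmul a m \<noteq> 0"
    and irreducible: "RH_submodule N \<Longrightarrow> N = {0} \<or> N = M"

text \<open>
  HOL cannot quantify over modules of all types in a definition. It suffices to consider modules
  whose underlying space is a subspace of the free vector space on \<open>R \<times> H\<close>, as every
  \<open>R\<close>-\<open>H\<close>-irreducible module is isomorphic to one of these; see
  \<open>H_jacobson_radical_annihilates\<close> below.
\<close>

definition H_jacobson_radical ::
    "('k::field \<Rightarrow> 'h::ring_1 \<Rightarrow> 'h) \<Rightarrow> ('h \<Rightarrow> ('h \<times> 'h) list set) \<Rightarrow>
     ('k \<Rightarrow> 'r::{ring, monoid_mult} \<Rightarrow> 'r) \<Rightarrow> ('h \<Rightarrow> 'r \<Rightarrow> 'r) \<Rightarrow> ('h \<Rightarrow> 'h \<Rightarrow> 'r) \<Rightarrow> 'r set"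
  where "H_jacobson_radical sH \<Delta> sR act \<sigma> =
    {a. \<forall>(M :: ('r \<times> 'h \<Rightarrow>\<^sub>0 'k) set) rmul hmul.
          RH_irreducible sH \<Delta> sR act \<sigma> free_scale M rmul hmul \<longrightarrow> (\<forall>m \<in> M. rmul a m = 0)}"

section \<open>Independence of the choices in the definitions\<close>

lemma lookup_free_scale: "Poly_Mapping.lookup (free_scale c f) x = c * Poly_Mapping.lookup f x"
  by (simp add: free_scale_def map.rep_eq when_def)

lemma vector_space_free_scale: "vector_space free_scale"
  by unfold_locales
    (rule poly_mapping_eqI, simp add: lookup_free_scale lookup_add algebra_simps)+

definition free_extension :: "('k::field \<Rightarrow> 'w::ab_group_add \<Rightarrow> 'w) \<Rightarrow> ('x \<Rightarrow> 'w) \<Rightarrow> ('x \<Rightarrow>\<^sub>0 'k) \<Rightarrow> 'w"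
  where "free_extension sW f p = (\<Sum>x\<in>Poly_Mapping.keys p. sW (Poly_Mapping.lookup p x) (f x))"

lemma free_extension_superset:
  assumes "vector_space sW" "finite A" "Poly_Mapping.keys p \<subseteq> A"
  shows "free_extension sW f p = (\<Sum>x\<in>A. sW (Poly_Mapping.lookup p x) (f x))"
proof -
  interpret vector_space sW by fact
  show ?thesis
    unfolding free_extension_def
    by (rule sum.mono_neutral_left) (use assms in \<open>auto simp: in_keys_iff\<close>)
qed

lemma linear_free_extension:
  assumes "vector_space sW"
  shows "Vector_Spaces.linear free_scale sW (free_extension sW f)"
proof -
  interpret W: vector_space sW by fact
  interpret F: vector_space free_scale by (rule vector_space_free_scale)
  show ?thesis
  proof unfold_locales
    fix p q :: "'c \<Rightarrow>\<^sub>0 'a"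
    let ?A = "Poly_Mapping.keys p \<union> Poly_Mapping.keys q"
    have A: "finite ?A" by simp
    have "free_extension sW f (p + q) = (\<Sum>x\<in>?A. sW (Poly_Mapping.lookup (p + q) x) (f x))"
      by (rule free_extension_superset[OF assms A Poly_Mapping.keys_add])
    also have "\<dots> = (\<Sum>x\<in>?A. sW (Poly_Mapping.lookup p x) (f x)) + (\<Sum>x\<in>?A. sW (Poly_Mapping.lookup q x) (f x))"
      by (simp add: lookup_add W.scale_left_distrib sum.distrib)
    also have "\<dots> = free_extension sW f p + free_extension sW f q"
      using free_extension_superset[OF assms A, of p f] free_extension_superset[OF assms A, of q f]
      by simp
    finally show "free_extension sW f (p + q) = free_extension sW f p + free_extension sW f q" .
  next
    fix c and p :: "'c \<Rightarrow>\<^sub>0 'a"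
    have "Poly_Mapping.keys (free_scale c p) \<subseteq> Poly_Mapping.keys p"
      by (auto simp: in_keys_iff lookup_free_scale)
    from free_extension_superset[OF assms finite_keys this, of f]
    have "free_extension sW f (free_scale c p) = (\<Sum>x\<in>Poly_Mapping.keys p. sW c (sW (Poly_Mapping.lookup p x) (f x)))"
      by (simp add: lookup_free_scale)
    also have "\<dots> = sW c (free_extension sW f p)"
      by (simp add: free_extension_def W.scale_sum_right)
    finally show "free_extension sW f (free_scale c p) = sW c (free_extension sW f p)" .
  qed
qed

lemma free_extension_single:
  assumes "vector_space sW"
  shows "free_extension sW f (Poly_Mapping.single x c) = sW c (f x)"
proof -
  interpret vector_space sW by fact
  show ?thesis
    by (cases "c = 0") (simp_all add: free_extension_def)
qed

text \<open>Bilinear sums do not depend on the representation of a tensor.\<close>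

lemma tensor_sum_cong:
  assumes f: "bilinear_map sU sV sW f" and eq: "tensor sU sV xs = tensor sU sV ys"
  shows "(\<Sum>(u, v)\<leftarrow>xs. f u v) = (\<Sum>(u, v)\<leftarrow>ys. f u v)"
proof -
  have lin: "Vector_Spaces.linear sV sW (f u)" "Vector_Spaces.linear sU sW (\<lambda>u. f u v)" for u v
    using f by (auto simp: bilinear_map_def)
  interpret F: vector_space free_scale by (rule vector_space_free_scale)
  interpret W: vector_space sW
    using lin(1)[of undefined] by (auto simp: Vector_Spaces.linear_def)
  interpret e: Vector_Spaces.linear free_scale sW "free_extension sW (\<lambda>(u, v). f u v)"
    by (rule linear_free_extension) (rule W.vector_space_axioms)
  let ?e = "free_extension sW (\<lambda>(u, v). f u v)"
  have single: "?e (Poly_Mapping.single (u, v) c) = sW c (f u v)" for u v c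
    by (simp add: free_extension_single[OF W.vector_space_axioms])
  have sum: "?e (formal_sum zs) = (\<Sum>(u, v)\<leftarrow>zs. f u v)" for zs
    by (induction zs) (auto simp: formal_sum_def e.add e.zero single)
  have bilin: "f (u + u') v = f u v + f u' v" "f u (v + v') = f u v + f u v'"
    "f (sU c u) v = sW c (f u v)" "f u (sV c v) = sW c (f u v)" for u u' v v' c
    using lin(1)[of u] lin(2)[of v]
    by (auto simp: Vector_Spaces.linear_iff)
  have zero: "?e p = 0" if "p \<in> tensor_relations sU sV" for p
    using that unfolding tensor_relations_def
  proof (induction rule: F.span_induct_alt)
    case (step c x y)
    then show ?case
      by (auto simp: e.add e.scale e.diff sum bilin)
  qed (rule e.zero)
  have "ys \<in> tensor sU sV xs"
    unfolding eq by (simp add: tensor_def tensor_relations_def F.span_zero)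
  then have "?e (formal_sum ys - formal_sum xs) = 0"
    by (intro zero) (simp add: tensor_def)
  then show ?thesis
    by (simp add: e.diff sum)
qed

text \<open>A linear bijection onto a subspace transports irreducible modules.\<close>

lemma RH_irreducible_transport:
  fixes sM :: "'k::field \<Rightarrow> 'm::ab_group_add \<Rightarrow> 'm" and sN :: "'k \<Rightarrow> 'n::ab_group_add \<Rightarrow> 'n"
  assumes "RH_irreducible sH \<Delta> sR act \<sigma> sM M rmul hmul"
    and phi: "Vector_Spaces.linear sN sM \<phi>" and psi: "Vector_Spaces.linear sM sN \<psi>"
    and inv: "\<And>m. m \<in> M \<Longrightarrow> \<phi> (\<psi> m) = m"
  shows "RH_irreducible sH \<Delta> sR act \<sigma> sN (\<psi> ` M)
    (\<lambda>a n. \<psi> (rmul a (\<phi> n))) (\<lambda>h n. \<psi> (hmul h (\<phi> n)))"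
proof -
  interpret M: RH_irreducible sH \<Delta> sR act \<sigma> sM M rmul hmul by fact
  interpret p: Vector_Spaces.linear sN sM \<phi> by fact
  interpret q: Vector_Spaces.linear sM sN \<psi> by fact
  have sum: "\<psi> (sum_list (map f xs)) = sum_list (map (\<lambda>x. \<psi> (f x)) xs)" for f and xs :: "'x list"
    by (induction xs) (simp_all add: q.add q.zero)
  note simps = inv M.rmul_closed M.hmul_closed
  interpret N: RH_module sH \<Delta> sR act \<sigma> sN "\<psi> ` M"
      "\<lambda>a n. \<psi> (rmul a (\<phi> n))" "\<lambda>h n. \<psi> (hmul h (\<phi> n))"
  proof unfold_locales
    show "p.vs1.subspace (\<psi> ` M)"
      using q.subspace_image[OF M.subspace_M] by simp
  next
    fix m h a assume "m \<in> \<psi> ` M"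
    then show "\<psi> (hmul h (\<phi> (\<psi> (rmul a (\<phi> m))))) =
       (\<Sum>(h1, h2)\<leftarrow>sweedler \<Delta> h. \<psi> (rmul (act h1 a) (\<phi> (\<psi> (hmul h2 (\<phi> m))))))"
      by (auto simp: simps M.hmul_rmul sum case_prod_unfold)
  next
    fix m h g assume "m \<in> \<psi> ` M"
    then show "\<psi> (hmul h (\<phi> (\<psi> (hmul g (\<phi> m))))) =
       (\<Sum>(h1, h2)\<leftarrow>sweedler \<Delta> h. \<Sum>(g1, g2)\<leftarrow>sweedler \<Delta> g.
         \<psi> (rmul (\<sigma> h1 g1) (\<phi> (\<psi> (hmul (h2 * g2) (\<phi> m))))))"
      by (auto simp: simps M.hmul_hmul sum case_prod_unfold)
  qed (auto simp: simps p.add p.scale q.add[symmetric] q.scale[symmetric]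
      M.rmul_add_left M.rmul_add_right M.rmul_scale_left M.rmul_scale_right M.rmul_mult
      M.hmul_add_left M.hmul_add_right M.hmul_scale_left M.hmul_scale_right M.hmul_one)
  show ?thesis
  proof
    obtain a m where am: "m \<in> M" "rmul a m \<noteq> 0"
      using M.rmul_nonzero by blast
    have "\<psi> (rmul a m) \<noteq> 0"
      using am inv[OF M.rmul_closed[OF am(1), of a]] p.zero by metis
    then show "\<exists>a. \<exists>m\<in>\<psi> ` M. \<psi> (rmul a (\<phi> m)) \<noteq> 0"
      using am by (auto simp: inv)
  next
    fix L assume L: "N.RH_submodule L"
    have L_sub: "p.vs1.subspace L" "L \<subseteq> \<psi> ` M"
      using L by (auto simp: N.RH_submodule_def)
    have psi_phi: "\<psi> (\<phi> n) = n" if "n \<in> L" for n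
      using that L_sub(2) by (auto simp: inv)
    have "\<phi> ` L \<subseteq> M"
      using L_sub(2) by (auto simp: inv)
    have "M.RH_submodule (\<phi> ` L)"
      unfolding M.RH_submodule_def
    proof (intro conjI allI ballI)
      show "M.subspace (\<phi> ` L)"
        using p.subspace_image[OF L_sub(1)] by simp
      show "\<phi> ` L \<subseteq> M" by fact
    next
      fix a m assume "m \<in> \<phi> ` L"
      then obtain n where n: "n \<in> L" "m = \<phi> n" by blast
      then have "\<psi> (rmul a m) \<in> L"
        using L by (auto simp: N.RH_submodule_def)
      moreover have "\<phi> (\<psi> (rmul a m)) = rmul a m"
        using n \<open>\<phi> ` L \<subseteq> M\<close> by (intro inv M.rmul_closed) auto
      ultimately show "rmul a m \<in> \<phi> ` L" by (metis imageI)
    next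
      fix h m assume "m \<in> \<phi> ` L"
      then obtain n where n: "n \<in> L" "m = \<phi> n" by blast
      then have "\<psi> (hmul h m) \<in> L"
        using L by (auto simp: N.RH_submodule_def)
      moreover have "\<phi> (\<psi> (hmul h m)) = hmul h m"
        using n \<open>\<phi> ` L \<subseteq> M\<close> by (intro inv M.hmul_closed) auto
      ultimately show "hmul h m \<in> \<phi> ` L" by (metis imageI)
    qed
    then have "\<phi> ` L = {0} \<or> \<phi> ` L = M"
      by (rule M.irreducible)
    moreover have "L = \<psi> ` \<phi> ` L"
      using psi_phi by (auto simp: image_image)
    ultimately show "L = {0} \<or> L = \<psi> ` M"
      using q.zero by (metis image_empty image_insert)
  qed
qed

text \<open>
  The definition of the radical only refers to modules inside one vector space, but its elements
  annihilate irreducible modules \<open>M\<close> over every type: if \<open>m \<in> M\<close> satisfies \<open>R m \<noteq> 0\<close>, then the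
  vectors \<open>a(hm)\<close> span \<open>M\<close>, so that \<open>M\<close> is a linear image of the free vector space on \<open>R \<times> H\<close>.
\<close>

theorem H_jacobson_radical_annihilates:
  fixes sM :: "'k::field \<Rightarrow> 'm::ab_group_add \<Rightarrow> 'm"
  assumes "RH_irreducible sH \<Delta> sR act \<sigma> sM M rmul hmul"
    and a: "a \<in> H_jacobson_radical sH \<Delta> sR act \<sigma>" and m: "m \<in> M"
  shows "rmul a m = 0"
proof -
  interpret M: RH_irreducible sH \<Delta> sR act \<sigma> sM M rmul hmul by fact
  obtain b x where x: "x \<in> M" "rmul b x \<noteq> 0"
    using M.rmul_nonzero by blast
  define G where "G = range (\<lambda>(c, h). rmul c (hmul h x))"
  define N where "N = M.span G"
  have "G \<subseteq> M"
    using x by (auto simp: G_def M.rmul_closed M.hmul_closed)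
  then have "N \<subseteq> M"
    unfolding N_def by (intro M.span_minimal M.subspace_M)
  have sum_N: "sum_list (map f xs) \<in> N" if "\<And>z. z \<in> set xs \<Longrightarrow> f z \<in> N" for f and xs :: "'x list"
    using that unfolding N_def by (induction xs) (auto intro: M.span_add M.span_zero)
  have rmul_zero: "rmul c 0 = 0" for c
    using M.rmul_add_right[of 0 0 c] M.subspace_0[OF M.subspace_M] by simp
  have hmul_zero: "hmul c 0 = 0" for c
    using M.hmul_add_right[of 0 0 c] M.subspace_0[OF M.subspace_M] by simp
  have rmul_G: "rmul c y \<in> N" if y_in: "y \<in> G" for c y
  proof -
    obtain d h where "y = rmul d (hmul h x)"
      using y_in unfolding G_def by fast
    then have "rmul c y = rmul (c * d) (hmul h x)"
      by (simp add: M.rmul_mult M.hmul_closed x)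
    then show ?thesis
      unfolding N_def G_def by (auto intro!: M.span_base)
  qed
  have rmul_N: "rmul c y \<in> N" if "y \<in> N" for c y
  proof -
    have "y \<in> M \<and> rmul c y \<in> N"
      using that unfolding N_def
    proof (induction rule: M.span_induct_alt)
      case base
      then show ?case
        using M.subspace_0[OF M.subspace_M] by (simp add: rmul_zero M.span_zero)
    next
      case (step k z y)
      then have "z \<in> M" "sM k z \<in> M"
        using \<open>G \<subseteq> M\<close> M.subspace_scale[OF M.subspace_M] by auto
      with step show ?case
        using rmul_G[of z c] M.subspace_add[OF M.subspace_M]
        by (auto simp: M.rmul_add_right M.rmul_scale_right N_def intro: M.span_add M.span_scale)
    qed
    then show ?thesis ..
  qed
  have hmul_G: "hmul g y \<in> N" if y_in: "y \<in> G" for g y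
  proof -
    obtain d h where y: "y = rmul d (hmul h x)"
      using y_in unfolding G_def by fast
    have "rmul c (hmul h' x) \<in> N" for c h'
      unfolding N_def G_def by (auto intro!: M.span_base)
    then have "rmul c (hmul h1 (hmul h2 x)) \<in> N" for c h1 h2
      by (subst M.hmul_hmul[OF x(1)]) (intro rmul_N sum_N, auto intro: sum_N)
    then show ?thesis
      unfolding y by (subst M.hmul_rmul[OF M.hmul_closed[OF x(1)]]) (intro sum_N, auto)
  qed
  have hmul_N: "hmul g y \<in> N" if "y \<in> N" for g y
  proof -
    have "y \<in> M \<and> hmul g y \<in> N"
      using that unfolding N_def
    proof (induction rule: M.span_induct_alt)
      case base
      then show ?case
        using M.subspace_0[OF M.subspace_M] by (simp add: hmul_zero M.span_zero)
    next
      case (step k z y)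
      then have "z \<in> M" "sM k z \<in> M"
        using \<open>G \<subseteq> M\<close> M.subspace_scale[OF M.subspace_M] by auto
      with step show ?case
        using hmul_G[of z g] M.subspace_add[OF M.subspace_M]
        by (auto simp: M.hmul_add_right M.hmul_scale_right N_def intro: M.span_add M.span_scale)
    qed
    then show ?thesis ..
  qed
  have "M.RH_submodule N"
    unfolding M.RH_submodule_def using rmul_N hmul_N \<open>N \<subseteq> M\<close> by (auto simp: N_def)
  moreover have "rmul b x \<in> N"
  proof -
    have "rmul b (hmul 1 x) \<in> G"
      unfolding G_def by (rule range_eqI[of _ _ "(b, 1)"]) simp
    then show ?thesis
      using x(1) by (simp add: M.hmul_one N_def M.span_base)
  qed
  ultimately have "N = M"
    using M.irreducible x(2) by blast

  define \<phi> where "\<phi> = free_extension sM (\<lambda>(c, h). rmul c (hmul h x))"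
  have phi: "Vector_Spaces.linear free_scale sM \<phi>"
    unfolding \<phi>_def by (rule linear_free_extension) (rule M.vector_space_axioms)
  interpret p: Vector_Spaces.linear free_scale sM \<phi> by (rule phi)
  interpret vector_space_pair free_scale sM
    by (intro vector_space_pair.intro vector_space_free_scale M.vector_space_axioms)
  have "\<phi> (Poly_Mapping.single (c, h) 1) = rmul c (hmul h x)" for c h
    unfolding \<phi>_def by (simp add: free_extension_single[OF M.vector_space_axioms])
  then have "G \<subseteq> range \<phi>"
    unfolding G_def by (auto intro: range_eqI[OF sym])
  then have "N \<subseteq> range \<phi>"
    unfolding N_def using p.subspace_image[OF p.vs1.subspace_UNIV] by (intro M.span_minimal) auto
  moreover obtain \<psi> where psi: "Vector_Spaces.linear sM free_scale \<psi>"
    and inv: "\<forall>v\<in>range \<phi>. \<phi> (\<psi> v) = v"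
    using linear_exists_right_inverse_on[OF phi p.vs1.subspace_UNIV] by blast
  ultimately have inv': "\<phi> (\<psi> v) = v" if "v \<in> M" for v
    using that \<open>N = M\<close> by blast
  have "RH_irreducible sH \<Delta> sR act \<sigma> free_scale (\<psi> ` M)
    (\<lambda>a n. \<psi> (rmul a (\<phi> n))) (\<lambda>h n. \<psi> (hmul h (\<phi> n)))"
    using assms(1) phi psi inv' by (rule RH_irreducible_transport)
  with a m have "\<psi> (rmul a (\<phi> (\<psi> m))) = 0"
    unfolding H_jacobson_radical_def by blast
  then have "\<phi> (\<psi> (rmul a m)) = 0"
    using m p.zero by (simp add: inv')
  then show ?thesis
    using m by (simp add: inv' M.rmul_closed)
qed

end

theory Submission
  imports Defs "HOL-Library.Function_Algebras" "HOL-Library.Set_Algebras"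
begin

text \<open>
  Over an algebraically closed field, a cocommutative cosemisimple Hopf algebra is spanned by its
  grouplike elements, and the characters of a commutative semisimple Hopf algebra separate its points.
  In both cases one obtains a finite group \<open>G\<close> whose order is invertible in the field, because of the
  integral of the algebra or its dual. Write \<open>A\<close> for the crossed product.

  If \<open>H\<close> is spanned by \<open>G\<close>, then \<open>A\<close> is a crossed product of \<open>R\<close> with a group: \<open>J(R)\<close> is stable under
  \<open>G\<close>, so \<open>J(R) \<subseteq> J(A)\<close> by Nakayama's lemma, and an averaging argument in the style of Maschke's
  theorem, applied to \<open>A / A L\<close> for maximal left ideals \<open>L\<close> of \<open>R\<close>, shows \<open>J(A) \<subseteq> J(R) # H\<close>.

  If \<open>G\<close> consists of characters, then \<open>G\<close> acts on \<open>A\<close> by automorphisms with fixed ring \<open>R\<close>. The same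
  averaging argument now shows \<open>J(R) \<subseteq> J(A)\<close>, and \<open>J(A) \<subseteq> J(R) # H\<close> because \<open>A\<close> has Galois coordinates
  over \<open>R\<close>: \<open>z = \<Sum> tr(z x\<^sub>i) y\<^sub>i\<close> with \<open>tr(z x\<^sub>i) \<in> J(A) \<inter> R = J(R)\<close> for \<open>z \<in> J(A)\<close>.

  Finally, irreducible \<open>R\<close>-\<open>H\<close>-modules are the irreducible \<open>A\<close>-modules.
\<close>

text \<open>Both averaging arguments work with elements instead of projection maps on quotients. A
  module is split as \<open>U + C\<close> with \<open>U \<inter> C \<subseteq> N\<close>, where
  \<open>U\<close> carries the radical in question, and the components of suitable elements are
  averaged. The outcome is \<open>e = j + s\<close> up to elements of a left ideal, with
  \<open>j\<close> in a radical and \<open>s\<close> sent into that ideal by the radical. Since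
  \<open>1 - j\<close> is invertible, the radical itself lies in the ideal. The averaging needs
  \<open>1 / |G|\<close>: for grouplike elements the coefficients of an integral are all equal to
  some \<open>c\<close>, and its counit gives \<open>|G| c = 1\<close>; for characters, their sum is
  an integral of the dual, and cosemisimplicity prevents it from vanishing at \<open>1\<close>.

  Algebraic closure enters through common eigenvectors of commuting operators: the operators
  \<open>translate f\<close> lead to grouplike elements, multiplications lead to characters.

  Neither the action nor \<open>\<sigma>\<close> is assumed to be normalised. The unit law of the
  crossed product supplies \<open>h \<cdot> 1 = \<epsilon>(h)\<close> and the corresponding values
  of \<open>\<sigma>\<close>.\<close>

section \<open>Rings with a left and right unit on a part of the type\<close>

text \<open>
  The multiplication is total on the type, and \<open>{x. e \<odot> x = x}\<close> is the ring of interest. This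
  avoids carrier conditions in the ring laws.
\<close>

locale corner_ring =
  fixes mul :: "'a::ab_group_add \<Rightarrow> 'a \<Rightarrow> 'a" (infixl "\<odot>" 70)
    and e :: 'a
  assumes mul_assoc: "(x \<odot> y) \<odot> z = x \<odot> (y \<odot> z)"
    and distrib_left: "x \<odot> (y + z) = x \<odot> y + x \<odot> z"
    and distrib_right: "(x + y) \<odot> z = x \<odot> z + y \<odot> z"
    and unit_mul: "e \<odot> (x \<odot> y) = x \<odot> y"
    and unit_commute: "x \<odot> e = e \<odot> x"
    and unit_unit: "e \<odot> e = e"
begin

definition A :: "'a set" where "A = {x. e \<odot> x = x}"

lemma mul_unit_mul: "x \<odot> (e \<odot> y) = x \<odot> y"
  by (metis mul_assoc unit_mul unit_commute)

lemma mul_mul_unit: "x \<odot> (y \<odot> e) = x \<odot> y"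
  by (metis mul_assoc unit_mul unit_commute)

lemma mul_zero [simp]: "x \<odot> 0 = 0" "0 \<odot> x = 0"
  using distrib_left[of x 0 0] distrib_right[of 0 0 x] by auto

lemma mul_minus [simp]: "x \<odot> (- y) = - (x \<odot> y)" "(- x) \<odot> y = - (x \<odot> y)"
proof -
  have "x \<odot> (- y) + x \<odot> y = 0" "(- x) \<odot> y + x \<odot> y = 0"
    by (simp_all flip: distrib_left distrib_right)
  then show "x \<odot> (- y) = - (x \<odot> y)" "(- x) \<odot> y = - (x \<odot> y)"
    by (simp_all add: eq_neg_iff_add_eq_0)
qed

lemma distrib_left_diff: "x \<odot> (y - z) = x \<odot> y - x \<odot> z"
  using distrib_left[of x y "- z"] by simp

lemma distrib_right_diff: "(x - y) \<odot> z = x \<odot> z - y \<odot> z"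
  using distrib_right[of x "- y" z] by simp

lemmas distribs = distrib_left distrib_right distrib_left_diff distrib_right_diff mul_assoc

lemma mul_sum: "x \<odot> (\<Sum>i\<in>I. f i) = (\<Sum>i\<in>I. x \<odot> f i)"
  by (induction I rule: infinite_finite_induct) (auto simp: distrib_left)

lemma sum_mul: "(\<Sum>i\<in>I. f i) \<odot> x = (\<Sum>i\<in>I. f i \<odot> x)"
  by (induction I rule: infinite_finite_induct) (auto simp: distrib_right)

lemma mul_sum_list: "x \<odot> sum_list (map f xs) = (\<Sum>i\<leftarrow>xs. x \<odot> f i)"
  by (induction xs) (auto simp: distrib_left)

lemma sum_list_mul: "sum_list (map f xs) \<odot> x = (\<Sum>i\<leftarrow>xs. f i \<odot> x)"
  by (induction xs) (auto simp: distrib_right)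

lemma A_closed [simp, intro]:
  "x \<odot> y \<in> A" "e \<in> A" "0 \<in> A"
  "x \<in> A \<Longrightarrow> y \<in> A \<Longrightarrow> x + y \<in> A" "x \<in> A \<Longrightarrow> y \<in> A \<Longrightarrow> x - y \<in> A" "x \<in> A \<Longrightarrow> - x \<in> A"
  by (auto simp: A_def unit_mul unit_unit distrib_left distrib_left_diff)

lemma A_unit_left [simp]: "x \<in> A \<Longrightarrow> e \<odot> x = x"
  by (simp add: A_def)

lemma A_unit_right [simp]: "x \<in> A \<Longrightarrow> x \<odot> e = x"
  using unit_commute[of x] by simp

lemma A_sum [intro]: "(\<And>i. i \<in> I \<Longrightarrow> f i \<in> A) \<Longrightarrow> sum f I \<in> A"
  by (induction I rule: infinite_finite_induct) auto

lemma A_sum_list [intro]: "(\<And>i. i \<in> set xs \<Longrightarrow> f i \<in> A) \<Longrightarrow> sum_list (map f xs) \<in> A"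
  by (induction xs) auto

section \<open>Left ideals and the Jacobson radical of the corner\<close>

definition lideal :: "'a set \<Rightarrow> bool" where
  "lideal L \<longleftrightarrow> L \<subseteq> A \<and> 0 \<in> L \<and> (\<forall>x\<in>L. \<forall>y\<in>L. x + y \<in> L) \<and> (\<forall>a. \<forall>x\<in>L. a \<odot> x \<in> L)"

definition max_lideal :: "'a set \<Rightarrow> bool" where
  "max_lideal L \<longleftrightarrow> lideal L \<and> e \<notin> L \<and> (\<forall>J. lideal J \<longrightarrow> L \<subseteq> J \<longrightarrow> e \<notin> J \<longrightarrow> J = L)"

text \<open>Left quasi-regularity serves as the definition because it passes along automorphisms and
  retractions without mention of ideals. The elements \<open>a\<close> and \<open>u\<close> may lie
  outside \<open>A\<close>; this changes nothing, as \<open>a \<odot> x\<close> depends only on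
  \<open>e \<odot> a\<close>.\<close>

definition rad :: "'a set" where
  "rad = {x. x \<in> A \<and> (\<forall>a. \<exists>u. u \<odot> (e - a \<odot> x) = e)}"

lemma lidealD:
  assumes "lideal L"
  shows "x \<in> L \<Longrightarrow> x \<in> A" "0 \<in> L" "x \<in> L \<Longrightarrow> y \<in> L \<Longrightarrow> x + y \<in> L" "x \<in> L \<Longrightarrow> a \<odot> x \<in> L"
    "x \<in> L \<Longrightarrow> - x \<in> L" "x \<in> L \<Longrightarrow> y \<in> L \<Longrightarrow> x - y \<in> L"
proof -
  show 1: "x \<in> L \<Longrightarrow> x \<in> A" "0 \<in> L" "x \<in> L \<Longrightarrow> y \<in> L \<Longrightarrow> x + y \<in> L" "x \<in> L \<Longrightarrow> a \<odot> x \<in> L" for x y a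
    using assms by (auto simp: lideal_def)
  show 2: "x \<in> L \<Longrightarrow> - x \<in> L" for x
    using 1(1)[of x] 1(4)[of x "- e"] by simp
  show "x \<in> L \<Longrightarrow> y \<in> L \<Longrightarrow> x - y \<in> L"
    using 1(3)[of x "- y"] 2[of y] by simp
qed

lemma lideal_sum: "lideal L \<Longrightarrow> (\<And>i. i \<in> I \<Longrightarrow> f i \<in> L) \<Longrightarrow> sum f I \<in> L"
  by (induction I rule: infinite_finite_induct) (auto simp: lidealD)

lemma lideal_sum_list: "lideal L \<Longrightarrow> (\<And>i. i \<in> set xs \<Longrightarrow> f i \<in> L) \<Longrightarrow> sum_list (map f xs) \<in> L"
  by (induction xs) (auto simp: lidealD)

lemma lideal_eq_A: "lideal J \<Longrightarrow> e \<in> J \<longleftrightarrow> J = A"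
  using lidealD(1,4)[of J] by (metis A_closed(2) A_unit_right subsetI subset_antisym)

lemma max_lideal_lideal: "max_lideal L \<Longrightarrow> lideal L"
  by (simp add: max_lideal_def)

lemma max_lideal_exists:
  assumes "lideal I" "e \<notin> I"
  obtains L where "max_lideal L" "I \<subseteq> L"
proof -
  let ?S = "{J. lideal J \<and> I \<subseteq> J \<and> e \<notin> J}"
  have "\<exists>U\<in>?S. \<forall>X\<in>C. X \<subseteq> U" if C: "subset.chain ?S C" for C
  proof (cases "C = {}")
    case True
    then show ?thesis using assms by blast
  next
    case False
    have mem: "\<And>X. X \<in> C \<Longrightarrow> lideal X \<and> I \<subseteq> X \<and> e \<notin> X"
      using C by (auto simp: subset.chain_def)
    have "lideal (\<Union>C)"
      unfolding lideal_def
    proof (intro conjI ballI allI)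
      show "\<Union>C \<subseteq> A" "0 \<in> \<Union>C" using mem False lidealD by blast+
      show "a \<odot> x \<in> \<Union>C" if "x \<in> \<Union>C" for a x using that mem lidealD(4) by blast
      fix x y assume "x \<in> \<Union>C" "y \<in> \<Union>C"
      then obtain X Y where XY: "X \<in> C" "Y \<in> C" "x \<in> X" "y \<in> Y" by blast
      then have "X \<subseteq> Y \<or> Y \<subseteq> X"
        using C by (auto simp: subset_chain_def)
      then show "x + y \<in> \<Union>C"
        using XY mem lidealD(3) by (metis UnionI subsetD)
    qed
    then have "\<Union>C \<in> ?S" using mem False by blast
    then show ?thesis by blast
  qed
  then have "\<exists>L\<in>?S. \<forall>X\<in>?S. L \<subseteq> X \<longrightarrow> X = L"
    by (rule subset_Zorn)
  then obtain L where L: "L \<in> ?S" and L_max: "\<forall>X\<in>?S. L \<subseteq> X \<longrightarrow> X = L" ..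
  have "max_lideal L"
    unfolding max_lideal_def
  proof (intro conjI allI impI)
    fix J assume "lideal J" "L \<subseteq> J" "e \<notin> J"
    moreover from this L have "J \<in> ?S" by auto
    ultimately show "J = L" using L_max by simp
  qed (use L in auto)
  moreover have "I \<subseteq> L" using L by simp
  ultimately show ?thesis by (rule that)
qed

text \<open>This is the simplicity of \<open>A / L\<close> in the form used later: every nonzero
  class generates the quotient, so some multiple of it is the class of \<open>e\<close>.\<close>

lemma max_lideal_add_principal:
  assumes L: "max_lideal L" and x: "x \<in> A" "x \<notin> L"
  obtains l a where "l \<in> L" "e = l + a \<odot> x"
proof -
  note L' = lidealD[OF max_lideal_lideal[OF L]]
  let ?J = "{l + a \<odot> x | l a. l \<in> L}"
  have "lideal ?J"
    unfolding lideal_def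
  proof (intro conjI ballI allI subsetI)
    fix y assume "y \<in> ?J" then show "y \<in> A" using L'(1) by auto
  next
    have "0 = 0 + 0 \<odot> x" by simp
    then show "0 \<in> ?J" using L'(2) by blast
  next
    fix y z assume "y \<in> ?J" "z \<in> ?J"
    then obtain l a m b where "y = l + a \<odot> x" "z = m + b \<odot> x" "l \<in> L" "m \<in> L" by blast
    then have "y + z = (l + m) + (a + b) \<odot> x" "l + m \<in> L" by (auto simp: distribs L'(3))
    then show "y + z \<in> ?J" by blast
  next
    fix b y assume "y \<in> ?J"
    then obtain l a where "y = l + a \<odot> x" "l \<in> L" by blast
    then have "b \<odot> y = b \<odot> l + (b \<odot> a) \<odot> x" "b \<odot> l \<in> L" by (auto simp: distribs L'(4))
    then show "b \<odot> y \<in> ?J" by blast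
  qed
  moreover have "L \<subseteq> ?J"
  proof
    fix y assume "y \<in> L"
    moreover have "y = y + 0 \<odot> x" by simp
    ultimately show "y \<in> ?J" by blast
  qed
  moreover have "?J \<noteq> L"
  proof
    assume "?J = L"
    moreover have "x = 0 + e \<odot> x" using x by simp
    then have "x \<in> ?J" using L'(2) by blast
    ultimately show False using x by simp
  qed
  ultimately have "e \<in> ?J"
    using L unfolding max_lideal_def by blast
  with that show thesis by blast
qed

text \<open>If \<open>x\<close> avoids a maximal \<open>L\<close>, then some
  \<open>e - a \<odot> x\<close> lies in \<open>L\<close> and cannot be left invertible. If
  \<open>e - a \<odot> x\<close> has no left inverse, it generates a proper left ideal, and a
  maximal one above it cannot contain \<open>x\<close>.\<close>

lemma rad_eq: "rad = A \<inter> \<Inter>{L. max_lideal L}"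
proof (intro equalityI subsetI IntI InterI)
  fix x L assume x: "x \<in> rad" and "L \<in> {L. max_lideal L}"
  then have L: "max_lideal L" by simp
  note L' = lidealD[OF max_lideal_lideal[OF L]]
  show "x \<in> L"
  proof (rule ccontr)
    assume "x \<notin> L"
    then obtain l a where la: "l \<in> L" "e = l + a \<odot> x"
      using max_lideal_add_principal[OF L] x by (auto simp: rad_def)
    from x obtain u where u: "u \<odot> (e - a \<odot> x) = e" by (auto simp: rad_def)
    have "e - a \<odot> x = l" using la(2) by (simp add: algebra_simps)
    then have "e \<in> L" using L'(4)[OF la(1), of u] u by simp
    then show False using L by (simp add: max_lideal_def)
  qed
next
  fix x assume "x \<in> rad" then show "x \<in> A" by (simp add: rad_def)
next
  fix x assume x: "x \<in> A \<inter> \<Inter>{L. max_lideal L}"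
  show "x \<in> rad"
  proof (rule ccontr)
    assume "x \<notin> rad"
    then obtain a where a: "\<And>u. u \<odot> (e - a \<odot> x) \<noteq> e"
      using x by (auto simp: rad_def)
    let ?I = "range (\<lambda>u. u \<odot> (e - a \<odot> x))"
    have "lideal ?I"
      unfolding lideal_def
    proof (intro conjI ballI allI)
      show "0 \<in> ?I" by (rule range_eqI[of _ _ 0]) simp
      fix b y z assume y: "y \<in> ?I"
      from y show "b \<odot> y \<in> ?I" by (auto simp flip: mul_assoc)
      assume "z \<in> ?I"
      with y show "y + z \<in> ?I" by (auto simp flip: distrib_right)
    qed auto
    moreover have "e \<notin> ?I" using a by (metis rangeE)
    ultimately obtain L where L: "max_lideal L" "?I \<subseteq> L" by (rule max_lideal_exists)
    note L' = lidealD[OF max_lideal_lideal[OF L(1)]]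
    have "e - a \<odot> x = e \<odot> (e - a \<odot> x)" by simp
    then have "e - a \<odot> x \<in> L" using L(2) by blast
    moreover have "a \<odot> x \<in> L" using x L(1) L'(4) by blast
    ultimately have "e \<in> L" using L'(3)[of "e - a \<odot> x" "a \<odot> x"] by simp
    with L(1) show False by (simp add: max_lideal_def)
  qed
qed

lemma lideal_rad: "lideal rad"
  unfolding rad_eq lideal_def using lidealD max_lideal_lideal by (auto; blast)

lemmas radD = lidealD[OF lideal_rad]

text \<open>A left inverse \<open>u\<close> of \<open>e - x\<close> satisfies
  \<open>u = e - (- u \<odot> x)\<close>, so it is left invertible for the same reason as
  \<open>e - x\<close>, and its own left inverse must be \<open>e - x\<close>.\<close>

lemma rad_quasi_regular:
  assumes "x \<in> rad"
  obtains u where "u \<in> A" "u \<odot> (e - x) = e" "(e - x) \<odot> u = e"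
proof -
  have xA: "x \<in> A" using assms radD(1) by blast
  have inv: "\<exists>u\<in>A. u \<odot> (e - y) = e" if "y \<in> rad" for y
  proof -
    have "\<exists>u. u \<odot> (e - e \<odot> y) = e" using \<open>y \<in> rad\<close> unfolding rad_def by blast
    then obtain u where "u \<odot> (e - e \<odot> y) = e" ..
    then have "(u \<odot> e) \<odot> (e - y) = e" using radD(1)[OF that] by (simp add: mul_assoc)
    then show ?thesis by blast
  qed
  obtain u where u: "u \<in> A" "u \<odot> (e - x) = e" using inv[OF assms] by blast
  have "- u \<odot> x \<in> rad" using radD(4,5) assms by simp
  then obtain v where v: "v \<in> A" "v \<odot> (e - (- u \<odot> x)) = e" using inv by blast
  have "e - (- u \<odot> x) = u" using u by (simp add: distribs algebra_simps)
  with v have "v \<odot> u = e" by simp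
  have "v = v \<odot> (u \<odot> (e - x))"
    using u v by simp
  also have "\<dots> = e - x"
    using \<open>v \<odot> u = e\<close> xA by (simp flip: mul_assoc)
  finally have "v = e - x" .
  with u \<open>v \<odot> u = e\<close> show thesis
    by (intro that[of u]) simp_all
qed

text \<open>An inverse \<open>u\<close> of \<open>e - b \<odot> a \<odot> x\<close> yields the left
  inverse \<open>e + a \<odot> x \<odot> u \<odot> b\<close> of
  \<open>e - a \<odot> x \<odot> b\<close>, as the geometric series suggests.\<close>

lemma rad_mul_right: "x \<odot> b \<in> rad" if x: "x \<in> rad"
  unfolding rad_def
proof (intro CollectI conjI allI)
  fix a
  have "b \<odot> a \<odot> x \<in> rad" using radD(4)[OF x] by simp
  then obtain u where u: "u \<in> A" "(e - b \<odot> a \<odot> x) \<odot> u = e" "u \<odot> (e - b \<odot> a \<odot> x) = e"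
    using rad_quasi_regular by metis
  have "a \<odot> x \<odot> u \<odot> b - a \<odot> x \<odot> u \<odot> b \<odot> a \<odot> x \<odot> b = a \<odot> x \<odot> (u \<odot> (e - b \<odot> a \<odot> x)) \<odot> b"
    using u(1) radD(1)[OF x] by (simp add: distribs mul_unit_mul)
  also have "\<dots> = a \<odot> x \<odot> b"
    using u(3) by (metis mul_assoc mul_unit_mul)
  finally have eq: "a \<odot> x \<odot> u \<odot> b - a \<odot> x \<odot> u \<odot> b \<odot> a \<odot> x \<odot> b = a \<odot> x \<odot> b" .
  have "(e + a \<odot> x \<odot> u \<odot> b) \<odot> (e - a \<odot> (x \<odot> b)) = e - a \<odot> x \<odot> b +
      (a \<odot> x \<odot> u \<odot> b - a \<odot> x \<odot> u \<odot> b \<odot> a \<odot> x \<odot> b)"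
    by (simp add: distribs mul_mul_unit)
  also have "\<dots> = e" by (simp add: eq)
  finally have "(e + a \<odot> x \<odot> u \<odot> b) \<odot> (e - a \<odot> (x \<odot> b)) = e" .
  then show "\<exists>u. u \<odot> (e - a \<odot> (x \<odot> b)) = e" ..
qed auto

section \<open>Comparison with the radical of a ring given by a carrier\<close>

lemma left_ideal_transport:
  assumes B: "ring B" and f: "bij_betw f (carrier B) A"
    and add: "\<And>x y. x \<in> carrier B \<Longrightarrow> y \<in> carrier B \<Longrightarrow> f (x \<oplus>\<^bsub>B\<^esub> y) = f x + f y"
    and mult: "\<And>x y. x \<in> carrier B \<Longrightarrow> y \<in> carrier B \<Longrightarrow> f (x \<otimes>\<^bsub>B\<^esub> y) = f x \<odot> f y"
  shows "left_ideal B I \<longleftrightarrow> I \<subseteq> carrier B \<and> lideal (f ` I)"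
proof -
  interpret B: ring B by fact
  let ?C = "carrier B"
  have inj: "inj_on f ?C" and im: "f ` ?C = A" using f by (auto simp: bij_betw_def)
  have zero: "f \<zero>\<^bsub>B\<^esub> = 0"
    using add[of "\<zero>\<^bsub>B\<^esub>" "\<zero>\<^bsub>B\<^esub>"] by simp
  have mulA: "a \<odot> x = (e \<odot> a) \<odot> x" if "x \<in> A" for a x
    by (metis mul_assoc unit_mul)
  show ?thesis
  proof (intro iffI conjI; (elim conjE)?)
    assume I: "left_ideal B I"
    then have sub: "additive_subgroup I B" by (simp add: left_ideal_def)
    then show IC: "I \<subseteq> ?C" by (rule additive_subgroup.a_subset)
    show "lideal (f ` I)"
      unfolding lideal_def
    proof (intro conjI ballI allI)
      show "f ` I \<subseteq> A" using IC im by blast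
      show "0 \<in> f ` I"
        using zero additive_subgroup.zero_closed[OF sub] by (metis imageI)
      show "y + z \<in> f ` I" if "y \<in> f ` I" "z \<in> f ` I" for y z
        using that add additive_subgroup.a_closed[OF sub] IC by (smt (verit) imageE imageI subsetD)
      fix a y assume "y \<in> f ` I"
      then obtain x where x: "x \<in> I" "y = f x" by blast
      obtain b where b: "b \<in> ?C" "f b = e \<odot> a" using im A_closed(1)[of e a] by (metis imageE)
      have "f (b \<otimes>\<^bsub>B\<^esub> x) = a \<odot> y"
        using x b IC im mulA by (metis imageI mult subsetD)
      moreover have "b \<otimes>\<^bsub>B\<^esub> x \<in> I" using I x b by (auto simp: left_ideal_def)
      ultimately show "a \<odot> y \<in> f ` I" by (metis imageI)
    qed
  next
    assume IC: "I \<subseteq> ?C" and I: "lideal (f ` I)"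
    have mem: "x \<in> I" if "f x \<in> f ` I" "x \<in> ?C" for x
      using that inj IC by (meson inj_on_image_mem_iff)
    have addI: "x \<oplus>\<^bsub>B\<^esub> y \<in> I" if "x \<in> I" "y \<in> I" for x y
      using that IC lidealD(3)[OF I, of "f x" "f y"] by (intro mem) (auto simp: add subset_iff)
    have multI: "a \<otimes>\<^bsub>B\<^esub> x \<in> I" if "x \<in> I" "a \<in> ?C" for x a
      using that IC lidealD(4)[OF I] by (intro mem) (auto simp: mult subset_iff)
    have "\<ominus>\<^bsub>B\<^esub> x \<in> I" if "x \<in> I" for x
    proof -
      have "\<ominus>\<^bsub>B\<^esub> x = (\<ominus>\<^bsub>B\<^esub> \<one>\<^bsub>B\<^esub>) \<otimes>\<^bsub>B\<^esub> x" using that IC by (simp add: B.l_minus subset_iff)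
      then show ?thesis using multI[OF that, of "\<ominus>\<^bsub>B\<^esub> \<one>\<^bsub>B\<^esub>"] by simp
    qed
    moreover have "\<zero>\<^bsub>B\<^esub> \<in> I"
      using lidealD(2)[OF I] zero by (intro mem) auto
    ultimately have "additive_subgroup I B"
      using IC addI by (intro additive_subgroup.intro subgroup.intro) (auto simp: a_inv_def)
    then show "left_ideal B I" using multI by (simp add: left_ideal_def)
  qed
qed

text \<open>Applied with the identity for \<open>R\<close> and with \<open>emb\<close> for the
  crossed product. Maximality is compared through \<open>e\<close>: a left ideal is proper exactly
  when it avoids \<open>e\<close>, and preimages are formed in the carrier, where \<open>f\<close>
  is injective.\<close>

lemma jacobson_radical_transport:
  assumes B: "ring B" and f: "bij_betw f (carrier B) A"
    and add: "\<And>x y. x \<in> carrier B \<Longrightarrow> y \<in> carrier B \<Longrightarrow> f (x \<oplus>\<^bsub>B\<^esub> y) = f x + f y"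
    and mult: "\<And>x y. x \<in> carrier B \<Longrightarrow> y \<in> carrier B \<Longrightarrow> f (x \<otimes>\<^bsub>B\<^esub> y) = f x \<odot> f y"
  shows "f ` jacobson_radical B = rad"
proof -
  let ?C = "carrier B"
  have inj: "inj_on f ?C" and im: "f ` ?C = A" using f by (auto simp: bij_betw_def)
  have left: "left_ideal B I \<longleftrightarrow> I \<subseteq> ?C \<and> lideal (f ` I)" for I
    using assms by (rule left_ideal_transport)
  have inv: "f ` (inv_into ?C f ` J) = J" "inv_into ?C f ` J \<subseteq> ?C" if "J \<subseteq> A" for J
    using image_inv_into_cancel[OF im that] that im by (simp, blast intro: inv_into_into)
  have eq: "I = J" if "f ` I = f ` J" "I \<subseteq> ?C" "J \<subseteq> ?C" for I J
    using inj_on_image_eq_iff[OF inj] that by blast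
  have max: "maximal_left_ideal B I \<longleftrightarrow> I \<subseteq> ?C \<and> max_lideal (f ` I)" for I
  proof -
    have ne: "J = ?C \<longleftrightarrow> e \<in> f ` J" if "left_ideal B J" for J
    proof -
      have J: "J \<subseteq> ?C" "lideal (f ` J)" using that left by simp_all
      have "e \<in> f ` J \<longleftrightarrow> f ` J = f ` ?C" using lideal_eq_A[OF J(2)] im by simp
      then show ?thesis using eq[of J ?C] J(1) by blast
    qed
    have "(\<forall>J. left_ideal B J \<longrightarrow> I \<subseteq> J \<longrightarrow> J = I \<or> J = ?C) \<longleftrightarrow>
       (\<forall>J. lideal J \<longrightarrow> f ` I \<subseteq> J \<longrightarrow> e \<notin> J \<longrightarrow> J = f ` I)" if I: "left_ideal B I"
    proof (intro iffI allI impI)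
      fix J assume *: "\<forall>J. left_ideal B J \<longrightarrow> I \<subseteq> J \<longrightarrow> J = I \<or> J = ?C"
        and J: "lideal J" "f ` I \<subseteq> J" "e \<notin> J"
      let ?J = "inv_into ?C f ` J"
      have JA: "J \<subseteq> A" using lidealD(1)[OF J(1)] by blast
      note J' = inv[OF JA]
      have lJ: "left_ideal B ?J" using J' J left by simp
      have "I \<subseteq> ?J"
      proof
        fix x assume x: "x \<in> I"
        then have "x \<in> ?C" "f x \<in> f ` ?J" using J(2) J' left I by auto
        then show "x \<in> ?J" using inj_on_image_mem_iff[OF inj _ J'(2)] by blast
      qed
      then have "?J = I \<or> ?J = ?C" using * lJ by blast
      then show "J = f ` I" using ne[OF lJ] J'(1) J(3) by metis
    next
      fix J assume *: "\<forall>J. lideal J \<longrightarrow> f ` I \<subseteq> J \<longrightarrow> e \<notin> J \<longrightarrow> J = f ` I"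
        and J: "left_ideal B J" "I \<subseteq> J"
      then have "lideal (f ` J)" "f ` I \<subseteq> f ` J" "I \<subseteq> ?C" "J \<subseteq> ?C"
        using left I by auto
      then show "J = I \<or> J = ?C" using ne[OF J(1)] eq[of J I] * by metis
    qed
    then show ?thesis
      unfolding maximal_left_ideal_def max_lideal_def using left[of I] ne[of I]
      by (cases "left_ideal B I") (simp_all, blast)
  qed
  show ?thesis
  proof (intro equalityI subsetI)
    fix y assume "y \<in> f ` jacobson_radical B"
    then obtain x where x: "x \<in> ?C" "\<And>I. maximal_left_ideal B I \<Longrightarrow> x \<in> I" "y = f x"
      by (auto simp: jacobson_radical_def)
    have "f x \<in> L" if L: "max_lideal L" for L
    proof -
      have "L \<subseteq> A" using lidealD(1)[OF max_lideal_lideal[OF L]] by blast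
      note L' = inv[OF this]
      then have "x \<in> inv_into ?C f ` L" using L max x(2) by simp
      then show ?thesis using L' by blast
    qed
    then show "y \<in> rad" using x im by (auto simp: rad_eq)
  next
    fix y assume y: "y \<in> rad"
    then obtain x where x: "x \<in> ?C" "y = f x" using im radD(1) by blast
    have "x \<in> I" if "maximal_left_ideal B I" for I
    proof -
      have "f x \<in> f ` I" "I \<subseteq> ?C" using that max y x by (auto simp: rad_eq)
      then show ?thesis using inj x by (meson inj_on_image_mem_iff)
    qed
    then have "x \<in> jacobson_radical B" using x by (auto simp: jacobson_radical_def)
    then show "y \<in> f ` jacobson_radical B" using x by blast
  qed
qed

end

section \<open>Radicals of finite extensions\<close>

lemma (in ab_group_add) diff_closed_plus:
  assumes "0 \<in> X" "\<And>x y. x \<in> X \<Longrightarrow> y \<in> X \<Longrightarrow> x - y \<in> X" "x \<in> X" "y \<in> X"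
  shows "x + y \<in> X"
  using assms(2)[OF assms(3) assms(2)[OF assms(1,4)]] by simp

text \<open>The predicate \<open>sub\<close> singles out the submodules, and the \<open>P g\<close> are simple modulo \<open>N\<close>.\<close>

lemma complement_exists:
  fixes N U :: "'m::ab_group_add set"
  assumes "finite G"
    and zero: "\<And>X. sub X \<Longrightarrow> 0 \<in> X"
    and diff: "\<And>X x y. sub X \<Longrightarrow> x \<in> X \<Longrightarrow> y \<in> X \<Longrightarrow> x - y \<in> X"
    and plus: "\<And>X Y. sub X \<Longrightarrow> sub Y \<Longrightarrow> sub (X + Y)"
    and sub: "sub {0}" "sub N" "sub U" "N \<subseteq> U"
    and P: "\<And>g. g \<in> G \<Longrightarrow> sub (P g)"
    and simple: "\<And>g X. g \<in> G \<Longrightarrow> sub X \<Longrightarrow> N \<subseteq> X \<Longrightarrow> P g \<inter> X \<subseteq> N \<or> P g \<subseteq> X"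
  shows "\<exists>C. sub C \<and> U \<inter> C \<subseteq> N \<and> (\<forall>g\<in>G. P g \<subseteq> U + C)"
  using \<open>finite G\<close> P simple
proof (induction G rule: finite_induct)
  case empty
  then show ?case using sub zero[OF sub(2)] by (intro exI[of _ "{0}"]) auto
next
  case (insert g G)
  have "\<exists>C. sub C \<and> U \<inter> C \<subseteq> N \<and> (\<forall>g\<in>G. P g \<subseteq> U + C)"
    by (rule insert.IH) (rule insert.prems; simp)+
  then obtain C where C: "sub C" "U \<inter> C \<subseteq> N" "\<And>h. h \<in> G \<Longrightarrow> P h \<subseteq> U + C"
    by blast
  have N_le: "N \<subseteq> U + C"
    using sub(4) set_zero_plus2[OF zero[OF C(1)], of U] by (auto simp: add.commute)
  have Pg: "sub (P g)" using insert.prems(1) by simp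
  \<comment> \<open>Simplicity applied to \<open>U + C\<close> leaves two cases: \<open>P g\<close>
    is covered already, or it meets \<open>U + C\<close> only in \<open>N\<close> and can be added
    to \<open>C\<close> without spoiling the intersection with \<open>U\<close>.\<close>
  consider "P g \<subseteq> U + C" | "P g \<inter> (U + C) \<subseteq> N"
    using insert.prems(2)[of g "U + C"] plus[OF sub(3) C(1)] N_le by blast
  then show ?case
  proof cases
    case 1
    then show ?thesis using C by blast
  next
    case 2
    have "U \<inter> (P g + C) \<subseteq> N"
    proof
      fix u assume "u \<in> U \<inter> (P g + C)"
      then obtain p q where u: "u = p + q" "u \<in> U" "p \<in> P g" "q \<in> C"
        by (auto elim: set_plus_elim)
      have "p = u + (0 - q)" using u(1) by simp
      then have "p \<in> U + C" using u diff[OF C(1) zero[OF C(1)]] by blast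
      then have pN: "p \<in> N" using 2 u(3) by blast
      have "q = u - p" using u(1) by simp
      then have "q \<in> U" using diff[OF sub(3)] u(2) pN sub(4) by auto
      then have "q \<in> N" using u(4) C(2) by blast
      then show "u \<in> N"
        using diff_closed_plus[OF zero[OF sub(2)] diff[OF sub(2)] pN] u(1) by simp
    qed
    moreover have "P h \<subseteq> U + (P g + C)" if "h \<in> insert g G" for h
    proof (cases "h = g")
      case True
      have "p = 0 + (p + 0)" if "p \<in> P g" for p by simp
      then show ?thesis using zero[OF C(1)] zero[OF sub(3)] True by (metis set_plus_intro subsetI)
    next
      case False
      have "C \<subseteq> P g + C" by (rule set_zero_plus2) (rule zero[OF Pg])
      then have "U + C \<subseteq> U + (P g + C)" by (simp add: set_plus_mono2)
      then show ?thesis using C(3)[of h] False that by auto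
    qed
    ultimately show ?thesis using plus[OF Pg C(1)] by blast
  qed
qed

text \<open>\<open>R\<close> is regarded as a corner of itself, so that its ideals and its radical
  obey the same lemmas as those of the crossed product.\<close>

interpretation regular: corner_ring "(*)" "1 :: 'r::{ring, monoid_mult}"
  by unfold_locales (simp_all add: mult.assoc ring_distribs)

lemma regular_A [simp]: "regular.A = UNIV"
  by (simp add: regular.A_def)

locale corner_extension = corner_ring mul e
  for mul :: "'a::ab_group_add \<Rightarrow> 'a \<Rightarrow> 'a" (infixl "\<odot>" 70) and e :: 'a +
  fixes \<iota> :: "'r::{ring, monoid_mult} \<Rightarrow> 'a"
  assumes \<iota>_add: "\<iota> (r + s) = \<iota> r + \<iota> s"
    and \<iota>_mult: "\<iota> (r * s) = \<iota> r \<odot> \<iota> s"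
    and \<iota>_one: "\<iota> 1 = e"
begin

lemma \<iota>_A [simp, intro]: "\<iota> r \<in> A"
  by (metis A_closed(1) \<iota>_mult mult_1)

lemma \<iota>_zero: "\<iota> 0 = 0"
  using \<iota>_add[of 0 0] by simp

lemma \<iota>_minus: "\<iota> (- r) = - \<iota> r"
  using \<iota>_add[of r "- r"] by (simp add: \<iota>_zero eq_neg_iff_add_eq_0 add.commute)

lemma \<iota>_diff: "\<iota> (r - s) = \<iota> r - \<iota> s"
  using \<iota>_add[of r "- s"] by (simp add: \<iota>_minus)

lemma \<iota>_sum_list: "\<iota> (sum_list (map f xs)) = (\<Sum>i\<leftarrow>xs. \<iota> (f i))"
  by (induction xs) (auto simp: \<iota>_zero \<iota>_add)

text \<open>Nakayama's lemma for the finitely generated module \<open>(K + \<Sum> R (v g)) / K\<close>.\<close>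

lemma nakayama:
  assumes "finite F" "lideal K" "\<And>g. g \<in> F \<Longrightarrow> v g \<in> A"
    and "\<And>g. g \<in> F \<Longrightarrow> \<exists>j. (\<forall>h\<in>F. j h \<in> regular.rad) \<and> v g - (\<Sum>h\<in>F. \<iota> (j h) \<odot> v h) \<in> K"
    and "g \<in> F"
  shows "v g \<in> K"
  using assms(1,3,4,5)
proof (induction F arbitrary: g rule: finite_induct)
  case (insert f F)
  note K = lidealD[OF assms(2)]
  obtain j where j: "\<And>h. h \<in> insert f F \<Longrightarrow> j h \<in> regular.rad"
    "v f - (\<Sum>h\<in>insert f F. \<iota> (j h) \<odot> v h) \<in> K"
    using insert.prems(2)[of f] by blast
  \<comment> \<open>Since \<open>1 - j f\<close> is invertible, the relation can be solved for
    \<open>v f\<close>, which becomes a combination of the other generators modulo \<open>K\<close>,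
    again with coefficients in the radical.\<close>
  obtain u where u: "u * (1 - j f) = 1"
    using regular.rad_quasi_regular[OF j(1)] by blast
  have "v f - (\<Sum>h\<in>F. \<iota> (u * j h) \<odot> v h) =
      \<iota> (u * (1 - j f)) \<odot> v f - \<iota> u \<odot> (\<Sum>h\<in>F. \<iota> (j h) \<odot> v h)"
    using insert.prems(1)[of f] by (simp add: u \<iota>_one \<iota>_mult mul_sum mul_assoc)
  also have "\<dots> = \<iota> u \<odot> (v f - (\<Sum>h\<in>insert f F. \<iota> (j h) \<odot> v h))"
    using insert.hyps insert.prems(1)[of f] by (simp add: \<iota>_mult \<iota>_diff \<iota>_one distribs)
  finally have f: "v f - (\<Sum>h\<in>F. \<iota> (u * j h) \<odot> v h) \<in> K"
    using K(4)[OF j(2)] by simp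
  have F: "v g \<in> K" if "g \<in> F" for g
  proof (rule insert.IH[OF _ _ that])
    fix g assume g: "g \<in> F"
    obtain i where i: "\<And>h. h \<in> insert f F \<Longrightarrow> i h \<in> regular.rad"
      "v g - (\<Sum>h\<in>insert f F. \<iota> (i h) \<odot> v h) \<in> K"
      using insert.prems(2)[of g] g by blast
    \<comment> \<open>The coefficients after substituting the expression for \<open>v f\<close> into
      the relation for \<open>v g\<close>.\<close>
    define j' where "j' h = i h + i f * (u * j h)" for h
    have "v g - (\<Sum>h\<in>F. \<iota> (j' h) \<odot> v h) =
      (v g - (\<Sum>h\<in>insert f F. \<iota> (i h) \<odot> v h)) + \<iota> (i f) \<odot> (v f - (\<Sum>h\<in>F. \<iota> (u * j h) \<odot> v h))"
      using insert.hyps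
      by (simp add: j'_def \<iota>_add \<iota>_mult distribs mul_sum sum.distrib)
    also have "\<dots> \<in> K" using K(3)[OF i(2) K(4)[OF f]] .
    finally have "v g - (\<Sum>h\<in>F. \<iota> (j' h) \<odot> v h) \<in> K" .
    moreover have "\<forall>h\<in>F. j' h \<in> regular.rad"
      unfolding j'_def using i(1) j(1) by (auto intro!: regular.radD(3,4))
    ultimately show "\<exists>j. (\<forall>h\<in>F. j h \<in> regular.rad) \<and> v g - (\<Sum>h\<in>F. \<iota> (j h) \<odot> v h) \<in> K"
      by blast
  qed (use insert.prems(1) in auto)
  have "(\<Sum>h\<in>F. \<iota> (u * j h) \<odot> v h) \<in> K"
    using F by (intro lideal_sum[OF assms(2)] K(4)) auto
  then have "v f \<in> K"
    using K(3)[OF f] by (metis diff_add_cancel)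
  with F insert.prems(3) show ?case by blast
qed simp

text \<open>
  Let \<open>R\<close> be fixed by finitely many automorphisms \<open>\<theta> g\<close> of \<open>A\<close>, with averages in \<open>R\<close>. For a maximal
  left ideal \<open>L\<close> of \<open>A\<close>, the module \<open>(A / L)\<^sup>G\<close> with the action twisted by \<open>\<theta>\<close> is semisimple, and the
  average of a projection onto the submodule generated by the constants in the radical of \<open>R\<close>
  restricts to an \<open>R\<close>-linear map on constants.
\<close>

lemma fixed_ring_radical:
  fixes \<theta> :: "'g \<Rightarrow> 'a \<Rightarrow> 'a"
  assumes G: "finite G"
    and \<theta>_mult: "\<And>g x y. g \<in> G \<Longrightarrow> \<theta> g (x \<odot> y) = \<theta> g x \<odot> \<theta> g y"
    and \<theta>_surj: "\<And>g y. g \<in> G \<Longrightarrow> y \<in> A \<Longrightarrow> \<exists>x. \<theta> g x = y"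
    and \<theta>_fix: "\<And>g r. g \<in> G \<Longrightarrow> \<theta> g (\<iota> r) = \<iota> r"
    and k: "\<And>x. k \<odot> x = x \<odot> k" "\<And>x. x \<in> A \<Longrightarrow> k \<odot> (\<Sum>g\<in>G. x) = x"
    and avg: "\<And>x. \<exists>r. k \<odot> (\<Sum>g\<in>G. \<theta> g x) = \<iota> r"
    and x: "x \<in> regular.rad"
  shows "\<iota> x \<in> rad"
  unfolding rad_eq
proof (intro IntI InterI)
  fix L assume "L \<in> {L. max_lideal L}"
  then have L: "max_lideal L" by simp
  note L' = lidealD[OF max_lideal_lideal[OF L]]
  \<comment> \<open>Functions on the index type model \<open>A^G\<close>, with component
    \<open>g\<close> twisted by \<open>\<theta> g\<close>. Values outside \<open>G\<close> are
    unconstrained in \<open>N\<close>, so that working modulo \<open>N\<close> amounts to working in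
    \<open>(A / L)^G\<close>.\<close>
  define act where "act a w = (\<lambda>g. \<theta> g a \<odot> w g)" for a and w :: "'g \<Rightarrow> 'a"
  define sub where "sub X \<longleftrightarrow> 0 \<in> X \<and> (\<forall>x\<in>X. \<forall>y\<in>X. x - y \<in> X) \<and> (\<forall>a. \<forall>x\<in>X. act a x \<in> X)" for X
  define P where "P g = {w. \<forall>h\<in>G. w h \<in> A \<and> (h \<noteq> g \<longrightarrow> w h = 0)}" for g
  define N where "N = {w. \<forall>g\<in>G. w g \<in> L}"
  \<comment> \<open>The \<open>A\<close>-span of the constant functions with values in
    \<open>J(R)\<close>. Multiplicativity of \<open>\<theta> g\<close> is available for
    \<open>g\<close> in \<open>G\<close> only, so stability under \<open>act\<close> holds modulo
    \<open>N\<close>.\<close>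
  define X where "X = {w. \<exists>xs. set xs \<subseteq> UNIV \<times> regular.rad \<and>
    w = (\<lambda>g. \<Sum>(a, x)\<leftarrow>xs. \<theta> g a \<odot> \<iota> x)}"
  have subD: "0 \<in> X" "\<And>x y. x \<in> X \<Longrightarrow> y \<in> X \<Longrightarrow> x - y \<in> X" "\<And>a x. x \<in> X \<Longrightarrow> act a x \<in> X"
    "\<And>x y. x \<in> X \<Longrightarrow> y \<in> X \<Longrightarrow> x + y \<in> X" if "sub X" for X
    using that diff_closed_plus[of X] unfolding sub_def by blast+
  have act_add: "act a (v + w) = act a v + act a w" for a v w
    by (auto simp: act_def distribs fun_eq_iff)
  have sub_plus: "sub (X + Y)" if X: "sub X" and Y: "sub Y" for X Y
    unfolding sub_def
  proof (intro conjI ballI allI)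
    show "0 \<in> X + Y" using set_plus_intro[OF subD(1)[OF X] subD(1)[OF Y]] by simp
    fix v assume "v \<in> X + Y"
    then obtain p q where v: "p \<in> X" "q \<in> Y" "v = p + q" by (rule set_plus_elim)
    then show "act a v \<in> X + Y" for a using subD(3)[OF X] subD(3)[OF Y] by (auto simp: act_add)
    fix w assume "w \<in> X + Y"
    then obtain p' q' where w: "p' \<in> X" "q' \<in> Y" "w = p' + q'" by (rule set_plus_elim)
    have "v - w = (p - p') + (q - q')" by (simp add: v w)
    moreover have "p - p' \<in> X" "q - q' \<in> Y" using v w subD(2)[OF X] subD(2)[OF Y] by blast+
    ultimately show "v - w \<in> X + Y" by (metis set_plus_intro)
  qed
  have sub_N: "sub N"
    unfolding sub_def N_def using L' by (auto simp: act_def)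
  have sub_P: "sub (P g)" for g
    unfolding sub_def P_def by (auto simp: act_def)
  have X_act: "act a w \<in> X + N" if wX: "w \<in> X" for a w
  proof -
    from wX obtain xs where xs: "set xs \<subseteq> UNIV \<times> regular.rad"
      "w = (\<lambda>g. \<Sum>(a, x)\<leftarrow>xs. \<theta> g a \<odot> \<iota> x)" by (auto simp: X_def)
    let ?ys = "map (\<lambda>(b, x). (a \<odot> b, x)) xs"
    let ?w = "\<lambda>g. \<Sum>(a, x)\<leftarrow>?ys. \<theta> g a \<odot> \<iota> x"
    have "act a w - ?w \<in> N"
      unfolding N_def using L'(2)
      by (auto simp: act_def xs(2) mul_sum_list case_prod_unfold o_def \<theta>_mult mul_assoc)
    moreover have "set ?ys \<subseteq> UNIV \<times> regular.rad" using xs(1) by auto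
    then have "?w \<in> X" unfolding X_def by blast
    ultimately have "?w + (act a w - ?w) \<in> X + N" by blast
    then show ?thesis by simp
  qed
  have X_diff: "v - w \<in> X" if vw: "v \<in> X" "w \<in> X" for v w
  proof -
    from vw obtain xs ys where xs: "set xs \<subseteq> UNIV \<times> regular.rad" "set ys \<subseteq> UNIV \<times> regular.rad"
      "v = (\<lambda>g. \<Sum>(a, x)\<leftarrow>xs. \<theta> g a \<odot> \<iota> x)" "w = (\<lambda>g. \<Sum>(a, x)\<leftarrow>ys. \<theta> g a \<odot> \<iota> x)"
      by (auto simp: X_def)
    let ?zs = "xs @ map (\<lambda>(a, x). (a, - x)) ys"
    have "(\<Sum>(a, x)\<leftarrow>map (\<lambda>(a, x). (a, - x)) ys. \<theta> g a \<odot> \<iota> x) = - (\<Sum>(a, x)\<leftarrow>ys. \<theta> g a \<odot> \<iota> x)" for g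
      by (induction ys) (auto simp: \<iota>_minus)
    then have "v - w = (\<lambda>g. \<Sum>(a, x)\<leftarrow>?zs. \<theta> g a \<odot> \<iota> x)"
      by (auto simp: xs fun_eq_iff)
    moreover have "set ?zs \<subseteq> UNIV \<times> regular.rad" using xs(1,2) regular.radD(5) by fastforce
    ultimately show ?thesis unfolding X_def by blast
  qed
  have X_zero: "0 \<in> X"
    unfolding X_def by (auto intro!: exI[of _ "[]"])
  define U where "U = X + N"
  have sub_U: "sub U"
    unfolding sub_def
  proof (intro conjI ballI allI)
    show "0 \<in> U" using set_plus_intro[OF X_zero subD(1)[OF sub_N]] by (simp add: U_def)
    fix v assume "v \<in> U"
    then obtain p q where v: "p \<in> X" "q \<in> N" "v = p + q" unfolding U_def by (rule set_plus_elim)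
    show "act a v \<in> U" for a
    proof -
      obtain p' q' where "p' \<in> X" "q' \<in> N" "act a p = p' + q'"
        using X_act[OF v(1), of a] by (rule set_plus_elim)
      moreover from this have "act a v = p' + (q' + act a q)" by (simp add: v act_add add.assoc)
      moreover have "q' + act a q \<in> N" using calculation(2) v(2) subD(3,4)[OF sub_N] by blast
      ultimately show ?thesis unfolding U_def by (metis set_plus_intro)
    qed
    fix w assume "w \<in> U"
    then obtain p' q' where w: "p' \<in> X" "q' \<in> N" "w = p' + q'" unfolding U_def by (rule set_plus_elim)
    have "v - w = (p - p') + (q - q')" by (simp add: v w)
    moreover have "p - p' \<in> X" "q - q' \<in> N" using v w X_diff subD(2)[OF sub_N] by blast+
    ultimately show "v - w \<in> U" unfolding U_def by (metis set_plus_intro)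
  qed
  have N_U: "N \<subseteq> U"
    unfolding U_def by (rule set_zero_plus2) (rule X_zero)
  have simple: "P g \<inter> X \<subseteq> N \<or> P g \<subseteq> X" if g: "g \<in> G" and X: "sub X" and NX: "N \<subseteq> X" for g X
    unfolding disj_imp
  proof (intro impI subsetI)
    fix p assume p: "p \<in> P g" and "\<not> P g \<inter> X \<subseteq> N"
    then obtain w where w: "w \<in> P g" "w \<in> X" "w \<notin> N" by blast
    then have wg: "w g \<notin> L" "w g \<in> A" using g L'(2) by (auto simp: P_def N_def)
    then obtain l a where la: "l \<in> L" "e = l + a \<odot> w g"
      using max_lideal_add_principal[OF L] by metis
    \<comment> \<open>Surjectivity of \<open>\<theta> g\<close> realises the multiplier that carries
      \<open>w g\<close> to \<open>p g\<close> modulo \<open>L\<close>. At the other indices in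
      \<open>G\<close> both functions vanish, so \<open>p\<close> and \<open>act b w\<close> agree
      modulo \<open>N\<close>.\<close>
    obtain b where b: "\<theta> g b = p g \<odot> a" using \<theta>_surj[OF g, of "p g \<odot> a"] by auto
    have "p g = p g \<odot> e" using p g by (simp add: P_def)
    also have "\<dots> = p g \<odot> l + \<theta> g b \<odot> w g" by (simp add: la(2) b distribs)
    finally have "p g - \<theta> g b \<odot> w g = p g \<odot> l" unfolding diff_eq_eq .
    then have "p g - \<theta> g b \<odot> w g \<in> L" using L'(4)[OF la(1)] by simp
    then have "p h - \<theta> h b \<odot> w h \<in> L" if "h \<in> G" for h
      using p w(1) L'(2) that by (cases "h = g") (auto simp: P_def)
    then have "p - act b w \<in> N"
      by (auto simp: N_def act_def)
    then have "(p - act b w) + act b w \<in> X" using subD(3,4)[OF X] w(2) NX by blast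
    then show "p \<in> X" by simp
  qed
  have sub_0: "sub {0}" by (auto simp: sub_def act_def fun_eq_iff)
  have "\<exists>C. sub C \<and> U \<inter> C \<subseteq> N \<and> (\<forall>g\<in>G. P g \<subseteq> U + C)"
    by (rule complement_exists[OF G, of sub])
      (rule sub_0 subD(1,2) sub_plus sub_N sub_U N_U sub_P simple; assumption)+
  then obtain C where C: "sub C" "U \<inter> C \<subseteq> N" "\<And>g. g \<in> G \<Longrightarrow> P g \<subseteq> U + C"
    by blast
  \<comment> \<open>On \<open>G\<close> this is the constant function \<open>e\<close>; as a sum of
    members of the \<open>P g\<close> it lies in \<open>U + C\<close>.\<close>
  define one where "one = (\<Sum>g\<in>G. (\<lambda>h. if h = g then e else 0))"
  have one: "one h = e" if "h \<in> G" for h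
  proof -
    have "one h = (\<Sum>g\<in>G. if h = g then e else 0)"
      unfolding one_def using G by (induction G rule: finite_induct) auto
    then show ?thesis using G that by simp
  qed
  have UC: "sub (U + C)" using sub_plus[OF sub_U C(1)] .
  have sum_UC: "sum f I \<in> U + C" if "\<And>i. i \<in> I \<Longrightarrow> f i \<in> U + C" for f :: "'g \<Rightarrow> _" and I
    using that subD(1,4)[OF UC] by (induction I rule: infinite_finite_induct) auto
  have "one \<in> U + C"
    unfolding one_def
  proof (rule sum_UC)
    fix g assume "g \<in> G"
    moreover have "(\<lambda>h. if h = g then e else 0) \<in> P g" by (simp add: P_def)
    ultimately show "(\<lambda>h. if h = g then e else 0) \<in> U + C" using C(3) by blast
  qed
  then obtain u c where uc: "u \<in> U" "c \<in> C" "one = u + c" by (rule set_plus_elim)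
  obtain v n where "v \<in> X" and n: "n \<in> N" "u = v + n" using uc(1) unfolding U_def by (rule set_plus_elim)
  then obtain xs where xs: "set xs \<subseteq> UNIV \<times> regular.rad" "v = (\<lambda>g. \<Sum>(a, x)\<leftarrow>xs. \<theta> g a \<odot> \<iota> x)"
    by (auto simp: X_def)
  define s where "s = (\<Sum>g\<in>G. c g)"
  \<comment> \<open>The constant \<open>\<iota> y\<close> lies in \<open>U\<close>, hence so does
    the \<open>C\<close>-component \<open>act (\<iota> y) c\<close>, which therefore falls into
    \<open>N\<close>. As \<open>\<theta> g\<close> fixes \<open>\<iota> y\<close>, this means
    \<open>\<iota> y \<odot> c g \<in> L\<close> for every \<open>g\<close>.\<close>
  have ys: "\<iota> y \<odot> s \<in> L" if y: "y \<in> regular.rad" for y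
  proof -
    have "act (\<iota> y) one - (\<lambda>g. \<Sum>(a, x)\<leftarrow>[(e, y)]. \<theta> g a \<odot> \<iota> x) \<in> N"
      using \<theta>_fix[of _ 1] L'(2) by (auto simp: N_def act_def one \<theta>_fix \<iota>_one)
    moreover have "(\<lambda>g. \<Sum>(a, x)\<leftarrow>[(e, y)]. \<theta> g a \<odot> \<iota> x) \<in> X"
      unfolding X_def using y by (intro CollectI exI[of _ "[(e, y)]"]) simp
    ultimately have "act (\<iota> y) one \<in> U"
      unfolding U_def by (metis (no_types, lifting) add.commute diff_add_cancel set_plus_intro)
    moreover have "act (\<iota> y) c = act (\<iota> y) one - act (\<iota> y) u"
      by (simp add: uc(3) act_add)
    ultimately have "act (\<iota> y) c \<in> U" using subD(2,3)[OF sub_U] uc(1) by simp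
    moreover have "act (\<iota> y) c \<in> C" using subD(3)[OF C(1)] uc(2) by simp
    ultimately have "act (\<iota> y) c \<in> N" using C(2) by blast
    then show ?thesis
      unfolding s_def mul_sum by (intro lideal_sum[OF max_lideal_lideal[OF L]]) (auto simp: N_def act_def \<theta>_fix)
  qed
  obtain r where r: "\<And>x. k \<odot> (\<Sum>g\<in>G. \<theta> g x) = \<iota> (r x)" using avg by metis
  \<comment> \<open>The average of the \<open>X\<close>-component of \<open>one\<close>. Only the
    left factors \<open>\<theta> g a\<close> vary with \<open>g\<close>, and their averages lie in
    \<open>R\<close>, so the result stays in \<open>J(R)\<close>.\<close>
  define j where "j = (\<Sum>(a, x)\<leftarrow>xs. r a * x)"
  have j: "j \<in> regular.rad"
    unfolding j_def using xs(1)
    by (intro regular.lideal_sum_list[OF regular.lideal_rad]) (auto intro!: regular.radD(4))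
  have swap: "(\<Sum>g\<in>G. \<Sum>(a, x)\<leftarrow>xs. \<theta> g a \<odot> \<iota> x) = (\<Sum>(a, x)\<leftarrow>xs. (\<Sum>g\<in>G. \<theta> g a) \<odot> \<iota> x)"
    by (induction xs) (auto simp: sum.distrib sum_mul)
  have "e = k \<odot> (\<Sum>g\<in>G. one g)" using k(2)[of e] one by simp
  also have "\<dots> = k \<odot> (\<Sum>g\<in>G. v g) + k \<odot> (\<Sum>g\<in>G. n g) + k \<odot> s"
    by (simp add: uc(3) n(2) s_def sum.distrib distribs)
  also have "k \<odot> (\<Sum>g\<in>G. v g) = (\<Sum>(a, x)\<leftarrow>xs. (k \<odot> (\<Sum>g\<in>G. \<theta> g a)) \<odot> \<iota> x)"
    unfolding xs(2) swap by (simp add: mul_sum_list case_prod_unfold mul_assoc)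
  also have "\<dots> = \<iota> j"
    unfolding r j_def by (simp add: \<iota>_sum_list case_prod_unfold \<iota>_mult)
  finally have e: "e - \<iota> j = k \<odot> (\<Sum>g\<in>G. n g) + k \<odot> s" by (simp add: algebra_simps)
  have n_sum: "(\<Sum>g\<in>G. n g) \<in> L"
    using n(1) by (intro lideal_sum[OF max_lideal_lideal[OF L]]) (auto simp: N_def)
  have y: "\<iota> (y * (1 - j)) \<in> L" if "y \<in> regular.rad" for y
  proof -
    have "\<iota> (y * (1 - j)) = (\<iota> y \<odot> k) \<odot> (\<Sum>g\<in>G. n g) + (\<iota> y \<odot> k) \<odot> s"
      by (simp add: \<iota>_mult \<iota>_diff \<iota>_one e distribs)
    also have "(\<iota> y \<odot> k) \<odot> s = k \<odot> (\<iota> y \<odot> s)" by (simp add: k(1)[symmetric] mul_assoc)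
    finally show ?thesis using L'(3,4) n_sum ys[OF that] by simp
  qed
  \<comment> \<open>Invertibility of \<open>1 - j\<close> writes \<open>x\<close> as
    \<open>y * (1 - j)\<close> with \<open>y = x * i\<close>, which is in \<open>J(R)\<close>
    because the radical is also a right ideal.\<close>
  obtain i where "i * (1 - j) = 1" using regular.rad_quasi_regular[OF j] by blast
  then have "x = x * i * (1 - j)" by (simp add: mult.assoc)
  then show "\<iota> x \<in> L" using y[OF regular.rad_mul_right[OF x, of i]] by simp
qed simp

end

text \<open>The group structure of the index set \<open>G\<close> is only visible through the products of the \<open>w g\<close>.\<close>

locale group_extension = corner_extension mul e \<iota>
  for mul :: "'a::ab_group_add \<Rightarrow> 'a \<Rightarrow> 'a" (infixl "\<odot>" 70) and e :: 'a
    and \<iota> :: "'r::{ring, monoid_mult} \<Rightarrow> 'a" +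
  fixes G :: "'g set" and w w' :: "'g \<Rightarrow> 'a" and p :: "'g \<Rightarrow> 'g \<Rightarrow> 'g"
  assumes G: "finite G"
    and w_A: "g \<in> G \<Longrightarrow> w g \<in> A"
    and inverses: "g \<in> G \<Longrightarrow> w g \<odot> w' g = e" "g \<in> G \<Longrightarrow> w' g \<odot> w g = e"
    and w_\<iota>: "g \<in> G \<Longrightarrow> \<exists>r'. w g \<odot> \<iota> r = \<iota> r' \<odot> w g"
    and \<iota>_w: "g \<in> G \<Longrightarrow> \<exists>r'. \<iota> r \<odot> w g = w g \<odot> \<iota> r'"
    and p: "g \<in> G \<Longrightarrow> bij_betw (p g) G G"
    and w_mult: "g \<in> G \<Longrightarrow> h \<in> G \<Longrightarrow> \<exists>r. w g \<odot> w h = \<iota> r \<odot> w (p g h)"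
    and w_span: "x \<in> A \<Longrightarrow> \<exists>r. x = (\<Sum>g\<in>G. \<iota> (r g) \<odot> w g)"
begin

text \<open>
  By stability, the left ideal \<open>K = A (1 - a x)\<close> satisfies \<open>A = K + J(R) A\<close>, and Nakayama's lemma gives
  \<open>K = A\<close>.
\<close>

lemma base_radical:
  assumes stable: "\<And>g x. g \<in> G \<Longrightarrow> x \<in> regular.rad \<Longrightarrow> \<exists>x'\<in>regular.rad. w g \<odot> \<iota> x = \<iota> x' \<odot> w g"
    and x: "x \<in> regular.rad"
  shows "\<iota> x \<in> rad"
  unfolding rad_def
proof (intro CollectI conjI allI)
  fix a
  define K where "K = range (\<lambda>u. u \<odot> (e - a \<odot> \<iota> x))"
  have K: "lideal K"
    unfolding lideal_def K_def
  proof (intro conjI ballI allI)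
    show "0 \<in> range (\<lambda>u. u \<odot> (e - a \<odot> \<iota> x))" by (rule range_eqI[of _ _ 0]) simp
    fix b y z assume y: "y \<in> range (\<lambda>u. u \<odot> (e - a \<odot> \<iota> x))"
    from y show "b \<odot> y \<in> range (\<lambda>u. u \<odot> (e - a \<odot> \<iota> x))" by (auto simp flip: mul_assoc)
    assume "z \<in> range (\<lambda>u. u \<odot> (e - a \<odot> \<iota> x))"
    with y show "y + z \<in> range (\<lambda>u. u \<odot> (e - a \<odot> \<iota> x))" by (auto simp flip: distrib_right)
  qed auto
  have w_K: "w g \<in> K" if "g \<in> G" for g
  proof (rule nakayama[OF G K w_A _ that])
    fix g assume g: "g \<in> G"
    obtain r where r: "w g \<odot> a = (\<Sum>h\<in>G. \<iota> (r h) \<odot> w h)" using w_span[of "w g \<odot> a"] by blast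
    obtain x' where x': "\<And>h. h \<in> G \<Longrightarrow> x' h \<in> regular.rad \<and> w h \<odot> \<iota> x = \<iota> (x' h) \<odot> w h"
      using stable[OF _ x] by metis
    \<comment> \<open>Modulo \<open>K\<close>, the element \<open>w g\<close> equals
      \<open>w g \<odot> a \<odot> \<iota> x\<close>. Stability moves the radical element to the
      left of each \<open>w h\<close>, which is the relation required by
      \<open>nakayama\<close>.\<close>
    have "w g \<odot> a \<odot> \<iota> x = (\<Sum>h\<in>G. \<iota> (r h) \<odot> (w h \<odot> \<iota> x))"
      by (simp add: r sum_mul mul_assoc)
    also have "\<dots> = (\<Sum>h\<in>G. \<iota> (r h * x' h) \<odot> w h)"
      by (intro sum.cong) (use x' in \<open>auto simp: \<iota>_mult mul_assoc\<close>)
    finally have "w g - (\<Sum>h\<in>G. \<iota> (r h * x' h) \<odot> w h) = w g \<odot> (e - a \<odot> \<iota> x)"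
      using w_A[OF g] by (simp add: distribs)
    then have "w g - (\<Sum>h\<in>G. \<iota> (r h * x' h) \<odot> w h) \<in> K"
      by (simp add: K_def)
    moreover have "\<forall>h\<in>G. r h * x' h \<in> regular.rad"
      using x' regular.radD(4) by blast
    ultimately show "\<exists>j. (\<forall>h\<in>G. j h \<in> regular.rad) \<and> w g - (\<Sum>h\<in>G. \<iota> (j h) \<odot> w h) \<in> K"
      by (intro exI[of _ "\<lambda>h. r h * x' h"]) simp
  qed
  obtain r where "e = (\<Sum>g\<in>G. \<iota> (r g) \<odot> w g)" using w_span[of e] by blast
  also have "\<dots> \<in> K" using w_K lidealD(4)[OF K] by (intro lideal_sum[OF K]) auto
  finally have "e \<in> range (\<lambda>u. u \<odot> (e - a \<odot> \<iota> x))" by (simp only: K_def)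
  then show "\<exists>u. u \<odot> (e - a \<odot> \<iota> x) = e" by (auto dest: sym)
qed simp

text \<open>
  For a maximal left ideal \<open>L\<close> of \<open>R\<close>, the \<open>R\<close>-module \<open>A / A L\<close> is a finite sum of the simple modules
  \<open>w g R / w g L\<close>. By averaging a projection, as in Maschke's theorem, it is a semisimple \<open>A\<close>-module.
\<close>

lemma radical_coefficients:
  assumes k: "\<And>x. k \<odot> x = x \<odot> k" "\<And>x. x \<in> A \<Longrightarrow> k \<odot> (\<Sum>g\<in>G. x) = x"
    and free: "\<And>r s g. (\<Sum>g\<in>G. w g \<odot> \<iota> (r g)) = (\<Sum>g\<in>G. w g \<odot> \<iota> (s g)) \<Longrightarrow> g \<in> G \<Longrightarrow> r g = s g"
    and x: "(\<Sum>g\<in>G. w g \<odot> \<iota> (x g)) \<in> rad" and g: "g \<in> G"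
  shows "x g \<in> regular.rad"
  unfolding regular.rad_eq
proof (intro IntI InterI)
  fix L :: "'r set" assume "L \<in> {L. regular.max_lideal L}"
  then have L: "regular.max_lideal L" by simp
  note L' = regular.lidealD[OF regular.max_lideal_lideal[OF L]]
  \<comment> \<open>This is \<open>A L\<close>, written with the coefficients on the right of the
    \<open>w g\<close>. By \<open>free\<close>, the coefficients of a member of \<open>N\<close> are
    determined and lie in \<open>L\<close>, which gives the conclusion at the end.\<close>
  define N where "N = {\<Sum>g\<in>G. w g \<odot> \<iota> (l g) | l. \<forall>g\<in>G. l g \<in> L}"
  have N_diff: "v - v' \<in> N" if N: "v \<in> N" "v' \<in> N" for v v'
  proof -
    from N obtain l l' where l: "\<forall>g\<in>G. l g \<in> L" "\<forall>g\<in>G. l' g \<in> L"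
      "v = (\<Sum>g\<in>G. w g \<odot> \<iota> (l g))" "v' = (\<Sum>g\<in>G. w g \<odot> \<iota> (l' g))"
      by (auto simp: N_def)
    then have "v - v' = (\<Sum>g\<in>G. w g \<odot> \<iota> (l g - l' g))"
      by (simp add: \<iota>_diff distribs sum_subtractf)
    moreover have "\<forall>g\<in>G. l g - l' g \<in> L" using l(1,2) L'(6) by blast
    ultimately show ?thesis
      unfolding N_def by (intro CollectI exI[of _ "\<lambda>g. l g - l' g"] conjI)
  qed
  have N_zero: "0 \<in> N"
    unfolding N_def using L'(2) by (intro CollectI exI[of _ "\<lambda>_. 0"]) (simp add: \<iota>_zero)
  note N_plus = diff_closed_plus[of N, OF N_zero N_diff]
  have N_sum: "sum f I \<in> N" if "\<And>i. i \<in> I \<Longrightarrow> f i \<in> N" for f :: "'g \<Rightarrow> 'a" and I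
    using that N_zero N_plus by (induction I rule: infinite_finite_induct) auto
  have N_w: "w g \<odot> \<iota> l \<in> N" if g: "g \<in> G" and l: "l \<in> L" for g l
  proof -
    have "(\<Sum>h\<in>G. w h \<odot> \<iota> (if h = g then l else 0)) = (\<Sum>h\<in>G. if h = g then w g \<odot> \<iota> l else 0)"
      by (intro sum.cong) (auto simp: \<iota>_zero)
    also have "\<dots> = w g \<odot> \<iota> l" using g G by simp
    finally show ?thesis
      unfolding N_def using l L'(2)
      by (intro CollectI exI[of _ "\<lambda>h. if h = g then l else 0"]) simp
  qed
  have N_\<iota>: "\<iota> r \<odot> (w g \<odot> \<iota> l) \<in> N" if g: "g \<in> G" and l: "l \<in> L" for g l r
  proof -
    obtain r' where "\<iota> r \<odot> w g = w g \<odot> \<iota> r'" using \<iota>_w[OF g] by blast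
    then have "\<iota> r \<odot> (w g \<odot> \<iota> l) = w g \<odot> \<iota> (r' * l)" by (simp add: \<iota>_mult flip: mul_assoc)
    then show ?thesis using N_w[OF g L'(4)[OF l]] by simp
  qed
  have N_left: "a \<odot> v \<in> N" if v: "v \<in> N" for a v
  proof -
    obtain l where l: "\<forall>g\<in>G. l g \<in> L" "v = (\<Sum>g\<in>G. w g \<odot> \<iota> (l g))" using v by (auto simp: N_def)
    obtain r where r: "e \<odot> a = (\<Sum>g\<in>G. \<iota> (r g) \<odot> w g)" using w_span[of "e \<odot> a"] by auto
    have "\<iota> (r h) \<odot> (w h \<odot> (w g \<odot> \<iota> (l g))) \<in> N" if gh: "g \<in> G" "h \<in> G" for g h
    proof -
      obtain s where s: "w h \<odot> w g = \<iota> s \<odot> w (p h g)" using w_mult gh by blast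
      have "\<iota> (r h) \<odot> (w h \<odot> (w g \<odot> \<iota> (l g))) = \<iota> (r h) \<odot> (w h \<odot> w g) \<odot> \<iota> (l g)"
        by (simp add: mul_assoc)
      also have "\<dots> = \<iota> (r h * s) \<odot> (w (p h g) \<odot> \<iota> (l g))"
        by (simp add: s \<iota>_mult mul_assoc)
      also have "\<dots> \<in> N" using l(1) gh p[of h] by (intro N_\<iota>) (auto simp: bij_betw_def)
      finally show ?thesis .
    qed
    then have "(\<Sum>h\<in>G. \<Sum>g\<in>G. \<iota> (r h) \<odot> (w h \<odot> (w g \<odot> \<iota> (l g)))) \<in> N"
      by (intro N_sum)
    also have "(\<Sum>h\<in>G. \<Sum>g\<in>G. \<iota> (r h) \<odot> (w h \<odot> (w g \<odot> \<iota> (l g)))) = (e \<odot> a) \<odot> v"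
      unfolding l(2) r sum_mul by (simp add: mul_sum mul_assoc)
    also have "\<dots> = a \<odot> v" using l(2) by (simp add: mul_sum mul_assoc unit_mul)
    finally show ?thesis .
  qed
  have N_A: "N \<subseteq> A" by (auto simp: N_def)
  have N: "lideal N"
    unfolding lideal_def using N_A N_zero N_plus N_left by blast
  define sub where "sub X \<longleftrightarrow> 0 \<in> X \<and> (\<forall>x\<in>X. \<forall>y\<in>X. x - y \<in> X) \<and> (\<forall>r. \<forall>x\<in>X. \<iota> r \<odot> x \<in> X)" for X
  define P where "P g = range (\<lambda>r. w g \<odot> \<iota> r)" for g
  define U where "U = rad + N"
  have subD: "0 \<in> X" "\<And>x y. x \<in> X \<Longrightarrow> y \<in> X \<Longrightarrow> x - y \<in> X" "\<And>r x. x \<in> X \<Longrightarrow> \<iota> r \<odot> x \<in> X"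
    "\<And>x y. x \<in> X \<Longrightarrow> y \<in> X \<Longrightarrow> x + y \<in> X" if "sub X" for X
    using that diff_closed_plus[of X] unfolding sub_def by blast+
  have sub_sum: "sum f I \<in> X" if "sub X" "\<And>i. i \<in> I \<Longrightarrow> f i \<in> X" for X and f :: "'g \<Rightarrow> 'a" and I
    using that(2) subD(1,4)[OF that(1)] by (induction I rule: infinite_finite_induct) auto
  have sub_lideal: "sub X" if "lideal X" for X
    unfolding sub_def by (intro conjI ballI allI lidealD(2,4,6)[OF that])
  have sub_plus: "sub (X + Y)" if X: "sub X" and Y: "sub Y" for X Y
    unfolding sub_def
  proof (intro conjI ballI allI)
    show "0 \<in> X + Y" using set_plus_intro[OF subD(1)[OF X] subD(1)[OF Y]] by simp
    fix v assume "v \<in> X + Y"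
    then obtain p q where v: "p \<in> X" "q \<in> Y" "v = p + q" by (rule set_plus_elim)
    then show "\<iota> r \<odot> v \<in> X + Y" for r using subD(3)[OF X] subD(3)[OF Y] by (auto simp: distrib_left)
    fix w assume "w \<in> X + Y"
    then obtain p' q' where w: "p' \<in> X" "q' \<in> Y" "w = p' + q'" by (rule set_plus_elim)
    have "v - w = (p - p') + (q - q')" by (simp add: v w)
    moreover have "p - p' \<in> X" "q - q' \<in> Y" using v w subD(2)[OF X] subD(2)[OF Y] by blast+
    ultimately show "v - w \<in> X + Y" by (metis set_plus_intro)
  qed
  have sub_P: "sub (P g)" if g: "g \<in> G" for g
    unfolding sub_def P_def
  proof (intro conjI ballI allI)
    show "0 \<in> range (\<lambda>r. w g \<odot> \<iota> r)" by (rule range_eqI[of _ _ 0]) (simp add: \<iota>_zero)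
    fix x y assume x: "x \<in> range (\<lambda>r. w g \<odot> \<iota> r)"
    then obtain r where r: "x = w g \<odot> \<iota> r" by blast
    show "\<iota> s \<odot> x \<in> range (\<lambda>r. w g \<odot> \<iota> r)" for s
    proof -
      obtain s' where "\<iota> s \<odot> w g = w g \<odot> \<iota> s'" using \<iota>_w[OF g] by blast
      then have "\<iota> s \<odot> x = w g \<odot> \<iota> (s' * r)" by (simp add: r \<iota>_mult flip: mul_assoc)
      then show ?thesis by blast
    qed
    assume "y \<in> range (\<lambda>r. w g \<odot> \<iota> r)"
    then show "x - y \<in> range (\<lambda>r. w g \<odot> \<iota> r)" using r by (auto simp flip: \<iota>_diff distrib_left_diff)
  qed
  have simple: "P g \<inter> X \<subseteq> N \<or> P g \<subseteq> X" if g: "g \<in> G" and X: "sub X" and NX: "N \<subseteq> X" for g X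
    unfolding disj_imp
  proof (intro impI subsetI)
    fix q assume q: "q \<in> P g" and "\<not> P g \<inter> X \<subseteq> N"
    then obtain r s where s: "w g \<odot> \<iota> s \<in> X" "w g \<odot> \<iota> s \<notin> N" and r: "q = w g \<odot> \<iota> r"
      unfolding P_def by blast
    have "s \<notin> L" using s(2) N_w[OF g] by blast
    then obtain l a where la: "l \<in> L" "1 = l + a * s"
      using regular.max_lideal_add_principal[OF L] by (metis UNIV_I regular_A)
    \<comment> \<open>\<open>w g R / w g L\<close> is \<open>R / L\<close> with its left action
      twisted by \<open>w g\<close>. The multiplier found in \<open>R / L\<close> stands to the
      right of \<open>w g\<close> and must be moved to the left.\<close>
    obtain t where t: "w g \<odot> \<iota> (r * a) = \<iota> t \<odot> w g" using w_\<iota>[OF g] by blast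
    have "r = r * (l + a * s)" using la(2) by simp
    also have "\<dots> = r * l + r * a * s" by (simp add: ring_distribs mult.assoc)
    finally have "q = w g \<odot> \<iota> (r * l + r * a * s)" unfolding r by simp
    also have "\<dots> = w g \<odot> \<iota> (r * l) + w g \<odot> \<iota> (r * a) \<odot> \<iota> s"
      by (simp only: \<iota>_add \<iota>_mult distribs)
    also have "\<dots> = w g \<odot> \<iota> (r * l) + \<iota> t \<odot> (w g \<odot> \<iota> s)"
      by (simp add: t mul_assoc)
    also have "\<dots> \<in> X"
      using NX N_w[OF g L'(4)[OF la(1)]] s(1) by (intro subD(4)[OF X] subD(3)[OF X]) auto
    finally show "q \<in> X" .
  qed
  have U: "lideal U"
    unfolding lideal_def
  proof (intro conjI ballI allI)
    show "U \<subseteq> A" using N_A radD(1) by (auto simp: U_def elim!: set_plus_elim)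
    show "0 \<in> U" using set_plus_intro[OF radD(2) N_zero] by (simp add: U_def)
    fix x assume x: "x \<in> U"
    then obtain y z where yz: "y \<in> rad" "z \<in> N" "x = y + z" unfolding U_def by (rule set_plus_elim)
    then show "a \<odot> x \<in> U" for a
      using radD(4) N_left by (auto simp: U_def distrib_left)
    show "x + x' \<in> U" if "x' \<in> U" for x'
      using subD(4)[OF sub_plus[OF sub_lideal[OF lideal_rad] sub_lideal[OF N]]] x that unfolding U_def by blast
  qed
  have rad_U: "rad \<subseteq> U" and N_U: "N \<subseteq> U"
    unfolding U_def using set_zero_plus2[OF N_zero, of rad] set_zero_plus2[OF radD(2), of N]
    by (auto simp: add.commute[of N])
  have sub_0: "sub {0}" by (auto simp: sub_def)
  have "\<exists>C. sub C \<and> U \<inter> C \<subseteq> N \<and> (\<forall>g\<in>G. P g \<subseteq> U + C)"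
    by (rule complement_exists[OF G, of sub])
      (rule sub_0 subD(1,2) sub_plus sub_lideal[OF N] sub_lideal[OF U] N_U sub_P simple; assumption)+
  then obtain C where C: "sub C" "U \<inter> C \<subseteq> N" "\<And>g. g \<in> G \<Longrightarrow> P g \<subseteq> U + C"
    by blast
  have UC: "sub (U + C)" using sub_plus[OF sub_lideal[OF U] C(1)] .
  have A_UC: "x \<in> U + C" if xA: "x \<in> A" for x
  proof -
    obtain r where r: "x = (\<Sum>g\<in>G. \<iota> (r g) \<odot> w g)" using w_span[OF xA] by blast
    have "\<iota> (r g) \<odot> w g \<in> U + C" if g: "g \<in> G" for g
    proof -
      have "w g = w g \<odot> \<iota> 1" using w_A[OF g] by (simp add: \<iota>_one)
      then have "w g \<in> U + C" using C(3)[OF g] unfolding P_def by blast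
      then show ?thesis by (rule subD(3)[OF UC])
    qed
    then show ?thesis unfolding r by (intro sub_sum[OF UC])
  qed
  have "\<forall>g. \<exists>u t. g \<in> G \<longrightarrow> e \<odot> w' g = u + t \<and> u \<in> U \<and> t \<in> C"
    using A_UC A_closed(1) by (metis set_plus_elim)
  then obtain u t where ut: "\<And>g. g \<in> G \<Longrightarrow> e \<odot> w' g = u g + t g \<and> u g \<in> U \<and> t g \<in> C"
    by metis
  \<comment> \<open>Up to the factor \<open>k\<close>, this is the value at \<open>e\<close> of the
    averaged projection onto the complement: each \<open>w' g\<close> is split first, and the parts
    are multiplied back by \<open>w g\<close>.\<close>
  define s where "s = (\<Sum>g\<in>G. w g \<odot> t g)"
  have Ys: "y \<odot> s \<in> N" if y: "y \<in> rad" for y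
  proof -
    obtain r where r: "y = (\<Sum>f\<in>G. \<iota> (r f) \<odot> w f)" using w_span[OF radD(1)[OF y]] by blast
    define q where "q f = inv_into G (p f)" for f
    have q: "bij_betw (q f) G G" "\<And>g. g \<in> G \<Longrightarrow> p f (q f g) = g" if "f \<in> G" for f
      using p[OF that] unfolding q_def by (auto intro: bij_betw_inv_into simp: bij_betw_inv_into_right)
    have q_G: "q f g \<in> G" if "f \<in> G" "g \<in> G" for f g
      using q(1)[OF that(1)] that(2) by (auto simp: bij_betw_def)
    have "y \<odot> s = (\<Sum>f\<in>G. \<Sum>h\<in>G. \<iota> (r f) \<odot> (w f \<odot> (w h \<odot> t h)))"
      unfolding r s_def sum_mul by (simp add: mul_sum mul_assoc)
    \<comment> \<open>Reindexing by the product, \<open>p f (q f g) = g\<close>, puts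
      \<open>w f \<odot> w (q f g)\<close> into \<open>\<iota> R \<odot> w g\<close> for all
      \<open>f\<close>, so the inner sum can be studied for each \<open>g\<close>
      separately.\<close>
    also have "\<dots> = (\<Sum>f\<in>G. \<Sum>g\<in>G. \<iota> (r f) \<odot> (w f \<odot> (w (q f g) \<odot> t (q f g))))"
      using q(1) by (intro sum.cong refl sum.reindex_bij_betw[symmetric]) auto
    also have "\<dots> = (\<Sum>g\<in>G. \<Sum>f\<in>G. \<iota> (r f) \<odot> (w f \<odot> (w (q f g) \<odot> t (q f g))))"
      by (rule sum.swap)
    also have "\<dots> \<in> N"
    proof (rule N_sum)
      fix g assume g: "g \<in> G"
      define z where "z = (\<Sum>f\<in>G. \<iota> (r f) \<odot> (w f \<odot> (w (q f g) \<odot> t (q f g))))"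
      have "\<exists>\<rho>. w' g \<odot> \<iota> (r f) \<odot> w f \<odot> w (q f g) = \<iota> \<rho>" if f: "f \<in> G" for f
      proof -
        obtain a where "w f \<odot> w (q f g) = \<iota> a \<odot> w g"
          using w_mult[OF f q_G[OF f g]] q(2)[OF f g] by auto
        moreover obtain b where "\<iota> (r f * a) \<odot> w g = w g \<odot> \<iota> b" using \<iota>_w[OF g] by blast
        ultimately have "\<iota> (r f) \<odot> (w f \<odot> w (q f g)) = w g \<odot> \<iota> b"
          by (simp add: \<iota>_mult mul_assoc)
        then have "w' g \<odot> \<iota> (r f) \<odot> w f \<odot> w (q f g) = (w' g \<odot> w g) \<odot> \<iota> b"
          by (simp add: mul_assoc)
        then show ?thesis using inverses(2)[OF g] by auto
      qed
      then obtain \<rho> where \<rho>: "\<And>f. f \<in> G \<Longrightarrow> w' g \<odot> \<iota> (r f) \<odot> w f \<odot> w (q f g) = \<iota> (\<rho> f)"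
        by metis
      have "w' g \<odot> z = (\<Sum>f\<in>G. (w' g \<odot> \<iota> (r f) \<odot> w f \<odot> w (q f g)) \<odot> t (q f g))"
        by (simp add: z_def mul_sum mul_assoc)
      also have "\<dots> = (\<Sum>f\<in>G. \<iota> (\<rho> f) \<odot> t (q f g))"
        using \<rho> by simp
      finally have z: "w' g \<odot> z = (\<Sum>f\<in>G. \<iota> (\<rho> f) \<odot> t (q f g))" .
      \<comment> \<open>The same coefficients \<open>\<rho> f\<close> express
        \<open>w' g \<odot> y\<close> through the \<open>w' (q f g)\<close>, whose
        \<open>C\<close>-components add up to \<open>w' g \<odot> z\<close>. Since
        \<open>w' g \<odot> y\<close> is in the radical, \<open>w' g \<odot> z\<close> lies in
        \<open>U\<close> as well as in \<open>C\<close>.\<close>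
      have "w' g \<odot> y = (\<Sum>f\<in>G. w' g \<odot> \<iota> (r f) \<odot> w f \<odot> (w (q f g) \<odot> w' (q f g)))"
        using inverses(1)[OF q_G[OF _ g]] w_A by (simp add: r mul_sum mul_assoc)
      also have "\<dots> = (\<Sum>f\<in>G. \<iota> (\<rho> f) \<odot> (e \<odot> w' (q f g)))"
        using \<rho> by (intro sum.cong) (simp_all add: mul_unit_mul flip: mul_assoc)
      also have "\<dots> = (\<Sum>f\<in>G. \<iota> (\<rho> f) \<odot> u (q f g)) + w' g \<odot> z"
        using ut[OF q_G[OF _ g]] by (simp add: z distrib_left sum.distrib)
      finally have "w' g \<odot> z = w' g \<odot> y - (\<Sum>f\<in>G. \<iota> (\<rho> f) \<odot> u (q f g))"
        by (simp add: algebra_simps)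
      moreover have "w' g \<odot> y \<in> U" using radD(4)[OF y] rad_U by blast
      moreover have "(\<Sum>f\<in>G. \<iota> (\<rho> f) \<odot> u (q f g)) \<in> U"
        using ut[OF q_G[OF _ g]] lidealD(4)[OF U] by (intro lideal_sum[OF U]) blast
      ultimately have "w' g \<odot> z \<in> U" using lidealD(6)[OF U] by simp
      moreover have "w' g \<odot> z \<in> C"
        unfolding z using ut[OF q_G[OF _ g]] subD(3)[OF C(1)] by (intro sub_sum[OF C(1)]) blast
      ultimately have "w' g \<odot> z \<in> N" using C(2) by blast
      then have "w g \<odot> (w' g \<odot> z) \<in> N" by (rule N_left)
      also have "w g \<odot> (w' g \<odot> z) = e \<odot> z" using inverses(1)[OF g] by (simp flip: mul_assoc)
      also have "\<dots> = z" by (simp add: z_def mul_sum unit_mul)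
      finally show "(\<Sum>f\<in>G. \<iota> (r f) \<odot> (w f \<odot> (w (q f g) \<odot> t (q f g)))) \<in> N" by (simp add: z_def)
    qed
    finally show ?thesis .
  qed
  have "(\<Sum>g\<in>G. w g \<odot> u g) \<in> U"
    using ut lidealD(4)[OF U] by (intro lideal_sum[OF U]) blast
  then obtain j n where jn: "j \<in> rad" "n \<in> N" "(\<Sum>g\<in>G. w g \<odot> u g) = j + n"
    unfolding U_def by (rule set_plus_elim)
  have "e = k \<odot> (\<Sum>g\<in>G. e)" using k(2)[of e] by simp
  also have "(\<Sum>g\<in>G. e) = (\<Sum>g\<in>G. w g \<odot> (e \<odot> w' g))"
    using inverses(1) by (simp add: mul_unit_mul)
  also have "\<dots> = j + n + s"
    using ut by (simp add: distrib_left sum.distrib jn(3) s_def)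
  finally have "e = k \<odot> (j + n + s)" .
  then have e: "e - k \<odot> j = k \<odot> n + k \<odot> s" by (metis add.assoc add_diff_cancel_left' distrib_left)
  have kj: "k \<odot> j \<in> rad" using radD(4)[OF jn(1)] .
  obtain v where v: "v \<odot> (e - k \<odot> j) = e" using rad_quasi_regular[OF kj] by blast
  define X where "X = (\<Sum>g\<in>G. w g \<odot> \<iota> (x g))"
  have Xv: "X \<odot> v \<in> rad" unfolding X_def by (rule rad_mul_right[OF x])
  \<comment> \<open>\<open>X \<odot> v\<close> is again in the radical, so it sends \<open>s\<close>
    into \<open>N\<close>; centrality of \<open>k\<close> allows the averaging factor to be pulled
    to the left first.\<close>
  have "X = X \<odot> v \<odot> (e - k \<odot> j)" using v by (simp add: mul_assoc X_def sum_mul)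
  also have "\<dots> = (X \<odot> v \<odot> k) \<odot> n + (X \<odot> v \<odot> k) \<odot> s" by (simp add: e distribs)
  also have "X \<odot> v \<odot> k = k \<odot> (X \<odot> v)" by (simp add: k(1))
  also have "k \<odot> (X \<odot> v) \<odot> n + k \<odot> (X \<odot> v) \<odot> s \<in> N"
    using N_plus N_left jn(2) Ys[OF Xv] by (metis mul_assoc)
  finally have "X \<in> N" .
  then obtain l where "\<forall>g\<in>G. l g \<in> L" "X = (\<Sum>g\<in>G. w g \<odot> \<iota> (l g))" by (auto simp: N_def)
  then show "x g \<in> L" using free[of x l g] g by (simp add: X_def)
qed simp

end

section \<open>Multilinear sums\<close>

abbreviation "lin \<equiv> Vector_Spaces.linear"

text \<open>Each structure map contributes its linearity rule once it is available; linearity of a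
  nested Sweedler sum in any of its variables is then a matter of
  \<open>intro lin_intros\<close>.\<close>

named_theorems lin_intros

lemma vector_space_field: "vector_space ((*) :: 'k::field \<Rightarrow> 'k \<Rightarrow> 'k)"
  by unfold_locales (simp_all add: algebra_simps)

lemma linD:
  assumes "lin sU sV f"
  shows "vector_space sU" "vector_space sV" "f (x + y) = f x + f y" "f (sU c x) = sV c (f x)"
  using assms by (auto simp: Vector_Spaces.linear_iff)

lemma lin_zero: "lin sU sV f \<Longrightarrow> f 0 = 0"
  using linD(3)[of sU sV f 0 0] by simp

lemma lin_diff: "lin sU sV f \<Longrightarrow> f (x - y) = f x - f y"
  using linD(3)[of sU sV f "x - y" y] by simp

lemma lin_sum: "lin sU sV f \<Longrightarrow> f (\<Sum>i\<in>I. g i) = (\<Sum>i\<in>I. f (g i))"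
  by (induction I rule: infinite_finite_induct) (auto simp: linD lin_zero)

lemma lin_sum_list: "lin sU sV f \<Longrightarrow> f (sum_list (map g xs)) = (\<Sum>i\<leftarrow>xs. f (g i))"
  by (induction xs) (auto simp: linD lin_zero)

lemma linI:
  assumes "vector_space sU" "vector_space sV"
    and "\<And>x y. f (x + y) = f x + f y" "\<And>c x. f (sU c x) = sV c (f x)"
  shows "lin sU sV f"
  using assms by (simp add: Vector_Spaces.linear_iff)

lemma lin_ident [lin_intros]: "vector_space s \<Longrightarrow> lin s s (\<lambda>x. x)"
  by (rule linI) simp_all

lemma lin_comp: "lin sV sW F \<Longrightarrow> lin sU sV g \<Longrightarrow> lin sU sW (\<lambda>x. F (g x))"
  by (simp add: Vector_Spaces.linear_iff)

lemma lin_plus: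
  assumes f: "lin sU sV f" and g: "lin sU sV g"
  shows "lin sU sV (\<lambda>x. f x + g x)"
proof -
  interpret vector_space sV using f by (rule linD)
  show ?thesis
    using linD(3,4)[OF f] linD(3,4)[OF g] by (intro linI linD(1,2)[OF f]) (simp_all add: scale_right_distrib)
qed

lemma lin_const_zero:
  assumes "vector_space sU" "vector_space sV"
  shows "lin sU sV (\<lambda>x. 0)"
proof -
  interpret vector_space sV by fact
  show ?thesis using assms by (intro linI) simp_all
qed

lemma lin_sum_list_fun:
  assumes "vector_space sU" "vector_space sV" "\<And>i. i \<in> set xs \<Longrightarrow> lin sU sV (\<lambda>x. f i x)"
  shows "lin sU sV (\<lambda>x. \<Sum>i\<leftarrow>xs. f i x)"
  using assms(3) by (induction xs) (auto intro: lin_plus lin_const_zero assms)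

lemma lin_sum_fun:
  assumes "vector_space sU" "vector_space sV" "\<And>i. i \<in> I \<Longrightarrow> lin sU sV (\<lambda>x. f i x)"
  shows "lin sU sV (\<lambda>x. \<Sum>i\<in>I. f i x)"
  using assms(3) by (induction I rule: infinite_finite_induct) (auto intro: lin_plus lin_const_zero assms)

lemma lin_scale_fun [lin_intros]:
  assumes f: "lin sU sV f"
  shows "lin sU sV (\<lambda>x. sV c (f x))"
proof -
  interpret vector_space sV using f by (rule linD)
  show ?thesis
    using linD(3,4)[OF f] by (intro linI linD(1,2)[OF f]) (simp_all add: scale_right_distrib mult.commute)
qed

lemma lin_scale_vector [lin_intros]:
  assumes V: "vector_space sV" and f: "lin sU (*) f"
  shows "lin sU sV (\<lambda>x. sV (f x) v)"
proof -
  interpret vector_space sV by fact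
  show ?thesis
    using linD(3,4)[OF f] by (intro linI linD(1)[OF f] V) (simp_all add: scale_left_distrib)
qed

lemma lin_mult_field [lin_intros]:
  fixes f :: "'u::ab_group_add \<Rightarrow> 'k::field"
  assumes f: "lin sU (*) f"
  shows "lin sU (*) (\<lambda>x. f x * c)"
  using lin_scale_fun[OF f, of c] by (simp add: mult.commute)

lemma (in k_algebra) lin_mult:
  assumes f: "lin sU scale f"
  shows "lin sU scale (\<lambda>x. f x * a)" "lin sU scale (\<lambda>x. a * f x)"
  using linD(3,4)[OF f]
  by (intro linI linD(1,2)[OF f]; simp add: ring_distribs scale_mult_left scale_mult_right)+

lemma bilinear_mapI:
  "(\<And>v. lin sU sW (\<lambda>u. f u v)) \<Longrightarrow> (\<And>u. lin sV sW (\<lambda>v. f u v)) \<Longrightarrow> bilinear_map sU sV sW f"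
  by (simp add: bilinear_map_def)

lemma bilinear_mapD:
  assumes "bilinear_map sU sV sW f"
  shows "lin sU sW (\<lambda>u. f u v)" "lin sV sW (\<lambda>v. f u v)"
  using assms by (auto simp: bilinear_map_def)

lemma bilinear_lin:
  assumes "bilinear_map sU sV sW f"
  shows "lin s sU g \<Longrightarrow> lin s sW (\<lambda>x. f (g x) v)" "lin s sV h \<Longrightarrow> lin s sW (\<lambda>x. f u (h x))"
  using lin_comp[OF bilinear_mapD(1)[OF assms]] lin_comp[OF bilinear_mapD(2)[OF assms]] by auto

context vector_space
begin

text \<open>Only finitely many vectors are expanded, but the coordinates \<open>f b\<close> are
  functionals on the whole space. Hence an identity known for all functionals may be applied to
  them.\<close>

lemma coordinates_exist:
  assumes "finite V"
  obtains B f where "finite B" "\<And>b. lin scale (*) (f b)" "\<And>v. v \<in> V \<Longrightarrow> v = (\<Sum>b\<in>B. scale (f b v) b)"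
proof -
  let ?E = "extend_basis {}"
  have E: "independent ?E" "span ?E = UNIV"
    using independent_extend_basis span_extend_basis independent_empty by auto
  let ?f = "\<lambda>b v. representation ?E v b"
  let ?B = "\<Union>v\<in>V. {b. representation ?E v b \<noteq> 0}"
  have fin: "finite ?B" using assms finite_representation by auto
  have "v = (\<Sum>b\<in>?B. scale (?f b v) b)" if "v \<in> V" for v
  proof -
    have "(\<Sum>b\<in>?B. scale (?f b v) b) = (\<Sum>b | representation ?E v b \<noteq> 0. scale (?f b v) b)"
      by (rule sum.mono_neutral_right) (use fin that in auto)
    also have "\<dots> = v" using E by (intro sum_nonzero_representation_eq) auto
    finally show ?thesis ..
  qed
  then show thesis
    using that[of ?B ?f] fin linear_representation[OF E] by blast
qed

lemma functional_exists:
  assumes "x \<noteq> 0"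
  obtains f where "lin scale (*) f" "f x = 1"
proof -
  obtain B f where "finite B" and B: "\<And>b. lin scale (*) (f b)"
      "\<And>v. v \<in> {x} \<Longrightarrow> v = (\<Sum>b\<in>B. scale (f b v) b)"
    by (rule coordinates_exist[of "{x}"]) (simp, rule that)
  have "\<exists>b. f b x \<noteq> 0"
  proof (rule ccontr)
    assume "\<nexists>b. f b x \<noteq> 0"
    then show False using B(2)[of x] assms by simp
  qed
  then obtain b where b: "f b x \<noteq> 0" ..
  have "lin scale (*) (\<lambda>y. f b y * inverse (f b x))"
    by (rule lin_mult_field) (rule B)
  then show thesis using b by (intro that[of "\<lambda>y. f b y * inverse (f b x)"]) simp_all
qed

lemma functionals_separate:
  assumes "\<And>f. lin scale (*) f \<Longrightarrow> f x = f y"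
  shows "x = y"
proof (rule ccontr)
  assume "x \<noteq> y"
  then obtain f where f: "lin scale (*) f" "f (x - y) = 1" using functional_exists[of "x - y"] by auto
  then show False using assms[OF f(1)] lin_diff[OF f(1), of x y] by simp
qed

lemma projection_exists:
  assumes "subspace K"
  obtains P where "lin scale scale P" "\<And>x. P x \<in> K" "\<And>x. x \<in> K \<Longrightarrow> P x = x"
proof -
  interpret vector_space_pair scale scale by unfold_locales
  have "\<exists>g. g ` UNIV \<subseteq> K \<and> lin scale scale g \<and> (\<forall>v\<in>K. g (v) = v)"
    using linear_exists_left_inverse_on[OF lin_ident[OF vector_space_axioms] assms] by (simp add: inj_on_def)
  then show thesis using that by blast
qed

end


section \<open>Tensors\<close>

text \<open>
  The map \<open>\<tau>\<close> is the quotient map by the tensor relations, realised inside the free vector space by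
  means of a linear projection.
\<close>

lemma tensor_universal:
  fixes sU :: "'k::field \<Rightarrow> 'u::ab_group_add \<Rightarrow> 'u" and sV :: "'k \<Rightarrow> 'v::ab_group_add \<Rightarrow> 'v"
  assumes U: "vector_space sU" and V: "vector_space sV"
  obtains \<tau> :: "'u \<Rightarrow> 'v \<Rightarrow> ('u \<times> 'v \<Rightarrow>\<^sub>0 'k)"
  where "bilinear_map sU sV free_scale \<tau>"
    and "\<And>xs ys. ys \<in> tensor sU sV xs \<longleftrightarrow> (\<Sum>(u, v)\<leftarrow>ys. \<tau> u v) = (\<Sum>(u, v)\<leftarrow>xs. \<tau> u v)"
proof -
  interpret F: vector_space "free_scale :: 'k \<Rightarrow> ('u \<times> 'v \<Rightarrow>\<^sub>0 'k) \<Rightarrow> _" by (rule vector_space_free_scale)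
  let ?T = "tensor_relations sU sV"
  have T: "F.subspace ?T" unfolding tensor_relations_def by (rule F.subspace_span)
  obtain P where P: "lin free_scale free_scale P" "\<And>x. P x \<in> ?T" "\<And>x. x \<in> ?T \<Longrightarrow> P x = x"
    using F.projection_exists[OF T] by blast
  define \<pi> where "\<pi> x = x - P x" for x
  have \<pi>_diff: "\<pi> (x - y) = \<pi> x - \<pi> y" for x y by (simp add: \<pi>_def lin_diff[OF P(1)])
  have \<pi>_add: "\<pi> (x + y) = \<pi> x + \<pi> y" for x y by (simp add: \<pi>_def linD(3)[OF P(1)])
  have \<pi>_scale: "\<pi> (free_scale c x) = free_scale c (\<pi> x)" for c x
    by (simp add: \<pi>_def linD(4)[OF P(1)] F.scale_right_diff_distrib)
  have \<pi>_0: "\<pi> x = 0 \<longleftrightarrow> x \<in> ?T" for x using P(2)[of x] P(3)[of x] by (auto simp: \<pi>_def)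
  have eq: "\<pi> x = \<pi> y" if "x - y \<in> ?T" for x y using that \<pi>_0[of "x - y"] by (simp add: \<pi>_diff)
  have single: "formal_sum [x] = Poly_Mapping.single x (1::'k)" for x :: "'u \<times> 'v"
    by (simp add: formal_sum_def)
  have cons: "formal_sum (x # xs) = Poly_Mapping.single x (1::'k) + formal_sum xs" for x :: "'u \<times> 'v" and xs
    by (simp add: formal_sum_def)
  define \<tau> where "\<tau> u v = \<pi> (Poly_Mapping.single (u, v) 1)" for u v
  have sum: "(\<Sum>(u, v)\<leftarrow>xs. \<tau> u v) = \<pi> (formal_sum xs)" for xs
  proof (induction xs)
    case Nil
    have "\<pi> 0 = 0" using \<pi>_add[of 0 0] by simp
    then show ?case by (simp add: formal_sum_def)
  qed (auto simp: cons \<pi>_add \<tau>_def)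
  have "bilinear_map sU sV free_scale \<tau>"
  proof (intro bilinear_mapI linI U V vector_space_free_scale)
    fix u u' v v' c
    have "\<tau> (u + u') v = \<pi> (formal_sum [(u, v), (u', v)])"
      unfolding \<tau>_def single[symmetric]
      by (rule eq) (unfold tensor_relations_def, rule F.span_base, blast)
    then show "\<tau> (u + u') v = \<tau> u v + \<tau> u' v" by (simp add: \<tau>_def cons formal_sum_def \<pi>_add)
    have "\<tau> u (v + v') = \<pi> (formal_sum [(u, v), (u, v')])"
      unfolding \<tau>_def single[symmetric]
      by (rule eq) (unfold tensor_relations_def, rule F.span_base, blast)
    then show "\<tau> u (v + v') = \<tau> u v + \<tau> u v'" by (simp add: \<tau>_def cons formal_sum_def \<pi>_add)
    have "\<tau> (sU c u) v = \<pi> (free_scale c (formal_sum [(u, v)]))"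
      unfolding \<tau>_def single[symmetric]
      by (rule eq) (unfold tensor_relations_def, rule F.span_base, blast)
    then show "\<tau> (sU c u) v = free_scale c (\<tau> u v)" by (simp add: \<tau>_def single \<pi>_scale)
    have "\<tau> u (sV c v) = \<pi> (free_scale c (formal_sum [(u, v)]))"
      unfolding \<tau>_def single[symmetric]
      by (rule eq) (unfold tensor_relations_def, rule F.span_base, blast)
    then show "\<tau> u (sV c v) = free_scale c (\<tau> u v)" by (simp add: \<tau>_def single \<pi>_scale)
  qed
  moreover have "ys \<in> tensor sU sV xs \<longleftrightarrow> (\<Sum>(u, v)\<leftarrow>ys. \<tau> u v) = (\<Sum>(u, v)\<leftarrow>xs. \<tau> u v)" for xs ys
    unfolding sum tensor_def mem_Collect_eq \<pi>_0[symmetric] by (simp add: \<pi>_diff)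
  ultimately show thesis by (rule that)
qed

lemma tensor_eq_iff_mem:
  fixes sU :: "'k::field \<Rightarrow> 'u::ab_group_add \<Rightarrow> 'u" and sV :: "'k \<Rightarrow> 'v::ab_group_add \<Rightarrow> 'v"
  assumes U: "vector_space sU" and V: "vector_space sV"
  shows "tensor sU sV ys = tensor sU sV xs \<longleftrightarrow> ys \<in> tensor sU sV xs"
proof -
  obtain \<tau> :: "'u \<Rightarrow> 'v \<Rightarrow> ('u \<times> 'v \<Rightarrow>\<^sub>0 'k)"
    where "bilinear_map sU sV free_scale \<tau>" and \<tau>: "\<And>xs ys. ys \<in> tensor sU sV xs \<longleftrightarrow> (\<Sum>(u, v)\<leftarrow>ys. \<tau> u v) = (\<Sum>(u, v)\<leftarrow>xs. \<tau> u v)"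
    by (rule tensor_universal[OF U V]) (rule that)
  show ?thesis by (auto simp: set_eq_iff \<tau>)
qed

text \<open>Expanding the finitely many second components in a common basis turns both sums into
  \<open>\<Sum> u_b \<otimes> b\<close>, and \<open>u_b\<close> is the contraction with the
  coordinate functional of \<open>b\<close>.\<close>

lemma tensor_eqI:
  fixes sU :: "'k::field \<Rightarrow> 'u::ab_group_add \<Rightarrow> 'u" and sV :: "'k \<Rightarrow> 'v::ab_group_add \<Rightarrow> 'v"
  assumes U: "vector_space sU" and V: "vector_space sV"
    and eq: "\<And>f. lin sV (*) f \<Longrightarrow> (\<Sum>(u, v)\<leftarrow>xs. sU (f v) u) = (\<Sum>(u, v)\<leftarrow>ys. sU (f v) u)"
  shows "tensor sU sV xs = tensor sU sV ys"
proof -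
  interpret U: vector_space sU by fact
  interpret V: vector_space sV by fact
  obtain \<tau> :: "'u \<Rightarrow> 'v \<Rightarrow> ('u \<times> 'v \<Rightarrow>\<^sub>0 'k)"
    where b: "bilinear_map sU sV free_scale \<tau>"
      and \<tau>: "\<And>xs ys. ys \<in> tensor sU sV xs \<longleftrightarrow> (\<Sum>(u, v)\<leftarrow>ys. \<tau> u v) = (\<Sum>(u, v)\<leftarrow>xs. \<tau> u v)"
    by (rule tensor_universal[OF U V]) (rule that)
  obtain B f where B: "finite B" "\<And>b. lin sV (*) (f b)"
    "\<And>v. v \<in> snd ` set (xs @ ys) \<Longrightarrow> v = (\<Sum>b\<in>B. sV (f b v) b)"
    by (rule V.coordinates_exist[of "snd ` set (xs @ ys)"]) (simp, rule that)
  have expand: "(\<Sum>(u, v)\<leftarrow>zs. \<tau> u v) = (\<Sum>b\<in>B. \<tau> (\<Sum>(u, v)\<leftarrow>zs. sU (f b v) u) b)"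
    if "set zs \<subseteq> set (xs @ ys)" for zs
    using that
  proof (induction zs)
    case Nil
    then show ?case by (simp add: lin_zero[OF bilinear_mapD(1)[OF b]])
  next
    case (Cons z zs)
    obtain u v where z: "z = (u, v)" by (cases z)
    have "v \<in> snd ` set (xs @ ys)" using Cons.prems z by force
    then have "\<tau> u v = \<tau> u (\<Sum>b\<in>B. sV (f b v) b)" using B(3) by metis
    also have "\<dots> = (\<Sum>b\<in>B. \<tau> (sU (f b v) u) b)"
      by (simp add: lin_sum[OF bilinear_mapD(2)[OF b]] linD(4)[OF bilinear_mapD(1)[OF b]] linD(4)[OF bilinear_mapD(2)[OF b]])
    finally show ?case
      using Cons by (simp add: z linD(3)[OF bilinear_mapD(1)[OF b]] sum.distrib)
  qed
  have "(\<Sum>(u, v)\<leftarrow>xs. \<tau> u v) = (\<Sum>(u, v)\<leftarrow>ys. \<tau> u v)"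
    using eq[OF B(2)] by (simp add: expand)
  then show ?thesis
    using \<tau> tensor_eq_iff_mem[OF U V] by metis
qed

lemma tensor3_sum_cong:
  assumes f: "\<And>v w. lin sU sW (\<lambda>u. f u v w)" "\<And>u w. lin sV sW (\<lambda>v. f u v w)"
      "\<And>u v. lin sX sW (\<lambda>w. f u v w)"
    and eq: "tensor3 sU sV sX xs = tensor3 sU sV sX ys"
  shows "(\<Sum>(u, v, w)\<leftarrow>xs. f u v w) = (\<Sum>(u, v, w)\<leftarrow>ys. f u v w)"
proof -
  interpret F: vector_space free_scale by (rule vector_space_free_scale)
  have W: "vector_space sW" using linD(2)[OF f(1)] .
  let ?e = "free_extension sW (\<lambda>(u, v, w). f u v w)"
  have e: "lin free_scale sW ?e" by (rule linear_free_extension[OF W])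
  interpret W: vector_space sW by (rule W)
  have single: "?e (Poly_Mapping.single (u, v, w) c) = sW c (f u v w)" for u v w c
    by (simp add: free_extension_single[OF W])
  have sum: "?e (formal_sum zs) = (\<Sum>(u, v, w)\<leftarrow>zs. f u v w)" for zs
    by (induction zs) (auto simp: formal_sum_def linD(3)[OF e] lin_zero[OF e] single)
  note multi = linD(3,4)[OF f(1)] linD(3,4)[OF f(2)] linD(3,4)[OF f(3)]
  have zero: "?e p = 0" if "p \<in> tensor3_relations sU sV sX" for p
    using that unfolding tensor3_relations_def
  proof (induction rule: F.span_induct_alt)
    case (step c x y)
    then have "?e x = 0"
      by (auto simp: lin_diff[OF e] linD(4)[OF e] sum multi)
    then show ?case
      using step by (simp add: linD(3,4)[OF e])
  qed (rule lin_zero[OF e])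
  have "ys \<in> tensor3 sU sV sX xs"
    unfolding eq by (simp add: tensor3_def tensor3_relations_def F.span_zero)
  then have "?e (formal_sum ys - formal_sum xs) = 0"
    by (intro zero) (simp add: tensor3_def)
  then show ?thesis
    by (simp add: lin_diff[OF e] sum)
qed


section \<open>Sums over comultiplications\<close>

context hopf_algebra
begin

text \<open>For bilinear \<open>f\<close> this is the linear map induced by \<open>f\<close> on the
  tensor product, composed with the comultiplication.\<close>

definition SW :: "('h \<Rightarrow> 'h \<Rightarrow> 'w::ab_group_add) \<Rightarrow> 'h \<Rightarrow> 'w"
  where "SW f h = (\<Sum>(h1, h2)\<leftarrow>sweedler \<Delta> h. f h1 h2)"

lemma vector_space_H: "vector_space scale" by (rule vector_space_axioms)

lemma tensor_sweedler: "tensor scale scale (sweedler \<Delta> h) = \<Delta> h"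
proof -
  obtain xs where xs: "\<Delta> h = tensor scale scale xs"
    using comult_closed[of h] by (auto simp: tensor_product_def)
  have "xs \<in> \<Delta> h" unfolding xs using tensor_eq_iff_mem[OF vector_space_H vector_space_H] by blast
  then have "sweedler \<Delta> h \<in> tensor scale scale xs"
    unfolding sweedler_def tensor_rep_def xs[symmetric] by (rule someI)
  then show ?thesis using tensor_eq_iff_mem[OF vector_space_H vector_space_H] xs by blast
qed

lemma SW_eq:
  assumes "bilinear_map scale scale sW f" "\<Delta> h = tensor scale scale xs"
  shows "SW f h = (\<Sum>(u, v)\<leftarrow>xs. f u v)"
  unfolding SW_def using assms tensor_sweedler by (intro tensor_sum_cong) auto

lemma SW_lin:
  assumes f: "bilinear_map scale scale sW f"
  shows "lin scale sW (SW f)"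
proof (intro linI vector_space_H)
  show "vector_space sW" using linD(2)[OF bilinear_mapD(1)[OF f]] .
  fix g h c
  show "SW f (g + h) = SW f g + SW f h"
    by (subst SW_eq[OF f comult_add]) (simp add: SW_def)
  have "SW f (scale c h) = (\<Sum>(h1, h2)\<leftarrow>sweedler \<Delta> h. f (scale c h1) h2)"
    by (subst SW_eq[OF f comult_scale]) (simp add: case_prod_unfold o_def)
  also have "\<dots> = sW c (SW f h)"
    unfolding SW_def linD(4)[OF bilinear_mapD(1)[OF f]]
    by (subst lin_sum_list[OF lin_scale_fun[OF lin_ident[OF \<open>vector_space sW\<close>]]]) (simp add: case_prod_unfold)
  finally show "SW f (scale c h) = sW c (SW f h)" .
qed

lemma lin_SW_arg: "(\<And>y. lin scale sW (\<lambda>x. f x y)) \<Longrightarrow> (\<And>x. lin scale sW (\<lambda>y. f x y)) \<Longrightarrow>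
    lin s scale g \<Longrightarrow> lin s sW (\<lambda>x. SW (\<lambda>x y. f x y) (g x))"
  by (rule lin_comp[OF SW_lin]) (rule bilinear_mapI; assumption)

lemma lin_SW_fun: "(\<And>y z. lin s sW (\<lambda>x. f x y z)) \<Longrightarrow> lin s sW (\<lambda>x. SW (\<lambda>y z. f x y z) h)"
  unfolding SW_def by (rule lin_sum_list_fun) (auto intro: linD)

lemma lin_eps: "lin s scale g \<Longrightarrow> lin s (*) (\<lambda>x. \<epsilon> (g x))"
  by (rule lin_comp[OF counit_linear])

lemma lin_antipode: "lin s scale g \<Longrightarrow> lin s scale (\<lambda>x. S (g x))"
  by (rule lin_comp[OF antipode_linear])

lemmas [lin_intros] = lin_SW_arg lin_SW_fun lin_eps lin_antipode lin_mult vector_space_H vector_space_field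

lemma SW_comp: "lin sV sW F \<Longrightarrow> F (SW f h) = SW (\<lambda>x y. F (f x y)) h"
  unfolding SW_def by (simp add: lin_sum_list case_prod_unfold)

lemma SW_cong: "(\<And>x y. f x y = g x y) \<Longrightarrow> SW f h = SW g h"
  by (simp add: SW_def)

lemma SW_add: "SW (\<lambda>x y. f x y + g x y) h = SW f h + SW g h"
  by (simp add: SW_def sum_list_addf case_prod_unfold)

lemma SW_zero: "SW (\<lambda>x y. 0) h = 0"
  by (simp add: SW_def case_prod_unfold)

lemma SW_sum: "SW (\<lambda>x y. \<Sum>i\<in>I. f i x y) h = (\<Sum>i\<in>I. SW (f i) h)"
  by (induction I rule: infinite_finite_induct) (auto simp: SW_add SW_zero)

lemma SW_swap: "SW (\<lambda>x y. SW (\<lambda>u v. f x y u v) g) h = SW (\<lambda>u v. SW (\<lambda>x y. f x y u v) h) g"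
proof -
  have "(\<Sum>p\<leftarrow>xs. \<Sum>q\<leftarrow>ys. F p q) = (\<Sum>q\<leftarrow>ys. \<Sum>p\<leftarrow>xs. F p q)"
    for F :: "'x \<Rightarrow> 'y \<Rightarrow> 'z::ab_group_add" and xs ys
    by (induction xs) (auto simp: sum_list_addf)
  then show ?thesis by (simp add: SW_def case_prod_unfold)
qed

lemma sum_list_concat_map: "sum_list (map f (concat (map g xs))) = (\<Sum>x\<leftarrow>xs. sum_list (map f (g x)))"
  by (induction xs) auto

lemma SW_mult:
  assumes "bilinear_map scale scale sW f"
  shows "SW f (g * h) = SW (\<lambda>g1 g2. SW (\<lambda>h1 h2. f (g1 * h1) (g2 * h2)) h) g"
  by (subst SW_eq[OF assms comult_mult]) (simp add: SW_def sum_list_concat_map case_prod_unfold o_def)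

lemma SW_one:
  assumes "bilinear_map scale scale sW f"
  shows "SW f 1 = f 1 1"
  by (subst SW_eq[OF assms comult_one]) simp

lemma SW_coassoc:
  assumes f: "\<And>v w. lin scale sW (\<lambda>u. f u v w)" "\<And>u w. lin scale sW (\<lambda>v. f u v w)"
      "\<And>u v. lin scale sW (\<lambda>w. f u v w)"
  shows "SW (\<lambda>h' h3. SW (\<lambda>h1 h2. f h1 h2 h3) h') h = SW (\<lambda>h1 h'. SW (\<lambda>h2 h3. f h1 h2 h3) h') h"
  using tensor3_sum_cong[OF f coassoc[of h]]
  by (simp add: SW_def sum_list_concat_map case_prod_unfold o_def)

lemma SW_counit_left:
  assumes "lin scale sW g"
  shows "SW (\<lambda>x y. sW (\<epsilon> x) (g y)) h = g h"
proof -
  have "g h = g (SW (\<lambda>x y. scale (\<epsilon> x) y) h)" by (simp add: SW_def counit_left)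
  then show ?thesis by (simp add: SW_comp[OF assms] linD(4)[OF assms])
qed

lemma SW_counit_right:
  assumes "lin scale sW g"
  shows "SW (\<lambda>x y. sW (\<epsilon> y) (g x)) h = g h"
proof -
  have "g h = g (SW (\<lambda>x y. scale (\<epsilon> y) x) h)" by (simp add: SW_def counit_right)
  then show ?thesis by (simp add: SW_comp[OF assms] linD(4)[OF assms])
qed

lemma SW_antipode_left:
  assumes "lin scale sW g"
  shows "SW (\<lambda>x y. g (S x * y)) h = sW (\<epsilon> h) (g 1)"
proof -
  have "g (scale (\<epsilon> h) 1) = g (SW (\<lambda>x y. S x * y) h)" by (simp add: SW_def antipode_left)
  then show ?thesis by (simp add: SW_comp[OF assms] linD(4)[OF assms])
qed

lemma comult_eqI:
  assumes "\<And>f. lin scale (*) f \<Longrightarrow> SW (\<lambda>x y. scale (f y) x) h = (\<Sum>(u, v)\<leftarrow>xs. scale (f v) u)"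
  shows "\<Delta> h = tensor scale scale xs"
proof -
  have "tensor scale scale (sweedler \<Delta> h) = tensor scale scale xs"
    using assms by (intro tensor_eqI vector_space_H) (simp add: SW_def)
  then show ?thesis by (simp add: tensor_sweedler)
qed

end


section \<open>Integrals\<close>

lemma ring_type_ring: "ring (type_ring :: 'a::{ring, monoid_mult} ring)"
proof (rule ringI)
  show "abelian_group (type_ring :: 'a ring)"
    by (rule abelian_groupI) (auto simp: type_ring_def algebra_simps intro: exI[of _ "- _"])
  show "Group.monoid (type_ring :: 'a ring)"
    by unfold_locales (auto simp: type_ring_def mult.assoc)
qed (auto simp: type_ring_def ring_distribs)

lemma left_ideal_type_ring:
  "left_ideal (type_ring :: 'a::{ring, monoid_mult} ring) I \<longleftrightarrow> regular.lideal I"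
  using regular.left_ideal_transport[OF ring_type_ring, of "\<lambda>x. x"]
  by (simp add: type_ring_def bij_betw_def)

lemma jacobson_radical_type_ring:
  "jacobson_radical (type_ring :: 'a::{ring, monoid_mult} ring) = regular.rad"
  using regular.jacobson_radical_transport[OF ring_type_ring, of "\<lambda>x. x"]
  by (simp add: type_ring_def bij_betw_def)

context hopf_algebra
begin

text \<open>A complement of the augmentation ideal is spanned by an integral.\<close>

lemma integral_exists:
  assumes "semisimple_ring (type_ring :: 'h ring)"
  obtains t where "\<And>h. h * t = scale (\<epsilon> h) t" "\<epsilon> t = 1"
proof -
  let ?I = "{h. \<epsilon> h = 0}"
  have I: "left_ideal type_ring ?I"
    unfolding left_ideal_type_ring regular.lideal_def
    by (auto simp: counit_mult linD(3)[OF counit_linear] lin_zero[OF counit_linear])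
  have "\<exists>J. left_ideal type_ring J \<and> ?I \<inter> J = {\<zero>\<^bsub>type_ring\<^esub>} \<and> ?I <+>\<^bsub>type_ring\<^esub> J = carrier type_ring"
    using assms I unfolding semisimple_ring_def by blast
  then obtain J where "left_ideal type_ring J" "?I \<inter> J = {\<zero>\<^bsub>type_ring\<^esub>}" "?I <+>\<^bsub>type_ring\<^esub> J = carrier type_ring"
    by blast
  then have J: "left_ideal type_ring J" "?I \<inter> J = {0}" "?I <+>\<^bsub>type_ring\<^esub> J = UNIV"
    by (simp_all add: type_ring_def)
  have "1 \<in> ?I <+>\<^bsub>type_ring\<^esub> J" using J(3) by simp
  then obtain x t where xt: "\<epsilon> x = 0" "t \<in> J" "1 = x + t"
    by (auto simp: type_ring_def set_add_def set_mult_def)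
  have t: "\<epsilon> t = 1" using counit_one linD(3)[OF counit_linear, of x t] xt by simp
  note J' = regular.lidealD[OF J(1)[unfolded left_ideal_type_ring]]
  \<comment> \<open>Both terms are multiples of \<open>t\<close>, so their difference is in
    \<open>J\<close>; as \<open>\<epsilon> t = 1\<close>, it is also in the augmentation ideal,
    which meets \<open>J\<close> only in \<open>0\<close>.\<close>
  have "h * t - scale (\<epsilon> h) t \<in> ?I \<inter> J" for h
  proof
    show "h * t - scale (\<epsilon> h) t \<in> ?I"
      by (simp add: lin_diff[OF counit_linear] linD(4)[OF counit_linear] counit_mult t)
    have "scale (\<epsilon> h) t = scale (\<epsilon> h) 1 * t" by (simp add: scale_mult_left)
    then show "h * t - scale (\<epsilon> h) t \<in> J" using J'(4,6) xt(2) by simp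
  qed
  then show thesis using that[of t] t J(2) by simp
qed

end

section \<open>Common eigenvectors\<close>

context vector_space
begin

lemma dim_psubset:
  assumes "finite B" "N \<subseteq> span B" "subspace N'" "N' \<subset> N"
  shows "dim N' < dim N"
proof -
  obtain b' where b': "b' \<subseteq> N'" "independent b'" "N' \<subseteq> span b'"
    using maximal_independent_subset by blast
  have N': "span b' = N'"
    using b' assms(3) by (intro antisym span_minimal) auto
  obtain b where b: "b' \<subseteq> b" "b \<subseteq> N" "independent b" "N \<subseteq> span b"
    using maximal_independent_subset_extend[of b' N] b' assms(4) by blast
  have "finite b" using independent_span_bound[OF assms(1) b(3)] b(2) assms(2) by auto
  moreover have "b' \<noteq> b" using N' b(4) assms(4) by auto
  ultimately have "card b' < card b" using b(1) by (intro psubset_card_mono) auto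
  then show ?thesis using basis_card_eq_dim b b' by metis
qed

end

text \<open>Let \<open>p\<close> be of least degree among the nonzero polynomials with
  \<open>p(T) n = 0\<close>. It has a root \<open>c\<close>, and for \<open>p = (X - c) q\<close>
  minimality makes \<open>q(T) n\<close> a nonzero eigenvector.\<close>

lemma eigenvector_exists:
  fixes scale :: "'k::alg_closed_field \<Rightarrow> 'v::ab_group_add \<Rightarrow> 'v"
  assumes T: "lin scale scale T" and N: "module.subspace scale N" "N \<subseteq> module.span scale B" "finite B"
    and inv: "\<And>x. x \<in> N \<Longrightarrow> T x \<in> N" and n: "n \<in> N" "n \<noteq> 0"
  obtains c v where "v \<in> N" "v \<noteq> 0" "T v = scale c v"
proof -
  interpret vector_space scale using T by (rule linD)
  define ev where "ev p = (\<Sum>i\<le>degree p. scale (coeff p i) ((T ^^ i) n))" for p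
  have ev: "ev p = (\<Sum>i\<le>m. scale (coeff p i) ((T ^^ i) n))" if "degree p \<le> m" for p m
    unfolding ev_def using that by (intro sum.mono_neutral_left) (auto simp: coeff_eq_0 not_le)
  have ev_add: "ev (p + q) = ev p + ev q" for p q
    using ev[of p "max (degree p) (degree q)"] ev[of q "max (degree p) (degree q)"]
      ev[OF degree_add_le_max[of p q]]
    by (simp add: scale_left_distrib sum.distrib)
  have ev_smult: "ev (smult c p) = scale c (ev p)" for c p
    using ev[OF degree_smult_le[of c p]] by (simp add: ev_def scale_sum_right)
  have ev_shift: "ev (pCons 0 p) = T (ev p)" for p
  proof -
    have "ev (pCons 0 p) = (\<Sum>i\<le>Suc (degree p). scale (coeff (pCons 0 p) i) ((T ^^ i) n))"
      by (rule ev) (rule degree_pCons_le)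
    also have "\<dots> = (\<Sum>i\<le>degree p. scale (coeff p i) (T ((T ^^ i) n)))"
      by (subst sum.atMost_Suc_shift) simp
    also have "\<dots> = T (ev p)" by (simp add: ev_def lin_sum[OF T] linD(4)[OF T])
    finally show ?thesis .
  qed
  have T_N: "(T ^^ i) n \<in> N" for i by (induction i) (auto simp: n inv)
  have ev_N: "ev p \<in> N" for p
    unfolding ev_def using N(1) T_N by (intro subspace_sum subspace_scale)
  have "\<exists>p. p \<noteq> 0 \<and> ev p = 0"
  proof (rule ccontr)
    \<comment> \<open>Otherwise the iterates of \<open>n\<close> are distinct and independent, and
      \<open>card B + 1\<close> of them would lie in the span of \<open>B\<close>.\<close>
    assume no: "\<nexists>p. p \<noteq> 0 \<and> ev p = 0"
    let ?M = "\<lambda>i. (T ^^ i) n"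
    have ev_monom: "ev (monom c i) = scale c (?M i)" for c i
    proof -
      have "ev (monom c i) = (\<Sum>j\<le>i. scale (coeff (monom c i) j) (?M j))"
        by (rule ev) (rule degree_monom_le)
      also have "\<dots> = (\<Sum>j\<in>{i}. scale (coeff (monom c i) j) (?M j))"
        by (rule sum.mono_neutral_right) auto
      finally show ?thesis by simp
    qed
    have inj: "inj ?M"
    proof (rule injI, rule ccontr)
      fix i j assume ij: "?M i = ?M j" "i \<noteq> j"
      have "ev (monom 1 i + monom (-1) j) = 0" using ij by (simp add: ev_add ev_monom)
      moreover have "coeff (monom 1 i + monom (-1) j) i \<noteq> (0::'k)" using ij by simp
      then have "monom 1 i + monom (-1) j \<noteq> (0 :: 'k poly)" by (metis coeff_0)
      ultimately show False using no by blast
    qed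
    define m where "m = card B"
    have "independent (?M ` {..m})"
    proof (rule independent_if_scalars_zero)
      fix f x assume sum: "(\<Sum>x\<in>?M ` {..m}. scale (f x) x) = 0" and x: "x \<in> ?M ` {..m}"
      define p where "p = (\<Sum>i\<le>m. monom (f (?M i)) i)"
      have coeff_p: "coeff p i = f (?M i)" if "i \<le> m" for i
        unfolding p_def using that by (simp add: coeff_sum)
      have ev_sum: "ev (\<Sum>i\<in>I. q i) = (\<Sum>i\<in>I. ev (q i))" if "finite I" for q and I :: "nat set"
        using that by (induction I rule: finite_induct) (auto simp: ev_add, simp add: ev_def)
      have "ev p = (\<Sum>i\<le>m. scale (f (?M i)) (?M i))"
        unfolding p_def by (simp add: ev_sum ev_monom)
      also have "\<dots> = (\<Sum>x\<in>?M ` {..m}. scale (f x) x)"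
        by (subst sum.reindex) (simp_all add: inj_on_subset[OF inj])
      finally have "ev p = 0" using sum by simp
      then have "p = 0" using no by blast
      moreover obtain i where "i \<le> m" "x = ?M i" using x by blast
      ultimately show "f x = 0" using coeff_p[of i] by simp
    qed simp
    moreover have "?M ` {..m} \<subseteq> span B" using T_N N(2) by blast
    ultimately have "card (?M ` {..m}) \<le> card B"
      using independent_span_bound[OF N(3)] by blast
    then show False using inj by (simp add: card_image inj_on_subset m_def)
  qed
  then obtain p where p: "p \<noteq> 0" "ev p = 0" and min: "\<And>q. q \<noteq> 0 \<Longrightarrow> ev q = 0 \<Longrightarrow> degree p \<le> degree q"
    using ex_has_least_nat[of "\<lambda>p. p \<noteq> 0 \<and> ev p = 0" _ degree] by blast
  have "degree p > 0"
  proof (rule ccontr)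
    assume "\<not> degree p > 0"
    then obtain a where a: "p = [:a:]" using degree_eq_zeroE by blast
    then have "ev p = scale a n" by (simp add: ev_def)
    then show False using p a n by simp
  qed
  then obtain c where "poly p c = 0" using alg_closed_imp_poly_has_root by blast
  then obtain q where q: "p = [:- c, 1:] * q" by (metis dvdE poly_eq_0_iff_dvd)
  have "q \<noteq> 0" using p q by auto
  have "degree q < degree p" using \<open>q \<noteq> 0\<close> unfolding q by (subst degree_mult_eq) auto
  then have "ev q \<noteq> 0" using min[OF \<open>q \<noteq> 0\<close>] by auto
  have eq: "p = smult (- c) q + pCons 0 q" by (simp add: q)
  have "ev p = scale (- c) (ev q) + T (ev q)" unfolding eq by (simp only: ev_add ev_smult ev_shift)
  then have "T (ev q) - scale c (ev q) = 0" using p(2) by simp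
  then have "T (ev q) = scale c (ev q)" by simp
  then show thesis using that ev_N \<open>ev q \<noteq> 0\<close> by blast
qed

text \<open>If a chosen vector fails to be an eigenvector of some \<open>T i\<close>, the space
  \<open>N\<close> shrinks to an eigenspace of \<open>T i\<close>, which is proper, nonzero and, by
  commutation, invariant under the whole family. The dimension bounds this descent even for an
  infinite family.\<close>

lemma common_eigenvector:
  fixes scale :: "'k::alg_closed_field \<Rightarrow> 'v::ab_group_add \<Rightarrow> 'v"
  assumes V: "vector_space scale" and N: "module.subspace scale N" "N \<subseteq> module.span scale B" "finite B" "N \<noteq> {0}"
    and T: "\<And>i. i \<in> I \<Longrightarrow> lin scale scale (T i)" "\<And>i x. i \<in> I \<Longrightarrow> x \<in> N \<Longrightarrow> T i x \<in> N"
      "\<And>i j x. i \<in> I \<Longrightarrow> j \<in> I \<Longrightarrow> x \<in> N \<Longrightarrow> T i (T j x) = T j (T i x)"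
  shows "\<exists>v\<in>N. v \<noteq> 0 \<and> (\<forall>i\<in>I. \<exists>c. T i v = scale c v)"
  using N T
proof (induction "vector_space.dim scale N" arbitrary: N rule: less_induct)
  case less
  interpret vector_space scale by fact
  obtain n where n: "n \<in> N" "n \<noteq> 0" using less.prems(1,4) subspace_0 by blast
  show ?case
  proof (cases "\<forall>i\<in>I. \<exists>c. T i n = scale c n")
    case True
    then show ?thesis using n by blast
  next
    case False
    then obtain i where i: "i \<in> I" "\<And>c. T i n \<noteq> scale c n" by blast
    obtain c v where v: "v \<in> N" "v \<noteq> 0" "T i v = scale c v"
      using eigenvector_exists[OF less.prems(5)[OF i(1)] less.prems(1-3) less.prems(6)[OF i(1)] n] by metis
    define N' where "N' = {x \<in> N. T i x = scale c x}"
    have sub: "subspace N'"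
      unfolding N'_def using less.prems(1) linD(3,4)[OF less.prems(5)[OF i(1)]] lin_zero[OF less.prems(5)[OF i(1)]]
      by (auto simp: subspace_def scale_right_distrib mult.commute)
    have "N' \<subset> N" using n i by (auto simp: N'_def)
    then have "dim N' < dim N" using dim_psubset[OF less.prems(3,2) sub] by blast
    moreover have "N' \<subseteq> span B" using \<open>N' \<subset> N\<close> less.prems(2) by auto
    moreover have "N' \<noteq> {0}" using v by (auto simp: N'_def)
    moreover have "T j x \<in> N'" if "j \<in> I" "x \<in> N'" for j x
      using that less.prems(6) less.prems(7)[of i j x] i linD(4)[OF less.prems(5)[OF that(1)]] by (auto simp: N'_def)
    ultimately have "\<exists>v\<in>N'. v \<noteq> 0 \<and> (\<forall>i\<in>I. \<exists>c. T i v = scale c v)"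
      using \<open>N' \<subset> N\<close> by (intro less.hyps sub less.prems(3,5,7)) auto
    then show ?thesis using \<open>N' \<subset> N\<close> by blast
  qed
qed


section \<open>Functionals on a Hopf algebra\<close>

context hopf_algebra
begin

definition conv :: "('h \<Rightarrow> 'k) \<Rightarrow> ('h \<Rightarrow> 'k) \<Rightarrow> 'h \<Rightarrow> 'k"
  where "conv f g h = SW (\<lambda>x y. f x * g y) h"

text \<open>The action of the dual algebra on \<open>H\<close>. By \<open>apply_translate\<close> it
  is the transpose of right multiplication by \<open>f\<close> for the product \<open>conv\<close>
  of the dual.\<close>

definition translate :: "('h \<Rightarrow> 'k) \<Rightarrow> 'h \<Rightarrow> 'h"
  where "translate f h = SW (\<lambda>x y. scale (f y) x) h"

lemma bil_conv:
  assumes f: "lin scale (*) f" and g: "lin scale (*) g"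
  shows "bilinear_map scale scale (*) (\<lambda>x y. f x * g y)"
  by (intro bilinear_mapI) (intro lin_intros f g)+

lemma lin_conv: "lin scale (*) f \<Longrightarrow> lin scale (*) g \<Longrightarrow> lin scale (*) (\<lambda>x. conv f g x)"
  unfolding conv_def by (rule SW_lin[OF bil_conv])

lemma bil_translate:
  assumes f: "lin scale (*) f"
  shows "bilinear_map scale scale scale (\<lambda>x y. scale (f y) x)"
  by (intro bilinear_mapI) (intro lin_intros f)+

lemma lin_translate [lin_intros]:
  assumes "lin scale (*) f" "lin s scale g"
  shows "lin s scale (\<lambda>x. translate f (g x))"
  unfolding translate_def using lin_comp[OF SW_lin[OF bil_translate]] assms by blast

lemma apply_translate:
  assumes f: "lin scale (*) f"
  shows "f (translate g h) = conv f g h"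
  unfolding translate_def conv_def by (simp add: SW_comp[OF f] linD(4)[OF f] mult.commute)

text \<open>Coassociativity lets a functional applied to the last tensor leg wait until after the
  remaining comultiplication, so a translation passes to the second factor of
  \<open>\<Delta> h\<close>.\<close>

lemma SW_translate:
  assumes f: "bilinear_map scale scale sW f" and c: "lin scale (*) c"
  shows "SW f (translate c h) = SW (\<lambda>x y. f x (translate c y)) h"
proof -
  note b = bilinear_lin[OF f]
  interpret W: vector_space sW using linD(2)[OF bilinear_mapD(1)[OF f]] .
  have W: "vector_space sW" by (rule W.vector_space_axioms)
  have sW: "lin sW sW (sW k)" for k using lin_scale_fun[OF lin_ident[OF W]] .
  have "SW f (translate c h) = SW (\<lambda>x y. SW (\<lambda>u v. sW (c y) (f u v)) x) h"
    unfolding translate_def by (simp add: SW_comp[OF SW_lin[OF f]] linD(4)[OF SW_lin[OF f]] SW_comp[OF sW])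
  also have "\<dots> = SW (\<lambda>u y. SW (\<lambda>v w. sW (c w) (f u v)) y) h"
    by (rule SW_coassoc[where sW = sW]) (intro lin_intros b W c)+
  also have "\<dots> = SW (\<lambda>u y. f u (translate c y)) h"
    unfolding translate_def by (simp add: SW_comp[OF bilinear_mapD(2)[OF f]] linD(4)[OF bilinear_mapD(2)[OF f]])
  finally show ?thesis .
qed

lemma translate_translate:
  assumes f: "lin scale (*) f" and g: "lin scale (*) g"
  shows "translate f (translate g h) = translate (conv f g) h"
proof -
  have "translate f (translate g h) = SW (\<lambda>x y. scale (f (translate g y)) x) h"
    unfolding translate_def[of f] by (rule SW_translate[OF bil_translate[OF f] g])
  then show ?thesis by (simp add: translate_def[of "conv f g"] apply_translate[OF f])
qed

lemma translate_counit: "translate \<epsilon> h = h"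
  unfolding translate_def by (rule SW_counit_right) (intro lin_intros)

lemma conv_counit:
  assumes "lin scale (*) f"
  shows "conv f \<epsilon> = f" "conv \<epsilon> f = f"
  unfolding conv_def fun_eq_iff using SW_counit_right[OF assms] SW_counit_left[OF assms]
  by (simp_all add: mult.commute)

lemma conv_assoc:
  assumes f: "lin scale (*) f" and g: "lin scale (*) g" and k: "lin scale (*) k"
  shows "conv (conv f g) k = conv f (conv g k)"
proof
  fix h
  have "conv (conv f g) k h = conv f g (translate k h)"
    by (rule apply_translate[OF lin_conv[OF f g], symmetric])
  also have "\<dots> = f (translate g (translate k h))"
    by (rule apply_translate[OF f, symmetric])
  also have "\<dots> = conv f (conv g k) h"
    by (simp only: translate_translate[OF g k] apply_translate[OF f])
  finally show "conv (conv f g) k h = conv f (conv g k) h" .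
qed

lemma counit_lin [simp]: "lin scale (*) \<epsilon>" by (rule counit_linear)


section \<open>Cocommutative cosemisimple Hopf algebras\<close>

definition grouplikes :: "'h set"
  where "grouplikes = {g. g \<noteq> 0 \<and> \<Delta> g = tensor scale scale [(g, g)]}"

lemma SW_grouplike:
  assumes "g \<in> grouplikes" "bilinear_map scale scale sW f"
  shows "SW f g = f g g"
  using SW_eq[OF assms(2), of g "[(g, g)]"] assms(1) by (simp add: grouplikes_def)

lemma grouplikeI:
  assumes "g \<noteq> 0" "\<And>f. lin scale (*) f \<Longrightarrow> translate f g = scale (f g) g"
  shows "g \<in> grouplikes"
  using assms by (auto simp: grouplikes_def translate_def intro!: comult_eqI)

lemma translate_grouplike: "g \<in> grouplikes \<Longrightarrow> lin scale (*) f \<Longrightarrow> translate f g = scale (f g) g"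
  unfolding translate_def by (rule SW_grouplike[OF _ bil_translate])

lemma counit_grouplike: "g \<in> grouplikes \<Longrightarrow> \<epsilon> g = 1"
  using translate_grouplike[of g \<epsilon>] translate_counit[of g] scale_right_imp_eq[of g "\<epsilon> g" 1]
  by (auto simp: grouplikes_def)

lemma one_grouplike: "1 \<in> grouplikes"
  using comult_one by (simp add: grouplikes_def)

lemma mult_grouplike:
  assumes g: "g \<in> grouplikes" and h: "h \<in> grouplikes"
  shows "g * h \<in> grouplikes"
proof (rule grouplikeI)
  have "\<epsilon> (g * h) = 1" using g h by (simp add: counit_mult counit_grouplike)
  then show "g * h \<noteq> 0" using lin_zero[OF counit_linear] by auto
  fix f assume f: "lin scale (*) f"
  have "translate f (g * h) = SW (\<lambda>g1 g2. SW (\<lambda>h1 h2. scale (f (g2 * h2)) (g1 * h1)) h) g"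
    unfolding translate_def by (rule SW_mult[OF bil_translate[OF f]])
  also have "\<dots> = SW (\<lambda>h1 h2. scale (f (g * h2)) (g * h1)) h"
    by (rule SW_grouplike[OF g, where sW = scale]) (intro bilinear_mapI; intro lin_intros lin_comp[OF f])
  also have "\<dots> = scale (f (g * h)) (g * h)"
    by (rule SW_grouplike[OF h, where sW = scale]) (intro bilinear_mapI; intro lin_intros lin_comp[OF f])
  finally show "translate f (g * h) = scale (f (g * h)) (g * h)" .
qed

lemma grouplike_inverse:
  assumes g: "g \<in> grouplikes"
  shows "g * S g = 1" "S g * g = 1"
proof -
  have "SW (\<lambda>x y. x * S y) g = g * S g"
    by (rule SW_grouplike[OF g, where sW = scale]) (intro bilinear_mapI; intro lin_intros)
  moreover have "SW (\<lambda>x y. S x * y) g = S g * g"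
    by (rule SW_grouplike[OF g, where sW = scale]) (intro bilinear_mapI; intro lin_intros)
  ultimately show "g * S g = 1" "S g * g = 1"
    using antipode_left[of g] antipode_right[of g] counit_grouplike[OF g] by (auto simp: SW_def)
qed

text \<open>Dedekind's argument: subtracting \<open>f g0\<close> times a relation from its translate
  by \<open>f\<close> removes \<open>g0\<close>. By induction \<open>c g * (f g - f g0) = 0\<close>
  for every functional \<open>f\<close>, and functionals separate \<open>g\<close> from
  \<open>g0\<close>.\<close>

lemma independent_grouplikes: "independent grouplikes"
proof -
  have "\<forall>g\<in>F. c g = 0" if "finite F" "F \<subseteq> grouplikes" "(\<Sum>g\<in>F. scale (c g) g) = 0" for F c
    using that
  proof (induction F arbitrary: c rule: finite_induct)
    case (insert g0 F)
    have F: "c g * (f g - f g0) = 0" if g: "g \<in> F" and f: "lin scale (*) f" for g f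
    proof -
      have T: "lin scale scale (translate f)" using lin_translate[OF f lin_ident[OF vector_space_H]] .
      have "0 = translate f (\<Sum>g\<in>insert g0 F. scale (c g) g)"
        by (simp only: insert.prems(2) lin_zero[OF T])
      also have "\<dots> = (\<Sum>g\<in>insert g0 F. scale (c g * f g) g)"
        unfolding lin_sum[OF T] linD(4)[OF T] using insert.prems(1) f
        by (intro sum.cong) (auto simp: translate_grouplike)
      finally have "(\<Sum>g\<in>insert g0 F. scale (c g * f g) g) = 0" ..
      moreover have "(\<Sum>g\<in>insert g0 F. scale (f g0 * c g) g) = 0"
        using insert.prems(2) by (simp flip: scale_scale scale_sum_right)
      ultimately have "(\<Sum>g\<in>insert g0 F. scale (c g * (f g - f g0)) g) = 0"
        by (simp add: right_diff_distrib scale_left_diff_distrib sum_subtractf mult.commute)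
      then have "(\<Sum>g\<in>F. scale (c g * (f g - f g0)) g) = 0"
        using insert.hyps by simp
      then show ?thesis using insert.IH[of "\<lambda>g. c g * (f g - f g0)"] insert.prems(1) g by auto
    qed
    have cF: "c g = 0" if g: "g \<in> F" for g
    proof (rule ccontr)
      assume "c g \<noteq> 0"
      then have "g = g0" using F[OF g] by (intro functionals_separate) auto
      then show False using g insert.hyps by simp
    qed
    then have "scale (c g0) g0 = 0" using insert by simp
    then have "c g0 = 0" using insert.prems(1) by (auto simp: grouplikes_def)
    then show ?case using cF by simp
  qed simp
  then show ?thesis
    unfolding dependent_explicit by blast
qed

lemma subcoalgebra_translate:
  assumes C: "subcoalgebra scale \<Delta> C" and h: "h \<in> C" and f: "lin scale (*) f"
  shows "translate f h \<in> C"
proof -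
  obtain xs where xs: "set xs \<subseteq> C \<times> C" "\<Delta> h = tensor scale scale xs"
    using C h by (auto simp: subcoalgebra_def)
  have sub: "subspace C" using C by (simp add: subcoalgebra_def)
  have "translate f h = (\<Sum>(u, v)\<leftarrow>xs. scale (f v) u)"
    unfolding translate_def by (rule SW_eq[OF bil_translate[OF f] xs(2)])
  also have "\<dots> \<in> C"
    using xs(1) by (induction xs) (auto intro: subspace_0[OF sub] subspace_add[OF sub] subspace_scale[OF sub])
  finally show ?thesis .
qed

lemma subcoalgebra_grouplike:
  assumes g: "g \<in> grouplikes"
  shows "subcoalgebra scale \<Delta> (span {g})"
  unfolding subcoalgebra_def
proof (intro conjI ballI)
  fix h assume "h \<in> span {g}"
  then obtain c where h: "h = scale c g" by (auto simp: span_singleton)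
  have "\<Delta> h = tensor scale scale [(h, g)]"
  proof (rule comult_eqI)
    fix f assume f: "lin scale (*) f"
    have "translate f h = scale c (translate f g)"
      unfolding h by (rule linD(4)[OF lin_translate[OF f lin_ident[OF vector_space_H]]])
    then show "SW (\<lambda>x y. scale (f y) x) h = (\<Sum>(u, v)\<leftarrow>[(h, g)]. scale (f v) u)"
      using translate_grouplike[OF g f] by (simp add: translate_def h mult.commute)
  qed
  moreover have "set [(h, g)] \<subseteq> span {g} \<times> span {g}" using h by (auto intro: span_base span_scale)
  ultimately show "\<exists>xs. set xs \<subseteq> span {g} \<times> span {g} \<and> \<Delta> h = tensor scale scale xs" by blast
qed (rule subspace_span)

end

locale alg_closed_hopf = hopf_algebra scale \<Delta> \<epsilon> S
  for scale :: "'k::alg_closed_field \<Rightarrow> 'h::ring_1 \<Rightarrow> 'h"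
    and \<Delta> :: "'h \<Rightarrow> ('h \<times> 'h) list set" and \<epsilon> :: "'h \<Rightarrow> 'k" and S :: "'h \<Rightarrow> 'h" +
  assumes semisimple: "semisimple_ring (type_ring :: 'h ring)" and cosemisimple: "cosemisimple scale \<Delta>"
begin

text \<open>By cocommutativity, the operators \<open>translate f\<close> commute; a common eigenvector is a multiple of a
  grouplike element.\<close>

lemma simple_subcoalgebra_grouplike:
  assumes cocomm: "cocommutative scale \<Delta>" and C: "simple_subcoalgebra scale \<Delta> C"
  shows "C \<subseteq> span grouplikes"
proof -
  have subC: "subcoalgebra scale \<Delta> C" "subspace C" using C by (auto simp: simple_subcoalgebra_def subcoalgebra_def)
  obtain h where h: "h \<in> C" "h \<noteq> 0"
    using C subspace_0[OF subC(2)] unfolding simple_subcoalgebra_def by blast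
  have conv_commute: "conv f g = conv g f" if f: "lin scale (*) f" and g: "lin scale (*) g" for f g
  proof
    fix h
    have "conv f g h = (\<Sum>(x, y)\<leftarrow>[(h2, h1). (h1, h2) \<leftarrow> sweedler \<Delta> h]. f x * g y)"
      unfolding conv_def by (rule SW_eq[OF bil_conv[OF f g]]) (use cocomm in \<open>simp add: cocommutative_def\<close>)
    also have "\<dots> = conv g f h"
      by (simp add: conv_def SW_def case_prod_unfold o_def mult.commute)
    finally show "conv f g h = conv g f h" .
  qed
  \<comment> \<open>The translates of \<open>h\<close> lie in the span of the first components of
    \<open>\<Delta> h\<close>, which makes this space finite-dimensional; it contains
    \<open>h\<close> because \<open>\<epsilon>\<close> translates trivially.\<close>
  define N where "N = {translate f h | f. lin scale (*) f}"
  have N: "subspace N"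
  proof (rule subspaceI)
    have "translate (\<lambda>x. 0) h = 0" by (simp add: translate_def SW_zero)
    then show "0 \<in> N" unfolding N_def using lin_const_zero[OF vector_space_H vector_space_field] by (metis (mono_tags, lifting) mem_Collect_eq)
    show "x + y \<in> N" if xy: "x \<in> N" "y \<in> N" for x y
    proof -
      from xy obtain f g where fg: "lin scale (*) f" "lin scale (*) g" "x = translate f h" "y = translate g h"
        by (auto simp: N_def)
      then have "x + y = translate (\<lambda>z. f z + g z) h"
        by (simp add: translate_def scale_left_distrib SW_add)
      then show ?thesis unfolding N_def using lin_plus[OF fg(1,2)] by blast
    qed
    show "scale c x \<in> N" if x: "x \<in> N" for c x
    proof -
      from x obtain f where f: "lin scale (*) f" "x = translate f h" by (auto simp: N_def)
      have "scale c x = translate (\<lambda>z. c * f z) h"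
        unfolding f(2) translate_def by (simp add: SW_comp[OF lin_scale_fun[OF lin_ident[OF vector_space_H]]])
      then show ?thesis unfolding N_def using lin_scale_fun[OF f(1), of c] by blast
    qed
  qed
  have "N \<subseteq> span (fst ` set (sweedler \<Delta> h))"
  proof
    fix x assume "x \<in> N"
    then obtain f where x: "x = translate f h" by (auto simp: N_def)
    have "(\<Sum>(u, v)\<leftarrow>xs. scale (f v) u) \<in> span (fst ` set xs)" for xs
    proof (induction xs)
      case (Cons p xs)
      have "(\<Sum>(u, v)\<leftarrow>xs. scale (f v) u) \<in> span (fst ` set (p # xs))"
        using Cons span_mono[of "fst ` set xs" "fst ` set (p # xs)"] by auto
      moreover have "scale (f (snd p)) (fst p) \<in> span (fst ` set (p # xs))"
        by (intro span_scale span_base) simp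
      ultimately have "scale (f (snd p)) (fst p) + (\<Sum>(u, v)\<leftarrow>xs. scale (f v) u) \<in> span (fst ` set (p # xs))"
        by (rule span_add[rotated])
      then show ?case by (simp only: list.map sum_list.Cons case_prod_unfold)
    qed (simp add: span_zero)
    then show "x \<in> span (fst ` set (sweedler \<Delta> h))" by (simp add: x translate_def SW_def)
  qed
  moreover have "h \<in> N" unfolding N_def using translate_counit[of h] counit_linear by (intro CollectI exI[of _ \<epsilon>]) simp
  then have "N \<noteq> {0}" using h by auto
  moreover have "translate f x \<in> N" if "lin scale (*) f" "x \<in> N" for f x
    using that lin_conv[of f] unfolding N_def by (auto simp: translate_translate)
  moreover have "translate f (translate g x) = translate g (translate f x)" if "lin scale (*) f" "lin scale (*) g" for f g x
    using that by (simp add: translate_translate conv_commute[of f g])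
  ultimately have "\<exists>v\<in>N. v \<noteq> 0 \<and> (\<forall>f\<in>Collect (lin scale (*)). \<exists>c. translate f v = scale c v)"
    using N lin_translate[OF _ lin_ident[OF vector_space_H]]
    by (intro common_eigenvector[OF vector_space_H, of N "fst ` set (sweedler \<Delta> h)"]) auto
  then obtain c where c: "c \<in> N" "c \<noteq> 0" "\<And>f. lin scale (*) f \<Longrightarrow> \<exists>a. translate f c = scale a c" by blast
  have cC: "c \<in> C" using c(1) subcoalgebra_translate[OF subC(1) h(1)] by (auto simp: N_def)
  obtain \<phi> where \<phi>: "lin scale (*) \<phi>" "\<phi> c = 1" using functional_exists[OF c(2)] by blast
  \<comment> \<open>For a common eigenvector, \<open>\<Delta> c = c \<otimes> d\<close>, where
    \<open>d\<close> is found by pairing the first factor with a functional equal to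
    \<open>1\<close> at \<open>c\<close>. The counit then shows that \<open>c\<close> is a multiple
    of \<open>d\<close>, and this rescaling is what makes \<open>d\<close> grouplike.\<close>
  define d where "d = SW (\<lambda>x y. scale (\<phi> x) y) c"
  have d: "translate f c = scale (f d) c" if f: "lin scale (*) f" for f
  proof -
    obtain a where a: "translate f c = scale a c" using c(3)[OF f] by blast
    have "f d = conv \<phi> f c" unfolding d_def conv_def by (simp add: SW_comp[OF f] linD(4)[OF f])
    also have "\<dots> = a" using \<phi> by (simp add: a linD(4)[OF \<phi>(1)] flip: apply_translate[OF \<phi>(1)])
    finally show ?thesis using a by simp
  qed
  have "\<Delta> c = tensor scale scale [(c, d)]"
    using d by (intro comult_eqI) (simp add: translate_def)
  moreover have "bilinear_map scale scale scale (\<lambda>x y. scale (\<epsilon> x) y)"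
    by (intro bilinear_mapI; intro lin_intros)
  ultimately have "SW (\<lambda>x y. scale (\<epsilon> x) y) c = scale (\<epsilon> c) d"
    using SW_eq[of scale "\<lambda>x y. scale (\<epsilon> x) y" c "[(c, d)]"] by simp
  then have cd: "c = scale (\<epsilon> c) d" by (simp add: SW_def counit_left)
  then have ne: "\<epsilon> c \<noteq> 0" "d \<noteq> 0" using c(2) by auto
  have dc: "d = scale (inverse (\<epsilon> c)) c" using cd ne(1) by (metis left_inverse scale_one scale_scale)
  have "translate f d = scale (f d) d" if f: "lin scale (*) f" for f
  proof -
    have "translate f d = translate f (scale (inverse (\<epsilon> c)) c)" using dc by simp
    also have "\<dots> = scale (f d) (scale (inverse (\<epsilon> c)) c)"
      by (simp add: linD(4)[OF lin_translate[OF f lin_ident[OF vector_space_H]]] d[OF f] mult.commute)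
    also have "\<dots> = scale (f d) d" using dc by simp
    finally show ?thesis .
  qed
  then have g: "d \<in> grouplikes" using ne(2) by (rule_tac grouplikeI) auto
  have "span {d} \<subseteq> C" using cC subC(2) dc by (intro span_minimal) (auto intro: subspace_scale)
  moreover have "span {d} \<noteq> {0}" using ne(2) span_base[of d "{d}"] by auto
  ultimately have "C = span {d}"
    using C subcoalgebra_grouplike[OF g] unfolding simple_subcoalgebra_def by blast
  then show ?thesis using g span_mono[of "{d}" grouplikes] by auto
qed

lemma span_grouplikes:
  assumes "cocommutative scale \<Delta>"
  shows "span grouplikes = UNIV"
proof -
  have "\<Union>{C. simple_subcoalgebra scale \<Delta> C} \<subseteq> span grouplikes"
    using simple_subcoalgebra_grouplike[OF assms] by blast
  then have "span (\<Union>{C. simple_subcoalgebra scale \<Delta> C}) \<subseteq> span grouplikes"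
    by (intro span_minimal subspace_span)
  then show ?thesis using cosemisimple by (simp add: cosemisimple_def top.extremum_unique)
qed

text \<open>The coefficients of an integral \<open>t\<close> in the basis of grouplike elements are
  invariant under left multiplication. Right multiplication by a point of the finite support
  therefore embeds all grouplike elements into it, and the coefficients are constant;
  \<open>\<epsilon> t = 1\<close> says that the cardinality times this constant is
  \<open>1\<close>.\<close>

lemma grouplikes_finite:
  assumes "cocommutative scale \<Delta>"
  shows "finite grouplikes" "of_nat (card grouplikes) \<noteq> (0 :: 'k)"
proof -
  let ?G = grouplikes
  obtain t where t: "\<And>h. h * t = scale (\<epsilon> h) t" "\<epsilon> t = 1"
    using integral_exists[OF semisimple] by blast
  note G = independent_grouplikes
  have span_G [simp]: "x \<in> span ?G" for x using span_grouplikes[OF assms] by simp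
  let ?r = "representation ?G"
  have lin_r: "lin scale (*) (\<lambda>v. ?r v y)" for y
    by (rule linear_representation[OF G span_grouplikes[OF assms]])
  have cancel: "g * x = g * y \<longleftrightarrow> x = y" "x * g = y * g \<longleftrightarrow> x = y" if "g \<in> ?G" for g x y
    using grouplike_inverse[OF that] by (metis mult.assoc mult_1 mult_1_right)+
  let ?S = "{g. ?r t g \<noteq> 0}"
  have fin: "finite ?S" by (rule finite_representation)
  have S_G: "?S \<subseteq> ?G" using representation_ne_zero by blast
  have sum_t: "(\<Sum>x\<in>?S. scale (?r t x) x) = t"
    by (rule sum_nonzero_representation_eq[OF G]) simp
  have inv: "?r t (g * x0) = ?r t x0" if g: "g \<in> ?G" and x0: "x0 \<in> ?G" for g x0
  proof -
    have "g * t = t" using t(1)[of g] counit_grouplike[OF g] by simp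
    then have "?r t (g * x0) = ?r (g * t) (g * x0)" by simp
    also have "g * t = (\<Sum>x\<in>?S. scale (?r t x) (g * x))"
      by (subst sum_t[symmetric]) (simp add: sum_distrib_left scale_mult_right)
    also have "?r \<dots> (g * x0) = (\<Sum>x\<in>?S. ?r t x * ?r (g * x) (g * x0))"
      by (simp only: lin_sum[OF lin_r] linD(4)[OF lin_r])
    also have "\<dots> = (\<Sum>x\<in>?S. if x = x0 then ?r t x else 0)"
      using S_G g by (intro sum.cong) (auto simp: representation_basis[OF G mult_grouplike] cancel subset_iff)
    also have "\<dots> = ?r t x0" using fin by simp
    finally show ?thesis .
  qed
  have "?S \<noteq> {}"
  proof
    assume "?S = {}"
    then have "t = 0" using sum_t by simp
    then show False using t(2) lin_zero[OF counit_linear] by simp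
  qed
  then obtain x0 where x0: "x0 \<in> ?S" by blast
  then have x0G: "x0 \<in> ?G" using S_G by blast
  have inj: "inj_on (\<lambda>g. g * x0) ?G" using cancel(2)[OF x0G] by (auto intro: inj_onI)
  have "(\<lambda>g. g * x0) ` ?G \<subseteq> ?S" using inv x0G x0 by auto
  then show fin_G: "finite ?G" using inj fin by (metis finite_imageD finite_subset)
  have surj: "(\<lambda>g. g * x0) ` ?G = ?G"
    by (rule endo_inj_surj[OF fin_G _ inj]) (use mult_grouplike x0G in blast)
  have const: "?r t y = ?r t x0" if y: "y \<in> ?G" for y
  proof -
    obtain g where "g \<in> ?G" "y = g * x0" using surj y by (metis imageE)
    then show ?thesis using inv x0G by simp
  qed
  have "1 = \<epsilon> (\<Sum>x\<in>?S. scale (?r t x) x)" by (simp add: sum_t t(2))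
  also have "\<dots> = (\<Sum>x\<in>?S. ?r t x)"
    using S_G by (auto simp: lin_sum[OF counit_linear] linD(4)[OF counit_linear] counit_grouplike intro!: sum.cong)
  also have "\<dots> = (\<Sum>x\<in>?G. ?r t x0)"
    using S_G fin_G const by (intro sum.mono_neutral_cong_left) auto
  finally show "of_nat (card ?G) \<noteq> (0 :: 'k)" by auto
qed

lemma bij_mult_grouplike:
  assumes "cocommutative scale \<Delta>" "g \<in> grouplikes"
  shows "bij_betw (\<lambda>h. g * h) grouplikes grouplikes"
proof -
  have "inj_on (\<lambda>h. g * h) grouplikes"
    using grouplike_inverse(2)[OF assms(2)] by (metis inj_onI mult.assoc mult_1)
  moreover have "(\<lambda>h. g * h) ` grouplikes \<subseteq> grouplikes" using mult_grouplike[OF assms(2)] by blast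
  ultimately show ?thesis
    using endo_inj_surj[OF grouplikes_finite(1)[OF assms(1)]] by (simp add: bij_betw_def)
qed


section \<open>Commutative semisimple Hopf algebras\<close>

text \<open>Write \<open>S h\<close> as \<open>\<Sum> \<epsilon>(h2) S(h1)\<close> and replace
  \<open>\<epsilon>(h2) t\<close> by \<open>h2 t\<close>. Comultiplying \<open>h2 t\<close> puts
  \<open>S(h1) h2\<close> in front of \<open>t1\<close>, where it cancels, and leaves the last leg
  of \<open>h\<close> in front of \<open>t2\<close>.\<close>

lemma integral_antipode:
  assumes t: "\<And>h. h * t = scale (\<epsilon> h) t" and F: "bilinear_map scale scale sW F"
  shows "SW (\<lambda>u v. F (S h * u) v) t = SW (\<lambda>u v. F u (h * v)) t"
proof -
  have W: "vector_space sW" using linD(2)[OF bilinear_mapD(1)[OF F]] .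
  note b = bilinear_lin[OF F]
  define K where "K x y1 y2 = SW (\<lambda>u v. F (S x * (y1 * u)) (y2 * v)) t" for x y1 y2
  have bil: "bilinear_map scale scale sW (\<lambda>u v. F (S x * u) v)" for x
    by (intro bilinear_mapI; intro lin_intros b)
  have "SW (\<lambda>u v. F (S h * u) v) t = SW (\<lambda>x y. sW (\<epsilon> y) (SW (\<lambda>u v. F (S x * u) v) t)) h"
    by (rule SW_counit_right[symmetric]) (intro lin_intros b)
  also have "\<dots> = SW (\<lambda>x y. SW (\<lambda>u v. F (S x * u) v) (y * t)) h"
    by (simp add: t linD(4)[OF SW_lin[OF bil]])
  also have "\<dots> = SW (\<lambda>x y. SW (\<lambda>y1 y2. K x y1 y2) y) h"
    unfolding K_def by (simp add: SW_mult[OF bil])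
  also have "\<dots> = SW (\<lambda>x' y2. SW (\<lambda>x y1. K x y1 y2) x') h"
    unfolding K_def by (rule SW_coassoc[where sW = sW, symmetric]; intro lin_intros b)
  also have "\<dots> = SW (\<lambda>x' y2. sW (\<epsilon> x') (SW (\<lambda>u v. F u (y2 * v)) t)) h"
  proof (rule SW_cong)
    fix x' y2
    have "SW (\<lambda>x y1. SW (\<lambda>u v. F (S x * y1 * u) (y2 * v)) t) x' = sW (\<epsilon> x') (SW (\<lambda>u v. F (1 * u) (y2 * v)) t)"
      by (rule SW_antipode_left) (intro lin_intros b)
    then show "SW (\<lambda>x y1. K x y1 y2) x' = sW (\<epsilon> x') (SW (\<lambda>u v. F u (y2 * v)) t)"
      by (simp add: K_def mult.assoc)
  qed
  also have "\<dots> = SW (\<lambda>u v. F u (h * v)) t"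
    by (rule SW_counit_left) (intro lin_intros b)
  finally show ?thesis .
qed

text \<open>
  The second tensor factors of \<open>\<Delta> t\<close> for an integral \<open>t\<close> span the algebra, because
  \<open>h = \<Sum> h S(t\<^sub>1) t\<^sub>2\<close> and \<open>t\<^sub>1 \<otimes> h t\<^sub>2 = S(h) t\<^sub>1 \<otimes> t\<^sub>2\<close>.
\<close>

lemma finite_dimensional: "\<exists>B. finite B \<and> span B = UNIV"
proof -
  obtain t where t: "\<And>h. h * t = scale (\<epsilon> h) t" "\<epsilon> t = 1"
    using integral_exists[OF semisimple] by blast
  let ?Y = "span (snd ` set (sweedler \<Delta> t))"
  obtain B f where "finite B" and B: "\<And>b. lin scale (*) (f b)"
    "\<And>u. u \<in> fst ` set (sweedler \<Delta> t) \<Longrightarrow> u = (\<Sum>b\<in>B. scale (f b u) b)"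
    by (rule coordinates_exist[of "fst ` set (sweedler \<Delta> t)"]) (simp, rule that)
  define y where "y b = SW (\<lambda>u v. scale (f b u) v) t" for b
  have SW_Y: "SW (\<lambda>u v. scale (c u) v) t \<in> ?Y" for c
  proof -
    have "(\<Sum>(u, v)\<leftarrow>xs. scale (c u) v) \<in> span (snd ` set xs)" for xs
    proof (induction xs)
      case (Cons p xs)
      have "(\<Sum>(u, v)\<leftarrow>xs. scale (c u) v) \<in> span (snd ` set (p # xs))"
        using Cons span_mono[of "snd ` set xs" "snd ` set (p # xs)"] by auto
      moreover have "scale (c (fst p)) (snd p) \<in> span (snd ` set (p # xs))"
        by (intro span_scale span_base) simp
      ultimately have "scale (c (fst p)) (snd p) + (\<Sum>(u, v)\<leftarrow>xs. scale (c u) v) \<in> span (snd ` set (p # xs))"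
        by (rule span_add[rotated])
      then show ?case by (simp only: list.map sum_list.Cons case_prod_unfold)
    qed (simp add: span_zero)
    then show ?thesis by (simp add: SW_def)
  qed
  have xy: "x * y b \<in> ?Y" for x b
  proof -
    have bil: "bilinear_map scale scale scale (\<lambda>u v. scale (f b u) v)"
      by (intro bilinear_mapI; intro lin_intros B)
    have "x * y b = SW (\<lambda>u v. scale (f b u) (x * v)) t"
      unfolding y_def by (simp add: SW_comp[OF lin_mult(2)[OF lin_ident[OF vector_space_H]]] scale_mult_right)
    also have "\<dots> = SW (\<lambda>u v. scale (f b (S x * u)) v) t"
      by (rule integral_antipode[OF t(1) bil, symmetric])
    also have "\<dots> \<in> ?Y" by (rule SW_Y)
    finally show ?thesis .
  qed
  \<comment> \<open>The antipode axiom at \<open>t\<close> writes \<open>1\<close> in terms of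
    \<open>t1\<close> and \<open>t2\<close>. Sorting by the coordinates of \<open>t1\<close> gathers
    the second factors into the \<open>y b\<close>, all of whose left multiples stay in
    \<open>?Y\<close>.\<close>
  have "1 = SW (\<lambda>u v. S u * v) t" using antipode_left[of t] t(2) by (simp add: SW_def)
  also have "\<dots> = SW (\<lambda>u v. \<Sum>b\<in>B. S b * scale (f b u) v) t"
  proof -
    have "S u * v = (\<Sum>b\<in>B. S b * scale (f b u) v)" if "(u, v) \<in> set (sweedler \<Delta> t)" for u v
    proof -
      have "S u = S (\<Sum>b\<in>B. scale (f b u) b)" using B(2)[of u] that by force
      then show ?thesis
        by (simp add: lin_sum[OF antipode_linear] linD(4)[OF antipode_linear] sum_distrib_right
            scale_mult_left scale_mult_right)
    qed
    then show ?thesis unfolding SW_def by (intro arg_cong[of _ _ sum_list] map_cong) auto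
  qed
  also have "\<dots> = (\<Sum>b\<in>B. S b * y b)"
    by (simp add: SW_sum y_def SW_comp[OF lin_mult(2)[OF lin_ident[OF vector_space_H]]])
  finally have one: "1 = (\<Sum>b\<in>B. S b * y b)" .
  have "h \<in> ?Y" for h
  proof -
    have "h = h * (\<Sum>b\<in>B. S b * y b)" by (simp flip: one)
    also have "\<dots> = (\<Sum>b\<in>B. (h * S b) * y b)" by (simp add: sum_distrib_left mult.assoc)
    also have "\<dots> \<in> ?Y" using xy by (intro span_sum) auto
    finally show ?thesis .
  qed
  then show ?thesis by (intro exI[of _ "snd ` set (sweedler \<Delta> t)"]) auto
qed

definition characters :: "('h \<Rightarrow> 'k) set"
  where "characters = {\<chi>. lin scale (*) \<chi> \<and> (\<forall>x y. \<chi> (x * y) = \<chi> x * \<chi> y) \<and> \<chi> 1 = 1}"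

lemma characterD:
  assumes "\<chi> \<in> characters"
  shows "lin scale (*) \<chi>" "\<chi> (x * y) = \<chi> x * \<chi> y" "\<chi> 1 = 1"
  using assms by (auto simp: characters_def)

lemma counit_character: "\<epsilon> \<in> characters"
  by (simp add: characters_def counit_mult counit_one)

lemma conv_character:
  assumes \<chi>: "\<chi> \<in> characters" and \<psi>: "\<psi> \<in> characters"
  shows "conv \<chi> \<psi> \<in> characters"
proof -
  note lin = characterD(1)[OF \<chi>] characterD(1)[OF \<psi>]
  have "conv \<chi> \<psi> (x * y) = SW (\<lambda>x1 x2. SW (\<lambda>y1 y2. (\<chi> x1 * \<psi> x2) * (\<chi> y1 * \<psi> y2)) y) x" for x y
    unfolding conv_def SW_mult[OF bil_conv[OF lin]]
    by (simp add: characterD(2)[OF \<chi>] characterD(2)[OF \<psi>] mult_ac)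
  also have "\<dots> x y = conv \<chi> \<psi> x * conv \<chi> \<psi> y" for x y
    unfolding conv_def
    by (simp add: SW_comp[OF lin_scale_fun[OF lin_ident[OF vector_space_field]]]
      SW_comp[OF lin_mult_field[OF lin_ident[OF vector_space_field]]], rule SW_swap)
  finally have "conv \<chi> \<psi> (x * y) = conv \<chi> \<psi> x * conv \<chi> \<psi> y" for x y .
  moreover have "conv \<chi> \<psi> 1 = 1"
    unfolding conv_def SW_one[OF bil_conv[OF lin]] by (simp add: characterD(3) \<chi> \<psi>)
  ultimately show ?thesis using lin_conv[OF lin] by (simp add: characters_def)
qed

text \<open>Distinct characters admit interpolating elements: for a finite set of them there are
  vectors on which they take the values of an identity matrix. Such vectors are independent, so
  their number is bounded by a finite spanning set.\<close>

lemma characters_finite: "finite characters"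
proof (rule ccontr)
  assume inf: "infinite characters"
  obtain B where B: "finite B" "span B = UNIV" using finite_dimensional by blast
  obtain F where F: "finite F" "card F = Suc (card B)" "F \<subseteq> characters"
    using infinite_arbitrarily_large[OF inf] by metis
  have sep: "\<exists>x. \<chi> x = 1 \<and> (\<forall>\<psi>\<in>E. \<psi> x = 0)"
    if "finite E" "E \<subseteq> characters" "\<chi> \<in> characters" "\<chi> \<notin> E" for E \<chi>
    using that
  proof (induction E rule: finite_induct)
    case empty
    then show ?case using characterD(3) by blast
  next
    case (insert \<psi> E)
    then obtain x where x: "\<chi> x = 1" "\<forall>\<psi>\<in>E. \<psi> x = 0" by auto
    have \<psi>: "\<psi> \<in> characters" and \<chi>: "\<chi> \<in> characters" using insert by auto
    obtain h where h: "\<chi> h \<noteq> \<psi> h" using insert.prems(3) by auto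
    \<comment> \<open>The factor killed by \<open>\<psi>\<close> but not by \<open>\<chi>\<close>,
      as in Lagrange interpolation; multiplying by it keeps the zeros already obtained for
      \<open>E\<close>.\<close>
    define y where "y = h - scale (\<psi> h) 1"
    have y: "\<theta> y = \<theta> h - \<psi> h" if "\<theta> \<in> characters" for \<theta>
      unfolding y_def using characterD[OF that] by (simp add: lin_diff linD(4)[OF characterD(1)[OF that]])
    define z where "z = scale (inverse (\<chi> y)) (y * x)"
    have z: "\<theta> z = inverse (\<chi> y) * (\<theta> y * \<theta> x)" if "\<theta> \<in> characters" for \<theta>
      unfolding z_def using characterD[OF that] by (simp add: linD(4)[OF characterD(1)[OF that]])
    have "\<chi> z = 1" using z[OF \<chi>] y[OF \<chi>] h x by simp
    moreover have "\<theta> z = 0" if "\<theta> \<in> insert \<psi> E" for \<theta>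
      using that z[of \<theta>] y[OF \<psi>] x insert.prems by auto
    ultimately show ?case by blast
  qed
  have "\<forall>\<chi>\<in>F. \<exists>x. \<chi> x = 1 \<and> (\<forall>\<psi>\<in>F - {\<chi>}. \<psi> x = 0)" using F by (intro ballI sep) auto
  then obtain x where x: "\<And>\<chi>. \<chi> \<in> F \<Longrightarrow> \<chi> (x \<chi>) = 1" "\<And>\<chi> \<psi>. \<chi> \<in> F \<Longrightarrow> \<psi> \<in> F \<Longrightarrow> \<psi> \<noteq> \<chi> \<Longrightarrow> \<psi> (x \<chi>) = 0"
    by (metis Diff_iff empty_iff insert_iff)
  have inj: "inj_on x F"
    using x by (metis inj_onI zero_neq_one)
  have "independent (x ` F)"
  proof (rule independent_if_scalars_zero)
    fix f y assume sum: "(\<Sum>v\<in>x ` F. scale (f v) v) = 0" and "y \<in> x ` F"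
    then obtain \<psi> where \<psi>: "\<psi> \<in> F" "y = x \<psi>" by blast
    have lin: "lin scale (*) \<psi>" using \<psi> F(3) characterD(1) by blast
    have "0 = \<psi> (\<Sum>\<chi>\<in>F. scale (f (x \<chi>)) (x \<chi>))"
      using sum by (simp add: sum.reindex[OF inj] lin_zero[OF lin])
    also have "\<dots> = (\<Sum>\<chi>\<in>F. if \<chi> = \<psi> then f (x \<psi>) else 0)"
      unfolding lin_sum[OF lin] linD(4)[OF lin] using x \<psi>(1) by (intro sum.cong) auto
    also have "\<dots> = f y" using F(1) \<psi> by simp
    finally show "f y = 0" ..
  qed (use F in simp)
  then have "card (x ` F) \<le> card B" using independent_span_bound[OF B(1)] B(2) by blast
  then show False using F(2) card_image[OF inj] by simp
qed

lemma antipode_conv: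
  assumes "\<chi> \<in> characters"
  shows "conv (\<lambda>x. \<chi> (S x)) \<chi> = \<epsilon>"
proof
  fix h
  note \<chi> = characterD[OF assms]
  have "conv (\<lambda>x. \<chi> (S x)) \<chi> h = SW (\<lambda>x y. \<chi> (S x * y)) h" by (simp add: conv_def \<chi>(2))
  then show "conv (\<lambda>x. \<chi> (S x)) \<chi> h = \<epsilon> h" using SW_antipode_left[OF \<chi>(1)] \<chi>(3) by simp
qed

text \<open>Convolution with \<open>\<chi> \<circ> S\<close> gives injectivity, and finiteness gives
  surjectivity. In this way multiplicativity of \<open>\<chi> \<circ> S\<close> does not have to be
  established.\<close>

lemma bij_conv_character:
  assumes "\<chi> \<in> characters"
  shows "bij_betw (conv \<chi>) characters characters"
proof -
  have lin: "lin scale (*) (\<lambda>x. \<chi> (S x))"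
    by (intro lin_comp[OF characterD(1)[OF assms]] antipode_linear)
  have "conv (\<lambda>x. \<chi> (S x)) (conv \<chi> \<psi>) = \<psi>" if "\<psi> \<in> characters" for \<psi>
    using conv_assoc[OF lin characterD(1)[OF assms] characterD(1)[OF that]] antipode_conv[OF assms]
      conv_counit(2)[OF characterD(1)[OF that]] by simp
  then have "inj_on (conv \<chi>) characters" by (intro inj_on_inverseI[of _ "conv (\<lambda>x. \<chi> (S x))"])
  moreover have "conv \<chi> ` characters \<subseteq> characters" using conv_character[OF assms] by blast
  ultimately show ?thesis using endo_inj_surj[OF characters_finite] by (simp add: bij_betw_def)
qed

lemma character_inverse:
  assumes "\<chi> \<in> characters"
  obtains \<chi>' where "\<chi>' \<in> characters" "conv \<chi> \<chi>' = \<epsilon>"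
proof -
  have "\<epsilon> \<in> conv \<chi> ` characters"
    using bij_conv_character[OF assms] counit_character by (simp add: bij_betw_def)
  then show thesis using that by auto
qed

lemma character_integral:
  assumes "\<And>h. h * t = scale (\<epsilon> h) t" "\<epsilon> t = 1" "\<chi> \<in> characters"
  shows "\<chi> t = (if \<chi> = \<epsilon> then 1 else 0)"
proof -
  note \<chi> = characterD[OF assms(3)]
  have "\<chi> h * \<chi> t = \<epsilon> h * \<chi> t" for h
  proof -
    have "\<chi> h * \<chi> t = \<chi> (scale (\<epsilon> h) t)" by (simp only: \<chi>(2)[symmetric] assms(1))
    then show ?thesis by (simp only: linD(4)[OF \<chi>(1)])
  qed
  then have "\<chi> = \<epsilon>" if "\<chi> t \<noteq> 0" using that by (intro ext) simp
  then show ?thesis using assms(2) by (cases "\<chi> = \<epsilon>") auto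
qed

context
  assumes commutative: "\<And>g h :: 'h. g * h = h * g"
begin

text \<open>The common kernel \<open>N\<close> of the characters has a complementary ideal by
  semisimplicity, so some \<open>n\<close> in \<open>N\<close> acts on \<open>N\<close> as the
  identity. If \<open>N\<close> were nonzero, a common eigenvector \<open>v\<close> in
  \<open>N\<close> of all multiplications would define a character with value \<open>1\<close> at
  \<open>n\<close>.\<close>

lemma characters_separate:
  assumes "\<And>\<chi>. \<chi> \<in> characters \<Longrightarrow> \<chi> h = \<chi> g"
  shows "h = g"
proof -
  define N where "N = {h. \<forall>\<chi>\<in>characters. \<chi> h = 0}"
  have "N = {0}"
  proof (rule ccontr)
    assume ne: "N \<noteq> {0}"
    have "left_ideal type_ring N"
      unfolding left_ideal_type_ring regular.lideal_def N_def
      by (auto simp: characterD(2) linD(3)[OF characterD(1)] lin_zero[OF characterD(1)])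
    then have "\<exists>J. left_ideal type_ring J \<and> N \<inter> J = {\<zero>\<^bsub>type_ring\<^esub>} \<and> N <+>\<^bsub>type_ring\<^esub> J = carrier type_ring"
      using semisimple unfolding semisimple_ring_def by blast
    then obtain J where "left_ideal type_ring J" "N \<inter> J = {\<zero>\<^bsub>type_ring\<^esub>}" "N <+>\<^bsub>type_ring\<^esub> J = carrier type_ring"
      by blast
    then have J: "regular.lideal J" "N \<inter> J = {0}" "N <+>\<^bsub>type_ring\<^esub> J = UNIV"
      by (simp_all add: left_ideal_type_ring[symmetric]) (simp_all add: type_ring_def)
    have "1 \<in> N <+>\<^bsub>type_ring\<^esub> J" using J(3) by simp
    then obtain n j where nj: "n \<in> N" "j \<in> J" "1 = n + j"
      by (auto simp: type_ring_def set_add_def set_mult_def)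
    have N: "n * x = x" if x: "x \<in> N" for x
    proof -
      have "x * j \<in> J" using regular.lidealD(4)[OF J(1) nj(2)] .
      moreover have "x * j \<in> N" using x by (auto simp: N_def characterD(2))
      ultimately have "x * j = 0" using J(2) by blast
      moreover have "x = x * (n + j)" using nj(3) by simp
      ultimately show ?thesis by (simp add: distrib_left commutative)
    qed
    have sub: "subspace N"
      unfolding N_def subspace_def using linD(3,4) lin_zero characterD(1) by fastforce
    obtain B where B: "finite B" "span B = UNIV" using finite_dimensional by blast
    have "\<exists>v\<in>N. v \<noteq> 0 \<and> (\<forall>h\<in>UNIV. \<exists>c. h * v = scale c v)"
    proof (rule common_eigenvector[OF vector_space_H sub _ B(1) ne])
      show "N \<subseteq> span B" using B by simp
      show "lin scale scale (\<lambda>v. h * v)" for h by (intro lin_intros)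
      show "h * x \<in> N" if "x \<in> N" for h x using that by (auto simp: N_def characterD(2))
      show "h * (g * x) = g * (h * x)" for g h x :: 'h by (simp add: commutative[of h g] flip: mult.assoc)
    qed
    then obtain v where v: "v \<in> N" "v \<noteq> 0" "\<And>h. \<exists>c. h * v = scale c v" by blast
    have "\<exists>\<chi>. \<forall>h. h * v = scale (\<chi> h) v" using v(3) by (intro choice allI)
    then obtain \<chi> where \<chi>: "\<And>h. h * v = scale (\<chi> h) v" by blast
    have eq: "a = b" if "scale a v = scale b v" for a b using scale_right_imp_eq[OF v(2) that] .
    have "\<chi> \<in> characters"
      unfolding characters_def
    proof (intro CollectI conjI allI linI vector_space_H vector_space_field)
      show "\<chi> (x + y) = \<chi> x + \<chi> y" for x y by (rule eq) (simp add: distrib_right scale_left_distrib flip: \<chi>)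
      show "\<chi> (scale c x) = c * \<chi> x" for c x
        by (rule eq) (simp add: scale_mult_left flip: \<chi> scale_scale)
      show "\<chi> (x * y) = \<chi> x * \<chi> y" for x y
      proof (rule eq)
        have "scale (\<chi> (x * y)) v = x * (y * v)" by (simp add: mult.assoc flip: \<chi>)
        also have "\<dots> = scale (\<chi> x * \<chi> y) v" by (simp add: \<chi> scale_mult_right mult.commute)
        finally show "scale (\<chi> (x * y)) v = scale (\<chi> x * \<chi> y) v" .
      qed
      show "\<chi> 1 = 1" by (rule eq) (simp flip: \<chi>)
    qed
    then have "\<chi> n = 0" using nj(1) by (auto simp: N_def)
    then show False using N[OF v(1)] \<chi>[of n] v(2) by simp
  qed
  moreover have "h - g \<in> N"
    unfolding N_def using assms lin_diff characterD(1) by fastforce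
  ultimately show ?thesis by simp
qed

text \<open>Characters separate points, and applying a character \<open>\<psi>\<close> to the left
  side only permutes the summands, because \<open>conv \<psi>\<close> is a bijection of the
  characters.\<close>

lemma sum_translate_characters:
  "(\<Sum>\<chi>\<in>characters. translate \<chi> h) = scale (\<Sum>\<chi>\<in>characters. \<chi> h) 1"
proof (rule characters_separate)
  fix \<psi> assume \<psi>: "\<psi> \<in> characters"
  note lin = characterD(1)[OF \<psi>]
  have "\<psi> (\<Sum>\<chi>\<in>characters. translate \<chi> h) = (\<Sum>\<chi>\<in>characters. conv \<psi> \<chi> h)"
    by (simp add: lin_sum[OF lin] apply_translate[OF lin])
  also have "\<dots> = (\<Sum>\<chi>\<in>characters. \<chi> h)"
    using sum.reindex_bij_betw[OF bij_conv_character[OF \<psi>], of "\<lambda>\<chi>. \<chi> h"] .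
  finally show "\<psi> (\<Sum>\<chi>\<in>characters. translate \<chi> h) = \<psi> (scale (\<Sum>\<chi>\<in>characters. \<chi> h) 1)"
    by (simp add: linD(4)[OF lin] characterD(3)[OF \<psi>])
qed

text \<open>
  The sum of all characters is an integral of the dual. If it vanished at \<open>1\<close>, a simple
  subcoalgebra on which it does not vanish would contain \<open>1\<close>, and hence be spanned by \<open>1\<close>.
\<close>

lemma card_characters_nonzero: "of_nat (card characters) \<noteq> (0 :: 'k)"
proof
  assume zero: "of_nat (card characters) = (0 :: 'k)"
  define \<Lambda> where "\<Lambda> h = (\<Sum>\<chi>\<in>characters. \<chi> h)" for h
  have lin: "lin scale (*) \<Lambda>"
    unfolding \<Lambda>_def using characterD(1) by (intro lin_sum_fun vector_space_H vector_space_field) auto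
  have "\<Lambda> 1 = (\<Sum>\<chi>\<in>characters. 1)"
    unfolding \<Lambda>_def using characterD(3) by (intro sum.cong) auto
  then have \<Lambda>_1: "\<Lambda> 1 = 0" using zero by simp
  have translate_\<Lambda>: "translate \<Lambda> h = scale (\<Lambda> h) 1" for h
    using sum_translate_characters[of h] unfolding translate_def \<Lambda>_def
    by (simp add: scale_sum_left SW_sum)
  obtain t where t: "\<And>h. h * t = scale (\<epsilon> h) t" "\<epsilon> t = 1"
    using integral_exists[OF semisimple] by blast
  \<comment> \<open>Only the counit survives at the integral, so \<open>\<Lambda>\<close> is not the
    zero functional and cosemisimplicity provides a simple subcoalgebra on which it does not
    vanish.\<close>
  have "\<Lambda> t = (\<Sum>\<chi>\<in>characters. if \<chi> = \<epsilon> then 1 else 0)"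
    unfolding \<Lambda>_def using character_integral[OF t] by (intro sum.cong) auto
  then have "\<Lambda> t = 1" using characters_finite counit_character by simp
  have "\<exists>C h. simple_subcoalgebra scale \<Delta> C \<and> h \<in> C \<and> \<Lambda> h \<noteq> 0"
  proof (rule ccontr)
    assume no: "\<nexists>C h. simple_subcoalgebra scale \<Delta> C \<and> h \<in> C \<and> \<Lambda> h \<noteq> 0"
    have "span (\<Union>{C. simple_subcoalgebra scale \<Delta> C}) \<subseteq> {h. \<Lambda> h = 0}"
      using no by (intro span_minimal) (auto simp: subspace_def lin_zero[OF lin] linD(3,4)[OF lin])
    then have "t \<in> {h. \<Lambda> h = 0}" using cosemisimple unfolding cosemisimple_def by blast
    then show False using \<open>\<Lambda> t = 1\<close> by simp
  qed
  then obtain C h where C: "simple_subcoalgebra scale \<Delta> C" and h: "h \<in> C" "\<Lambda> h \<noteq> 0" by blast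
  have subC: "subcoalgebra scale \<Delta> C" "subspace C" using C by (auto simp: simple_subcoalgebra_def subcoalgebra_def)
  have "scale (inverse (\<Lambda> h)) (translate \<Lambda> h) \<in> C"
    using subcoalgebra_translate[OF subC(1) h(1) lin] subspace_scale[OF subC(2)] by blast
  then have "1 \<in> C" using h(2) by (simp add: translate_\<Lambda>)
  then have "span {1} \<subseteq> C" using subC(2) by (intro span_minimal) auto
  moreover have "span {1} \<noteq> {0 :: 'h}" using span_base[of 1 "{1}"] by auto
  ultimately have "C = span {1}"
    using C subcoalgebra_grouplike[OF one_grouplike] unfolding simple_subcoalgebra_def by blast
  then obtain c where "h = scale c 1" using h(1) by (auto simp: span_singleton)
  then show False using h(2) \<Lambda>_1 by (simp add: linD(4)[OF lin])
qed

end

end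

section \<open>The crossed product as a ring of functions\<close>

text \<open>
  A tensor in \<open>R \<otimes> H\<close> is determined by the values \<open>\<Sum> \<phi>(h) a\<close> for \<open>\<phi>\<close> in the dual of \<open>H\<close>. Thus \<open>R \<otimes> H\<close>
  becomes a subspace of a function space, and \<open>basic a h\<close> is the image of \<open>a # h\<close>.
\<close>

locale crossed_product_ring = alg_closed_hopf sH \<Delta> \<epsilon> S + R: k_algebra sR
  for sH :: "'k::alg_closed_field \<Rightarrow> 'h::ring_1 \<Rightarrow> 'h"
    and \<Delta> :: "'h \<Rightarrow> ('h \<times> 'h) list set" and \<epsilon> :: "'h \<Rightarrow> 'k" and S :: "'h \<Rightarrow> 'h"
    and sR :: "'k \<Rightarrow> 'r::{ring, monoid_mult} \<Rightarrow> 'r" +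
  fixes act :: "'h \<Rightarrow> 'r \<Rightarrow> 'r" and \<sigma> :: "'h \<Rightarrow> 'h \<Rightarrow> 'r"
  assumes twisted: "twisted_module_algebra sH \<Delta> \<epsilon> sR act \<sigma>"
    and ring_crossed: "ring (crossed_product sH \<Delta> sR act \<sigma>)"
begin

lemma vector_space_R: "vector_space sR" by (rule R.vector_space_axioms)

lemma weak_action: "weak_action sH \<Delta> sR act" and bil_\<sigma>: "bilinear_map sH sH sR \<sigma>"
  using twisted by (auto simp: twisted_module_algebra_def)

lemma bil_act: "bilinear_map sH sR sR act"
  using weak_action by (simp add: weak_action_def)

lemma act_mult: "act h (r * s) = SW (\<lambda>h1 h2. act h1 r * act h2 s) h"
  and act_one_left: "act 1 r = r"
  using weak_action by (auto simp: weak_action_def SW_def)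

lemma twisted_inverse:
  obtains \<tau> where "bilinear_map sH sH sR \<tau>"
    and "\<And>h g. SW (\<lambda>h1 h2. SW (\<lambda>g1 g2. \<sigma> h1 g1 * \<tau> h2 g2) g) h = sR (\<epsilon> h * \<epsilon> g) 1"
    and "\<And>h g. SW (\<lambda>h1 h2. SW (\<lambda>g1 g2. \<tau> h1 g1 * \<sigma> h2 g2) g) h = sR (\<epsilon> h * \<epsilon> g) 1"
    and "\<And>h g r. act h (act g r) = SW (\<lambda>h1 h'. SW (\<lambda>h2 h3. SW (\<lambda>g1 g'. SW (\<lambda>g2 g3.
      \<sigma> h1 g1 * act (h2 * g2) r * \<tau> h3 g3) g') g) h') h"
proof -
  obtain \<tau> where \<tau>: "bilinear_map sH sH sR \<tau>" "convolution_inverse \<Delta> \<epsilon> sR \<sigma> \<tau>"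
    "\<And>h g r. act h (act g r) = (\<Sum>(h1, h2, h3) \<leftarrow> sweedler3 \<Delta> h. \<Sum>(g1, g2, g3) \<leftarrow> sweedler3 \<Delta> g.
          \<sigma> h1 g1 * act (h2 * g2) r * \<tau> h3 g3)"
    using twisted by (auto simp: twisted_module_algebra_def)
  show thesis
  proof (rule that[OF \<tau>(1)])
    show "act h (act g r) = SW (\<lambda>h1 h'. SW (\<lambda>h2 h3. SW (\<lambda>g1 g'. SW (\<lambda>g2 g3.
      \<sigma> h1 g1 * act (h2 * g2) r * \<tau> h3 g3) g') g) h') h" for h g r
      unfolding \<tau>(3) sweedler3_def SW_def by (simp add: sum_list_concat_map case_prod_unfold o_def)
  qed (use \<tau>(2) in \<open>simp_all add: convolution_inverse_def SW_def\<close>)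
qed

definition sW :: "'k \<Rightarrow> (('h \<Rightarrow> 'k) \<Rightarrow> 'r) \<Rightarrow> (('h \<Rightarrow> 'k) \<Rightarrow> 'r)"
  where "sW c w = (\<lambda>\<phi>. sR c (w \<phi>))"

lemma vector_space_W: "vector_space sW"
  by unfold_locales (simp_all add: sW_def fun_eq_iff R.scale_right_distrib R.scale_left_distrib)

text \<open>The default \<open>0\<close> at nonlinear arguments makes equality of functions the same
  as equality at all functionals.\<close>

definition basic :: "'r \<Rightarrow> 'h \<Rightarrow> (('h \<Rightarrow> 'k) \<Rightarrow> 'r)"
  where "basic a h = (\<lambda>\<phi>. if lin sH (*) \<phi> then sR (\<phi> h) a else 0)"

lemma basic_apply: "lin sH (*) \<phi> \<Longrightarrow> basic a h \<phi> = sR (\<phi> h) a"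
  by (simp add: basic_def)

lemma lin_apply: "lin s sW f \<Longrightarrow> lin s sR (\<lambda>x. f x \<phi>)"
  by (auto intro!: linI vector_space_R dest: linD simp: linD(3,4) sW_def)

lemma bil_basic: "bilinear_map sR sH sW basic"
  by (intro bilinear_mapI linI vector_space_W vector_space_R vector_space_H)
    (auto simp: basic_def sW_def fun_eq_iff R.scale_right_distrib R.scale_left_distrib linD mult.commute)

lemmas [lin_intros] = bilinear_lin[OF bil_act] bilinear_lin[OF bil_\<sigma>] bilinear_lin[OF bil_basic]
  R.lin_mult vector_space_W vector_space_R

definition val :: "('r \<times> 'h) list \<Rightarrow> (('h \<Rightarrow> 'k) \<Rightarrow> 'r)"
  where "val xs = (\<Sum>(a, h)\<leftarrow>xs. basic a h)"

lemma val_append: "val (xs @ ys) = val xs + val ys"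
  by (simp add: val_def)

lemma val_apply: "lin sH (*) \<phi> \<Longrightarrow> val xs \<phi> = (\<Sum>(a, h)\<leftarrow>xs. sR (\<phi> h) a)"
  by (induction xs) (auto simp: val_def basic_def)

lemma val_eq_iff: "val xs = val ys \<longleftrightarrow> tensor sR sH xs = tensor sR sH ys"
proof
  assume eq: "val xs = val ys"
  show "tensor sR sH xs = tensor sR sH ys"
    by (intro tensor_eqI vector_space_R vector_space_H) (simp flip: val_apply add: eq)
next
  assume "tensor sR sH xs = tensor sR sH ys"
  then show "val xs = val ys" unfolding val_def by (rule tensor_sum_cong[OF bil_basic])
qed

abbreviation "CP \<equiv> crossed_product sH \<Delta> sR act \<sigma>"

definition emb :: "('r \<times> 'h) list set \<Rightarrow> (('h \<Rightarrow> 'k) \<Rightarrow> 'r)"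
  where "emb X = val (tensor_rep X)"

lemma carrier_CP: "carrier CP = range (tensor sR sH)"
  by (simp add: crossed_product_def tensor_product_def)

lemma tensor_tensor_rep: "tensor sR sH (tensor_rep (tensor sR sH xs)) = tensor sR sH xs"
proof -
  have "xs \<in> tensor sR sH xs" using tensor_eq_iff_mem[OF vector_space_R vector_space_H] by blast
  then have "tensor_rep (tensor sR sH xs) \<in> tensor sR sH xs" unfolding tensor_rep_def by (rule someI)
  then show ?thesis using tensor_eq_iff_mem[OF vector_space_R vector_space_H] by blast
qed

lemma emb_tensor: "emb (tensor sR sH xs) = val xs"
  unfolding emb_def val_eq_iff by (rule tensor_tensor_rep)

lemma emb_inj: "inj_on emb (carrier CP)"
  by (auto simp: inj_on_def carrier_CP emb_tensor val_eq_iff)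

lemma emb_image: "emb ` carrier CP = range val"
  by (auto simp: carrier_CP emb_tensor image_iff)

definition basic_mult :: "'r \<Rightarrow> 'h \<Rightarrow> 'r \<Rightarrow> 'h \<Rightarrow> (('h \<Rightarrow> 'k) \<Rightarrow> 'r)"
  where "basic_mult a h b g = SW (\<lambda>h1 h'. SW (\<lambda>h2 h3. SW (\<lambda>g1 g2.
    basic (a * act h1 b * \<sigma> h2 g1) (h3 * g2)) g) h') h"

lemma lin_basic_mult:
  "lin sR sW (\<lambda>a. basic_mult a h b g)" "lin sH sW (\<lambda>h. basic_mult a h b g)"
  "lin sR sW (\<lambda>b. basic_mult a h b g)" "lin sH sW (\<lambda>g. basic_mult a h b g)"
  unfolding basic_mult_def by (intro lin_intros)+

text \<open>The product of the crossed product is formed from chosen representatives; multilinearity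
  of \<open>basic_mult\<close> makes it computable from any.\<close>

lemma emb_mult:
  assumes "X = tensor sR sH xs" "Y = tensor sR sH ys"
  shows "emb (X \<otimes>\<^bsub>CP\<^esub> Y) = (\<Sum>(a, h)\<leftarrow>xs. \<Sum>(b, g)\<leftarrow>ys. basic_mult a h b g)"
proof -
  have "emb (X \<otimes>\<^bsub>CP\<^esub> Y) = (\<Sum>(a, h)\<leftarrow>tensor_rep X. \<Sum>(b, g)\<leftarrow>tensor_rep Y. basic_mult a h b g)"
    unfolding crossed_product_def
    by (simp add: emb_tensor val_def basic_mult_def SW_def sweedler3_def sum_list_concat_map case_prod_unfold o_def)
  also have "\<dots> = (\<Sum>(a, h)\<leftarrow>xs. \<Sum>(b, g)\<leftarrow>tensor_rep Y. basic_mult a h b g)"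
    unfolding case_prod_unfold
    by (rule tensor_sum_cong[of sR sH sW "\<lambda>a h. \<Sum>p\<leftarrow>tensor_rep Y. basic_mult a h (fst p) (snd p)",
          unfolded case_prod_unfold])
      (auto intro!: bilinear_mapI lin_sum_list_fun vector_space_R vector_space_H vector_space_W lin_basic_mult simp: assms tensor_tensor_rep)
  also have "\<dots> = (\<Sum>(a, h)\<leftarrow>xs. \<Sum>(b, g)\<leftarrow>ys. basic_mult a h b g)"
    using tensor_sum_cong[of sR sH sW "\<lambda>b g. basic_mult a h b g" "tensor_rep Y" ys for a h]
    by (simp add: bilinear_mapI lin_basic_mult assms tensor_tensor_rep)
  finally show ?thesis .
qed

lemma emb_add:
  assumes "X \<in> carrier CP" "Y \<in> carrier CP"
  shows "emb (X \<oplus>\<^bsub>CP\<^esub> Y) = emb X + emb Y"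
proof -
  have "X \<oplus>\<^bsub>CP\<^esub> Y = tensor sR sH (tensor_rep X @ tensor_rep Y)" by (simp add: crossed_product_def)
  then show ?thesis by (simp add: emb_tensor val_append) (simp add: emb_def)
qed

lemma subspace_val: "module.subspace sW (range val)"
proof -
  interpret W: vector_space sW by (rule vector_space_W)
  show ?thesis
  proof (rule W.subspaceI)
    show "0 \<in> range val" by (rule range_eqI[of _ _ "[]"]) (simp add: val_def)
    show "x + y \<in> range val" if "x \<in> range val" "y \<in> range val" for x y
      using that by (auto simp flip: val_append)
    show "sW c x \<in> range val" if x: "x \<in> range val" for c x
    proof -
      obtain xs where x: "x = val xs" using x by blast
      have "sW c x = val (map (\<lambda>(a, h). (sR c a, h)) xs)"
        unfolding x val_def
        by (simp add: lin_sum_list[OF lin_scale_fun[OF lin_ident[OF vector_space_W]]] case_prod_unfold o_def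
            linD(4)[OF bilinear_mapD(1)[OF bil_basic]])
      then show ?thesis by blast
    qed
  qed
qed

text \<open>\<open>corner_ring\<close> requires a product on the whole type. The projection extends
  the product from the image of \<open>R \<otimes> H\<close> to all functions, and left
  multiplication by \<open>e\<close> becomes this projection.\<close>

definition proj :: "(('h \<Rightarrow> 'k) \<Rightarrow> 'r) \<Rightarrow> (('h \<Rightarrow> 'k) \<Rightarrow> 'r)"
  where "proj = (SOME P. lin sW sW P \<and> (\<forall>x. P x \<in> range val) \<and> (\<forall>x\<in>range val. P x = x))"

lemma proj: "lin sW sW proj" "proj x \<in> range val" "x \<in> range val \<Longrightarrow> proj x = x"
proof -
  interpret W: vector_space sW by (rule vector_space_W)
  have "\<exists>P. lin sW sW P \<and> (\<forall>x. P x \<in> range val) \<and> (\<forall>x\<in>range val. P x = x)"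
    by (rule W.projection_exists[OF subspace_val]) blast
  from someI_ex[OF this] show "lin sW sW proj" "proj x \<in> range val" "x \<in> range val \<Longrightarrow> proj x = x"
    unfolding proj_def by blast+
qed

definition unemb :: "(('h \<Rightarrow> 'k) \<Rightarrow> 'r) \<Rightarrow> ('r \<times> 'h) list set"
  where "unemb x = inv_into (carrier CP) emb (proj x)"

lemma unemb: "unemb x \<in> carrier CP" "emb (unemb x) = proj x"
proof -
  have "proj x \<in> emb ` carrier CP" using proj(2) emb_image by blast
  then show "unemb x \<in> carrier CP" "emb (unemb x) = proj x"
    unfolding unemb_def by (auto intro: inv_into_into f_inv_into_f)
qed

lemma unemb_emb: "X \<in> carrier CP \<Longrightarrow> unemb (emb X) = X"
proof -
  assume X: "X \<in> carrier CP"
  then have "proj (emb X) = emb X" using emb_image by (intro proj(3)) blast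
  then show "unemb (emb X) = X" unfolding unemb_def using emb_inj X by simp
qed

lemma unemb_eqI: "X \<in> carrier CP \<Longrightarrow> emb X = proj x \<Longrightarrow> unemb x = X"
  using unemb[of x] inj_onD[OF emb_inj, of "unemb x" X] by simp

definition mul :: "(('h \<Rightarrow> 'k) \<Rightarrow> 'r) \<Rightarrow> (('h \<Rightarrow> 'k) \<Rightarrow> 'r) \<Rightarrow> (('h \<Rightarrow> 'k) \<Rightarrow> 'r)" (infixl "\<odot>" 70)
  where "x \<odot> y = emb (unemb x \<otimes>\<^bsub>CP\<^esub> unemb y)"

abbreviation "e \<equiv> basic 1 1"

lemma emb_one: "emb \<one>\<^bsub>CP\<^esub> = e"
  unfolding crossed_product_def by (simp add: emb_tensor val_def)

sublocale ring CP by (rule ring_crossed)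

lemma emb_mult_mul: "X \<in> carrier CP \<Longrightarrow> Y \<in> carrier CP \<Longrightarrow> emb (X \<otimes>\<^bsub>CP\<^esub> Y) = emb X \<odot> emb Y"
  by (simp add: mul_def unemb_emb)

sublocale corner_ring mul e
proof
  fix x y z
  note U = unemb(1)
  have unemb_mul: "unemb (x \<odot> y) = unemb x \<otimes>\<^bsub>CP\<^esub> unemb y" for x y
    by (simp add: mul_def unemb_emb U)
  have unemb_add: "unemb (x + y) = unemb x \<oplus>\<^bsub>CP\<^esub> unemb y" for x y
    by (rule unemb_eqI) (simp_all add: U emb_add unemb(2) linD(3)[OF proj(1)])
  have unemb_e: "unemb e = \<one>\<^bsub>CP\<^esub>"
    using unemb_emb[of "\<one>\<^bsub>CP\<^esub>"] by (simp add: emb_one)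
  show "x \<odot> y \<odot> z = x \<odot> (y \<odot> z)"
    unfolding mul_def[of "x \<odot> y"] mul_def[of x "y \<odot> z"] by (simp add: unemb_mul U m_assoc)
  show "x \<odot> (y + z) = x \<odot> y + x \<odot> z" "(x + y) \<odot> z = x \<odot> z + y \<odot> z"
    unfolding mul_def by (simp_all add: unemb_add U r_distr l_distr emb_add)
  show "e \<odot> (x \<odot> y) = x \<odot> y"
    unfolding mul_def[of e] by (simp add: unemb_e unemb_mul U) (simp add: mul_def)
  show "x \<odot> e = e \<odot> x" "e \<odot> e = e"
    by (simp_all add: mul_def unemb_e U emb_one)
qed

lemma unit_eq_proj: "e \<odot> x = proj x"
  using unemb_emb[of "\<one>\<^bsub>CP\<^esub>"] by (simp add: emb_one mul_def unemb)

lemma A_eq: "A = range val"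
proof (intro equalityI subsetI)
  show "x \<in> range val" if "x \<in> A" for x using that proj(2)[of x] by (simp add: A_def unit_eq_proj)
  show "x \<in> A" if "x \<in> range val" for x using proj(3)[OF that] by (simp add: A_def unit_eq_proj)
qed

lemma bij_emb: "bij_betw emb (carrier CP) A"
  using emb_inj emb_image by (simp add: bij_betw_def A_eq)

lemma emb_jacobson_radical: "emb ` jacobson_radical CP = rad"
  using bij_emb by (intro jacobson_radical_transport[OF ring_crossed]) (auto simp: emb_add emb_mult_mul)

lemma basic_A [simp, intro]: "basic a h \<in> A"
  unfolding A_eq by (rule range_eqI[of _ _ "[(a, h)]"]) (simp add: val_def)

lemma val_mul: "val xs \<odot> val ys = (\<Sum>(a, h)\<leftarrow>xs. \<Sum>(b, g)\<leftarrow>ys. basic_mult a h b g)"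
  using emb_mult[OF refl refl, of xs ys] by (simp add: emb_mult_mul carrier_CP emb_tensor)

lemma basic_mul: "basic a h \<odot> basic b g = basic_mult a h b g"
  using val_mul[of "[(a, h)]" "[(b, g)]"] by (simp add: val_def)

section \<open>Normalisation of the cocycle and of the action\<close>

lemma SW_apply:
  fixes \<phi> :: "'h \<Rightarrow> 'k"
  shows "SW f h \<phi> = SW (\<lambda>x y. f x y \<phi> :: 'r) h"
proof -
  have "(\<Sum>p\<leftarrow>xs. F p) \<phi> = (\<Sum>p\<leftarrow>xs. F p \<phi>)" for F :: "'x \<Rightarrow> ('h \<Rightarrow> 'k) \<Rightarrow> 'r" and xs
    by (induction xs) auto
  then show ?thesis by (simp add: SW_def case_prod_unfold)
qed

lemma sR_one: "a * sR c 1 = sR c a" "sR c 1 * a = sR c a"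
  by (simp_all add: R.scale_mult_left R.scale_mult_right)

lemma basic_scale: "basic (sR c a) h = sW c (basic a h)"
  by (rule linD(4)[OF bilinear_mapD(1)[OF bil_basic]])

text \<open>Obtained from the left unit law \<open>e \<odot> \<gamma>(g) = \<gamma>(g)\<close> by
  applying the counit to the second tensor factor.\<close>

lemma \<sigma>_one_left: "\<sigma> 1 g = sR (\<epsilon> g) 1"
proof -
  have "basic_mult 1 1 1 g = SW (\<lambda>h2 h3. SW (\<lambda>g1 g2. basic (1 * act 1 1 * \<sigma> h2 g1) (h3 * g2)) g) 1"
    unfolding basic_mult_def
    by (rule SW_one[where sW = sW]) (intro bilinear_mapI; intro lin_intros)
  also have "\<dots> = SW (\<lambda>g1 g2. basic (1 * act 1 1 * \<sigma> 1 g1) (1 * g2)) g"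
    by (rule SW_one[where sW = sW]) (intro bilinear_mapI; intro lin_intros)
  finally have "SW (\<lambda>g1 g2. basic (\<sigma> 1 g1) g2) g = basic 1 g"
    using basic_mul[of 1 1 1 g] by (simp add: act_one_left)
  then have "SW (\<lambda>g1 g2. basic (\<sigma> 1 g1) g2) g \<epsilon> = basic 1 g \<epsilon>" by simp
  then have "SW (\<lambda>g1 g2. sR (\<epsilon> g2) (\<sigma> 1 g1)) g = sR (\<epsilon> g) 1"
    by (simp add: SW_apply basic_apply)
  moreover have "SW (\<lambda>g1 g2. sR (\<epsilon> g2) (\<sigma> 1 g1)) g = \<sigma> 1 g"
    by (rule SW_counit_right) (intro lin_intros)
  ultimately show ?thesis by simp
qed

text \<open>The right unit law, after applying the counit, controls only the convolution product of
  \<open>h \<cdot> 1\<close> and \<open>\<sigma>(h, 1)\<close>; the two factors are separated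
  below.\<close>

lemma act_\<sigma>_one: "SW (\<lambda>x y. act x 1 * \<sigma> y 1) h = sR (\<epsilon> h) 1"
proof -
  have in_one: "SW (\<lambda>g1 g2. basic (1 * act h1 1 * \<sigma> h2 g1) (h3 * g2)) 1 = basic (act h1 1 * \<sigma> h2 1) h3" for h1 h2 h3
    by (subst SW_one[where sW = sW]) ((intro bilinear_mapI; intro lin_intros), simp)
  have "SW (\<lambda>h1 h'. SW (\<lambda>h2 h3. basic (act h1 1 * \<sigma> h2 1) h3) h') h = basic 1 h"
    using basic_mul[of 1 h 1 1] unfolding basic_mult_def in_one by simp
  then have "SW (\<lambda>h1 h'. SW (\<lambda>h2 h3. basic (act h1 1 * \<sigma> h2 1) h3) h') h \<epsilon> = basic 1 h \<epsilon>" by simp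
  then have "SW (\<lambda>h1 h'. SW (\<lambda>h2 h3. sR (\<epsilon> h3) (act h1 1 * \<sigma> h2 1)) h') h = sR (\<epsilon> h) 1"
    by (simp add: SW_apply basic_apply)
  moreover have "SW (\<lambda>h2 h3. sR (\<epsilon> h3) (act h1 1 * \<sigma> h2 1)) h' = act h1 1 * \<sigma> h' 1" for h1 h'
    by (rule SW_counit_right) (intro lin_intros)
  ultimately show ?thesis by simp
qed

text \<open>
  \<open>h \<mapsto> h \<cdot> 1\<close> is a convolution idempotent, and has the right inverse \<open>h \<mapsto> \<sigma>(h, 1)\<close> by
  \<open>act_\<sigma>_one\<close>; hence both are trivial.
\<close>

lemma act_one_right: "act h 1 = sR (\<epsilon> h) 1"
proof -
  have "act h 1 = SW (\<lambda>x y. sR (\<epsilon> y) (act x 1)) h"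
    by (rule SW_counit_right[symmetric]) (intro lin_intros)
  also have "\<dots> = SW (\<lambda>x y. SW (\<lambda>p q. act x 1 * (act p 1 * \<sigma> q 1)) y) h"
    by (simp add: SW_comp[OF R.lin_mult(2)[OF lin_ident[OF vector_space_R]], symmetric] act_\<sigma>_one sR_one)
  also have "\<dots> = SW (\<lambda>y q. SW (\<lambda>x p. act x 1 * (act p 1 * \<sigma> q 1)) y) h"
    by (rule SW_coassoc[where sW = sR, symmetric]; intro lin_intros)
  also have "\<dots> = SW (\<lambda>y q. act y (1 * 1) * \<sigma> q 1) h"
    unfolding act_mult by (simp add: SW_comp[OF R.lin_mult(1)[OF lin_ident[OF vector_space_R]]] mult.assoc)
  also have "\<dots> = sR (\<epsilon> h) 1" by (simp add: act_\<sigma>_one)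
  finally show ?thesis .
qed

lemma \<sigma>_one_right: "\<sigma> h 1 = sR (\<epsilon> h) 1"
proof -
  have "\<sigma> h 1 = SW (\<lambda>x y. sR (\<epsilon> x) (\<sigma> y 1)) h"
    by (rule SW_counit_left[symmetric]) (intro lin_intros)
  also have "\<dots> = sR (\<epsilon> h) 1" using act_\<sigma>_one[of h] by (simp add: act_one_right sR_one)
  finally show ?thesis .
qed

section \<open>Commutation rules for \<open>R\<close> and \<open>H\<close> inside the crossed
  product\<close>

abbreviation "\<iota> r \<equiv> basic r 1"
abbreviation "\<gamma> h \<equiv> basic 1 h"

lemma \<iota>_mul_basic: "\<iota> a \<odot> basic b h = basic (a * b) h"
proof -
  have "basic_mult a 1 b h = SW (\<lambda>h2 h3. SW (\<lambda>g1 g2. basic (a * act 1 b * \<sigma> h2 g1) (h3 * g2)) h) 1"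
    unfolding basic_mult_def
    by (rule SW_one[where sW = sW]) (intro bilinear_mapI; intro lin_intros)
  also have "\<dots> = SW (\<lambda>g1 g2. basic (a * act 1 b * \<sigma> 1 g1) (1 * g2)) h"
    by (rule SW_one[where sW = sW]) (intro bilinear_mapI; intro lin_intros)
  also have "\<dots> = SW (\<lambda>g1 g2. sW (\<epsilon> g1) (basic (a * b) g2)) h"
    by (simp add: act_one_left \<sigma>_one_left sR_one basic_scale)
  also have "\<dots> = basic (a * b) h"
    by (rule SW_counit_left) (intro lin_intros)
  finally show ?thesis by (simp add: basic_mul)
qed

lemma basic_eq: "basic a h = \<iota> a \<odot> \<gamma> h"
  by (simp add: \<iota>_mul_basic)

lemma \<gamma>_mul_\<iota>: "\<gamma> h \<odot> \<iota> b = SW (\<lambda>h1 h2. basic (act h1 b) h2) h"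
proof -
  have in_one: "SW (\<lambda>g1 g2. basic (1 * act h1 b * \<sigma> h2 g1) (h3 * g2)) 1 = sW (\<epsilon> h2) (basic (act h1 b) h3)" for h1 h2 h3
    by (subst SW_one[where sW = sW])
      ((intro bilinear_mapI; intro lin_intros), simp add: \<sigma>_one_right sR_one basic_scale)
  have "SW (\<lambda>h2 h3. sW (\<epsilon> h2) (basic (act h1 b) h3)) h' = basic (act h1 b) h'" for h1 h'
    by (rule SW_counit_left) (intro lin_intros)
  then show ?thesis unfolding basic_mul basic_mult_def in_one by (rule SW_cong)
qed

lemma \<gamma>_mul_\<gamma>: "\<gamma> h \<odot> \<gamma> g = SW (\<lambda>h1 h2. SW (\<lambda>g1 g2. basic (\<sigma> h1 g1) (h2 * g2)) g) h"
proof -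
  have sWv: "lin sW sW (sW c)" for c by (rule lin_scale_fun[OF lin_ident[OF vector_space_W]])
  have "\<gamma> h \<odot> \<gamma> g = SW (\<lambda>x h'. sW (\<epsilon> x) (SW (\<lambda>h1 h2. SW (\<lambda>g1 g2. basic (\<sigma> h1 g1) (h2 * g2)) g) h')) h"
    unfolding basic_mul basic_mult_def by (simp add: act_one_right sR_one basic_scale SW_comp[OF sWv])
  also have "\<dots> = SW (\<lambda>h1 h2. SW (\<lambda>g1 g2. basic (\<sigma> h1 g1) (h2 * g2)) g) h"
    by (rule SW_counit_left) (intro lin_intros)
  finally show ?thesis .
qed

sublocale corner_extension mul e "\<lambda>r. \<iota> r"
proof
  show "\<iota> (r + s) = \<iota> r + \<iota> s" for r s by (rule linD(3)[OF bilinear_mapD(1)[OF bil_basic]])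
  show "\<iota> (r * s) = \<iota> r \<odot> \<iota> s" for r s by (simp add: \<iota>_mul_basic)
qed simp

lemma sW_eq_mul: "x \<in> A \<Longrightarrow> sW c x = \<iota> (sR c 1) \<odot> x"
proof -
  assume "x \<in> A"
  then obtain xs where x: "x = val xs" by (auto simp: A_eq)
  have "\<iota> (sR c 1) \<odot> basic a h = sW c (basic a h)" for a h
    by (subst \<iota>_mul_basic) (simp add: sR_one basic_scale)
  then show ?thesis
    unfolding x val_def mul_sum_list lin_sum_list[OF lin_scale_fun[OF lin_ident[OF vector_space_W]]] case_prod_unfold
    by simp
qed

lemma scalar_central: "\<iota> (sR c 1) \<odot> x = x \<odot> \<iota> (sR c 1)"
proof -
  have "basic_mult a h (sR c 1) 1 = sW c (basic_mult a h 1 1)" for a h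
    by (rule linD(4)[OF lin_basic_mult(3)])
  then have *: "basic a h \<odot> \<iota> (sR c 1) = \<iota> (sR c 1) \<odot> basic a h" for a h
    using basic_A[of a h] by (simp add: sW_eq_mul flip: basic_mul)
  obtain xs where xs: "e \<odot> x = val xs" using A_closed(1)[of e x] unfolding A_eq by blast
  have "\<iota> (sR c 1) \<odot> (e \<odot> x) = (e \<odot> x) \<odot> \<iota> (sR c 1)"
    unfolding xs val_def by (simp add: mul_sum_list sum_list_mul case_prod_unfold *)
  then show ?thesis by (simp add: mul_unit_mul mul_assoc unit_mul)
qed

lemma lin_mul: "lin s sW f \<Longrightarrow> lin s sW (\<lambda>x. f x \<odot> y)" "lin s sW f \<Longrightarrow> lin s sW (\<lambda>x. y \<odot> f x)"
proof -
  have scale: "sW c x \<odot> y = sW c (x \<odot> y)" "y \<odot> sW c x = sW c (y \<odot> x)" for c x y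
  proof -
    have "e \<odot> sW c x = \<iota> (sR c 1) \<odot> x" for x
    proof -
      have "e \<odot> sW c x = sW c (e \<odot> x)" by (simp add: unit_eq_proj linD(4)[OF proj(1)])
      then show ?thesis by (simp add: sW_eq_mul mul_unit_mul)
    qed
    then show "sW c x \<odot> y = sW c (x \<odot> y)" "y \<odot> sW c x = sW c (y \<odot> x)"
      by (metis A_closed(1) mul_assoc mul_unit_mul sW_eq_mul scalar_central unit_mul)+
  qed
  show "lin s sW f \<Longrightarrow> lin s sW (\<lambda>x. f x \<odot> y)" "lin s sW f \<Longrightarrow> lin s sW (\<lambda>x. y \<odot> f x)"
    using scale by (auto simp: Vector_Spaces.linear_iff distribs)
qed

lemmas [lin_intros] = lin_mul

lemma emb_crossed_subspace: "emb ` crossed_subspace sH sR I = {val xs | xs. set xs \<subseteq> I \<times> UNIV}"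
  unfolding crossed_subspace_def by (simp add: image_image emb_tensor) blast

text \<open>The counit of \<open>H\<close> gives a left \<open>R\<close>-linear retraction onto \<open>R\<close>.\<close>

lemma apply_counit_\<iota>: "\<iota> r \<epsilon> = r"
  by (simp add: basic_apply counit_one)

lemma apply_counit_mul: "x \<in> A \<Longrightarrow> (\<iota> r \<odot> x) \<epsilon> = r * x \<epsilon>"
proof -
  assume "x \<in> A"
  then obtain xs where x: "x = val xs" by (auto simp: A_eq)
  have "(\<Sum>p\<leftarrow>xs. F p) \<epsilon> = (\<Sum>p\<leftarrow>xs. F p \<epsilon>)" for F :: "'r \<times> 'h \<Rightarrow> ('h \<Rightarrow> 'k) \<Rightarrow> 'r" and xs
    by (induction xs) auto
  then show ?thesis
    unfolding x val_def mul_sum_list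
    by (simp add: case_prod_unfold \<iota>_mul_basic basic_apply R.scale_mult_right flip: sum_list_const_mult)
qed

text \<open>The retraction is left \<open>R\<close>-linear, so an inverse of
  \<open>e - \<iota> y\<close> in \<open>A\<close> yields a right inverse of \<open>1 - y\<close> in
  \<open>R\<close>. A second use of this turns right inverses into two-sided ones.\<close>

lemma base_mem_radical:
  assumes x: "\<iota> x \<in> rad"
  shows "x \<in> regular.rad"
proof -
  have right_inv: "\<exists>v. (1 - y) * v = 1" if y: "\<iota> y \<in> rad" for y
  proof -
    obtain u where u: "u \<in> A" "(e - \<iota> y) \<odot> u = e" using rad_quasi_regular[OF y] by blast
    have "e - \<iota> y = \<iota> (1 - y)" by (simp add: \<iota>_diff)
    then have "(\<iota> (1 - y) \<odot> u) \<epsilon> = 1" using u apply_counit_\<iota>[of 1] by simp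
    then show ?thesis using apply_counit_mul[OF u(1)] by auto
  qed
  have "\<exists>u. u * (1 - a * x) = 1" for a
  proof -
    have y: "\<iota> (a * x) \<in> rad" using radD(4)[OF x] by (simp add: \<iota>_mult)
    obtain v where v: "(1 - a * x) * v = 1" using right_inv[OF y] by blast
    have "\<iota> (- (a * x * v)) \<in> rad"
      using radD(5)[OF rad_mul_right[OF y, of "\<iota> v"]] by (simp add: \<iota>_mult \<iota>_minus)
    then obtain w where w: "(1 - - (a * x * v)) * w = 1" using right_inv by blast
    \<comment> \<open>The right inverse \<open>v\<close> of \<open>1 - a * x\<close> has the form
      \<open>1 - y\<close> with \<open>\<iota> y\<close> in the radical, so \<open>v\<close> has a
      right inverse too and must be a unit.\<close>
    have "1 - - (a * x * v) = v" using v by (simp add: left_diff_distrib algebra_simps)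
    then have "v * w = 1" using w by simp
    then have "w = 1 - a * x" using v by (metis mult.assoc mult_1 mult_1_right)
    then show ?thesis using \<open>v * w = 1\<close> by blast
  qed
  then show ?thesis by (simp add: regular.rad_def)
qed

section \<open>Crossed products with group algebras and their duals\<close>

text \<open>The subspace \<open>J(R) # H\<close>, transferred to the function space.\<close>

definition rad_span :: "(('h \<Rightarrow> 'k) \<Rightarrow> 'r) set"
  where "rad_span = {val xs | xs. set xs \<subseteq> regular.rad \<times> UNIV}"

lemma rad_span_basic: "a \<in> regular.rad \<Longrightarrow> basic a h \<in> rad_span"
  unfolding rad_span_def by (intro CollectI exI[of _ "[(a, h)]"]) (simp add: val_def)

lemma rad_span_zero: "0 \<in> rad_span"
  unfolding rad_span_def by (intro CollectI exI[of _ "[]"]) (simp add: val_def)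

lemma rad_span_add:
  assumes "x \<in> rad_span" "y \<in> rad_span"
  shows "x + y \<in> rad_span"
proof -
  obtain xs ys where xs: "set xs \<subseteq> regular.rad \<times> UNIV" "set ys \<subseteq> regular.rad \<times> UNIV"
    and xy: "x = val xs" "y = val ys"
    using assms by (auto simp: rad_span_def)
  have "x + y = val (xs @ ys)" by (simp add: xy val_append)
  moreover have "set (xs @ ys) \<subseteq> regular.rad \<times> UNIV" using xs by simp
  ultimately show ?thesis unfolding rad_span_def by blast
qed

lemma rad_span_sum: "(\<And>i. i \<in> I \<Longrightarrow> f i \<in> rad_span) \<Longrightarrow> sum f I \<in> rad_span"
  by (induction I rule: infinite_finite_induct) (auto intro: rad_span_zero rad_span_add)

lemma rad_span_sum_list: "(\<And>i. i \<in> set xs \<Longrightarrow> f i \<in> rad_span) \<Longrightarrow> sum_list (map f xs) \<in> rad_span"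
  by (induction xs) (auto intro: rad_span_zero rad_span_add)

lemma average:
  assumes "finite G" "of_nat (card G) \<noteq> (0 :: 'k)"
  defines "k \<equiv> \<iota> (sR (inverse (of_nat (card G))) 1)"
  shows "k \<odot> x = x \<odot> k" and "x \<in> A \<Longrightarrow> k \<odot> (\<Sum>g\<in>G. x) = x"
proof -
  interpret W: vector_space sW by (rule vector_space_W)
  show "k \<odot> x = x \<odot> k" unfolding k_def by (rule scalar_central)
  assume x: "x \<in> A"
  then have "(\<Sum>g\<in>G. x) \<in> A" by auto
  then have "k \<odot> (\<Sum>g\<in>G. x) = sW (inverse (of_nat (card G))) (sW (of_nat (card G)) x)"
    unfolding k_def by (simp add: sW_eq_mul[symmetric] W.sum_constant_scale)
  then show "k \<odot> (\<Sum>g\<in>G. x) = x" using assms(2) by simp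
qed

section \<open>The cocommutative case: a group of grouplike elements\<close>

context
  assumes cocomm: "cocommutative sH \<Delta>"
begin

lemma \<gamma>_\<iota>_grouplike:
  assumes g: "g \<in> grouplikes"
  shows "\<gamma> g \<odot> \<iota> b = \<iota> (act g b) \<odot> \<gamma> g"
  unfolding \<gamma>_mul_\<iota> basic_eq[of "act g b" g, symmetric]
  by (rule SW_grouplike[OF g, where sW = sW]) (intro bilinear_mapI; intro lin_intros)

lemma \<gamma>_\<gamma>_grouplike:
  assumes g: "g \<in> grouplikes" and h: "h \<in> grouplikes"
  shows "\<gamma> g \<odot> \<gamma> h = \<iota> (\<sigma> g h) \<odot> \<gamma> (g * h)"
proof -
  have "\<gamma> g \<odot> \<gamma> h = SW (\<lambda>h1 h2. basic (\<sigma> g h1) (g * h2)) h"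
    unfolding \<gamma>_mul_\<gamma> by (rule SW_grouplike[OF g, where sW = sW]) (intro bilinear_mapI; intro lin_intros)
  also have "\<dots> = basic (\<sigma> g h) (g * h)"
    by (rule SW_grouplike[OF h, where sW = sW]) (intro bilinear_mapI; intro lin_intros)
  finally show ?thesis by (simp add: \<iota>_mul_basic)
qed

lemma act_grouplike:
  assumes g: "g \<in> grouplikes"
  shows "act g (r * s) = act g r * act g s" "act g 1 = 1" "act g (r - s) = act g r - act g s"
proof -
  show "act g (r * s) = act g r * act g s"
    unfolding act_mult by (rule SW_grouplike[OF g, where sW = sR]) (intro bilinear_mapI; intro lin_intros)
  show "act g 1 = 1" by (simp add: act_one_right counit_grouplike[OF g])
  show "act g (r - s) = act g r - act g s" by (rule lin_diff[OF bilinear_mapD(2)[OF bil_act]])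
qed

text \<open>On grouplike elements every Sweedler sum has a single term, so
  \<open>\<sigma>(g, g')\<close> becomes a unit and the twisting becomes conjugation by it.\<close>

lemma grouplike_twist:
  assumes g: "g \<in> grouplikes" and g': "g' \<in> grouplikes"
  obtains s t where "\<sigma> g g' = s" "s * t = 1" "t * s = 1" "\<And>r. act g (act g' r) = s * act (g * g') r * t"
proof -
  obtain \<tau> where b: "bilinear_map sH sH sR \<tau>"
    and \<tau>: "\<And>h g. SW (\<lambda>h1 h2. SW (\<lambda>g1 g2. \<sigma> h1 g1 * \<tau> h2 g2) g) h = sR (\<epsilon> h * \<epsilon> g) 1"
      "\<And>h g. SW (\<lambda>h1 h2. SW (\<lambda>g1 g2. \<tau> h1 g1 * \<sigma> h2 g2) g) h = sR (\<epsilon> h * \<epsilon> g) 1"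
      "\<And>h g r. act h (act g r) = SW (\<lambda>h1 h'. SW (\<lambda>h2 h3. SW (\<lambda>g1 g'. SW (\<lambda>g2 g3.
        \<sigma> h1 g1 * act (h2 * g2) r * \<tau> h3 g3) g') g) h') h"
    by (rule twisted_inverse) (rule that)
  note [lin_intros] = bilinear_lin[OF b]
  have 2: "SW (\<lambda>h1 h2. SW (\<lambda>g1 g2. F h1 g1 h2 g2) g') g = F g g' g g'"
    if "\<And>b c d. lin sH sR (\<lambda>a. F a b c d)" "\<And>a c d. lin sH sR (\<lambda>b. F a b c d)"
      "\<And>a b d. lin sH sR (\<lambda>c. F a b c d)" "\<And>a b c. lin sH sR (\<lambda>d. F a b c d)" for F
  proof -
    have "SW (\<lambda>h1 h2. SW (\<lambda>g1 g2. F h1 g1 h2 g2) g') g = SW (\<lambda>g1 g2. F g g1 g g2) g'"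
      by (rule SW_grouplike[OF g, where sW = sR]) (intro bilinear_mapI; intro lin_SW_fun that)
    also have "\<dots> = F g g' g g'"
      by (rule SW_grouplike[OF g', where sW = sR]) (intro bilinear_mapI; intro that)
    finally show ?thesis .
  qed
  have "\<sigma> g g' * \<tau> g g' = sR (\<epsilon> g * \<epsilon> g') 1"
    using \<tau>(1)[of g' g] by (subst (asm) 2) (assumption | intro lin_intros)+
  then have "\<sigma> g g' * \<tau> g g' = 1" by (simp add: counit_grouplike g g')
  moreover have "\<tau> g g' * \<sigma> g g' = sR (\<epsilon> g * \<epsilon> g') 1"
    using \<tau>(2)[of g' g] by (subst (asm) 2) (assumption | intro lin_intros)+
  then have "\<tau> g g' * \<sigma> g g' = 1" by (simp add: counit_grouplike g g')
  moreover have "act g (act g' r) = \<sigma> g g' * act (g * g') r * \<tau> g g'" for r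
  proof -
    have "act g (act g' r) = SW (\<lambda>h2 h3. SW (\<lambda>g1 x. SW (\<lambda>g2 g3. \<sigma> g g1 * act (h2 * g2) r * \<tau> h3 g3) x) g') g"
      unfolding \<tau>(3) by (rule SW_grouplike[OF g, where sW = sR]) (intro bilinear_mapI; intro lin_intros)
    also have "\<dots> = SW (\<lambda>g1 x. SW (\<lambda>g2 g3. \<sigma> g g1 * act (g * g2) r * \<tau> g g3) x) g'"
      by (rule SW_grouplike[OF g, where sW = sR]) (intro bilinear_mapI; intro lin_intros)
    also have "\<dots> = SW (\<lambda>g2 g3. \<sigma> g g' * act (g * g2) r * \<tau> g g3) g'"
      by (rule SW_grouplike[OF g', where sW = sR]) (intro bilinear_mapI; intro lin_intros)
    also have "\<dots> = \<sigma> g g' * act (g * g') r * \<tau> g g'"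
      by (rule SW_grouplike[OF g', where sW = sR]) (intro bilinear_mapI; intro lin_intros)
    finally show ?thesis .
  qed
  ultimately show thesis using that by blast
qed

text \<open>The inverse is \<open>S g\<close>; that it is grouplike follows from the bijectivity of
  left multiplication by \<open>g\<close> on the finite set of grouplike elements.\<close>

lemma grouplike_inverse_exists:
  assumes g: "g \<in> grouplikes"
  obtains g' where "g' \<in> grouplikes" "g * g' = 1" "g' * g = 1"
proof -
  have "1 \<in> (\<lambda>h. g * h) ` grouplikes"
    using bij_mult_grouplike[OF cocomm g] one_grouplike by (simp add: bij_betw_def)
  then obtain g' where g': "g' \<in> grouplikes" "g * g' = 1" by auto
  have "g' = S g * (g * g')" using grouplike_inverse(2)[OF g] by (simp flip: mult.assoc)
  then have "g' = S g" using g'(2) by simp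
  then show thesis using that g' grouplike_inverse(2)[OF g] by simp
qed

text \<open>Acting by \<open>g\<close> and its inverse, in either order, is an inner automorphism of
  \<open>R\<close>; one order gives surjectivity and the other injectivity.\<close>

lemma act_grouplike_bij:
  assumes g: "g \<in> grouplikes"
  shows "\<exists>s. act g s = r" "act g r = act g s \<Longrightarrow> r = s"
proof -
  obtain g' where g': "g' \<in> grouplikes" "g * g' = 1" "g' * g = 1" by (rule grouplike_inverse_exists[OF g])
  obtain p q where st: "p * q = 1" "q * p = 1" "\<And>r. act g (act g' r) = p * r * q"
    using grouplike_twist[OF g g'(1)] g'(2) act_one_left by metis
  have "p * (q * r * p) * q = (p * q) * r * (p * q)" by (simp add: mult.assoc)
  then have "act g (act g' (q * r * p)) = r" using st by simp
  then show "\<exists>s. act g s = r" ..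
  obtain p q where st: "p * q = 1" "q * p = 1" "\<And>r. act g' (act g r) = p * r * q"
    using grouplike_twist[OF g'(1) g] g'(3) act_one_left by metis
  have "q * act g' (act g r) * p = r" for r
  proof -
    have "q * (p * r * q) * p = (q * p) * r * (q * p)" by (simp add: mult.assoc)
    then show ?thesis using st by simp
  qed
  then show "act g r = act g s \<Longrightarrow> r = s" by metis
qed

lemma \<gamma>_unit:
  assumes g: "g \<in> grouplikes"
  shows "\<exists>x. \<gamma> g \<odot> x = e \<and> x \<odot> \<gamma> g = e"
proof -
  obtain g' where g': "g' \<in> grouplikes" "g * g' = 1" "g' * g = 1" by (rule grouplike_inverse_exists[OF g])
  obtain t where t: "\<sigma> g g' * t = 1" using grouplike_twist[OF g g'(1)] by metis
  obtain t' where t': "t' * \<sigma> g' g = 1" using grouplike_twist[OF g'(1) g] by metis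
  define x where "x = \<gamma> g' \<odot> \<iota> t"
  define y where "y = \<iota> t' \<odot> \<gamma> g'"
  have x: "\<gamma> g \<odot> x = e"
    unfolding x_def mul_assoc[symmetric] \<gamma>_\<gamma>_grouplike[OF g g'(1)] using t
    by (simp add: g' flip: \<iota>_mult)
  have y: "y \<odot> \<gamma> g = e"
    unfolding y_def mul_assoc \<gamma>_\<gamma>_grouplike[OF g'(1) g] using t'
    by (simp add: g' flip: \<iota>_mult)
  have "y = y \<odot> (\<gamma> g \<odot> x)" using x by (simp add: y_def)
  also have "\<dots> = x" using y by (simp add: x_def flip: mul_assoc)
  finally show ?thesis using x y by blast
qed

lemma act_grouplike_radical:
  assumes g: "g \<in> grouplikes" and x: "x \<in> regular.rad"
  shows "act g x \<in> regular.rad"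
proof -
  have "\<exists>u. u * (1 - a * act g x) = 1" for a
  proof -
    obtain b where b: "act g b = a" using act_grouplike_bij(1)[OF g] by blast
    obtain u where u: "u * (1 - b * x) = 1" using x by (auto simp: regular.rad_def)
    have "act g u * (1 - a * act g x) = act g (u * (1 - b * x))"
      by (simp add: act_grouplike[OF g] b)
    then show ?thesis using u act_grouplike(2)[OF g] by auto
  qed
  then show ?thesis by (simp add: regular.rad_def)
qed

text \<open>Elements of \<open>A\<close> are functions on the dual, so their coefficient at
  \<open>g\<close> is simply their value at this functional.\<close>

abbreviation "coord g \<equiv> (\<lambda>h. representation grouplikes h g)"

lemma coord_lin: "lin sH (*) (coord g)"
  by (rule linear_representation[OF independent_grouplikes span_grouplikes[OF cocomm]])

lemma grouplike_expansion:
  assumes "x \<in> A"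
  shows "x = (\<Sum>g\<in>grouplikes. \<iota> (x (coord g)) \<odot> \<gamma> g)"
proof -
  have basic: "basic a h = (\<Sum>g\<in>grouplikes. basic (sR (coord g h) a) g)" for a h
  proof -
    have "h = (\<Sum>g\<in>grouplikes. sH (coord g h) g)"
      using span_grouplikes[OF cocomm] grouplikes_finite(1)[OF cocomm]
      by (intro sum_representation_eq[symmetric] independent_grouplikes) auto
    then have "basic a h = basic a (\<Sum>g\<in>grouplikes. sH (coord g h) g)" by simp
    also have "\<dots> = (\<Sum>g\<in>grouplikes. basic (sR (coord g h) a) g)"
      by (simp add: lin_sum[OF bilinear_mapD(2)[OF bil_basic]] linD(4)[OF bilinear_mapD(2)[OF bil_basic]]
          basic_scale)
    finally show ?thesis .
  qed
  obtain xs where x: "x = val xs" using assms by (auto simp: A_eq)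
  have "val xs = (\<Sum>g\<in>grouplikes. basic (val xs (coord g)) g)"
  proof (induction xs)
    case Nil
    have v: "val [] (coord g) = 0" for g by (simp add: val_def)
    have z: "basic 0 g = 0" for g by (rule lin_zero[OF bilinear_mapD(1)[OF bil_basic]])
    show ?case unfolding v z sum.neutral_const by (simp add: val_def)
  next
    case (Cons p xs)
    obtain a h where p: "p = (a, h)" by (cases p)
    have "val (p # xs) = basic a h + val xs" by (simp add: val_def p)
    also have "\<dots> = (\<Sum>g\<in>grouplikes. basic (sR (coord g h) a) g) + (\<Sum>g\<in>grouplikes. basic (val xs (coord g)) g)"
      by (rule arg_cong2[of _ _ _ _ "(+)", OF basic Cons.IH])
    also have "\<dots> = (\<Sum>g\<in>grouplikes. basic (val (p # xs) (coord g)) g)"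
      by (simp add: val_apply[OF coord_lin] p linD(3)[OF bilinear_mapD(1)[OF bil_basic]] sum.distrib)
    finally show ?case .
  qed
  then show ?thesis by (simp add: x \<iota>_mul_basic)
qed

lemma coord_sum:
  assumes "g \<in> grouplikes"
  shows "(\<Sum>h\<in>grouplikes. \<iota> (r h) \<odot> \<gamma> h) (coord g) = r g"
proof -
  have "(\<Sum>h\<in>grouplikes. basic (r h) h) (coord g) = (\<Sum>h\<in>grouplikes. basic (r h) h (coord g))"
    by (rule lin_sum[OF lin_apply[OF lin_ident[OF vector_space_W]]])
  also have "\<dots> = (\<Sum>h\<in>grouplikes. if h = g then r g else 0)"
    using representation_basis[OF independent_grouplikes]
    by (intro sum.cong) (auto simp: basic_apply[OF coord_lin])
  also have "\<dots> = r g" using assms grouplikes_finite(1)[OF cocomm] by simp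
  finally show ?thesis by (simp add: \<iota>_mul_basic)
qed

lemma radical_cocommutative:
  shows "x \<in> regular.rad \<Longrightarrow> \<iota> x \<in> rad" and "rad \<subseteq> rad_span"
proof -
  obtain w' where w': "\<And>g. g \<in> grouplikes \<Longrightarrow> \<gamma> g \<odot> w' g = e" "\<And>g. g \<in> grouplikes \<Longrightarrow> w' g \<odot> \<gamma> g = e"
    using \<gamma>_unit by metis
  have \<iota>_\<gamma>: "\<exists>r'. \<iota> r \<odot> \<gamma> g = \<gamma> g \<odot> \<iota> r'" if g: "g \<in> grouplikes" for g r
    using act_grouplike_bij(1)[OF g, of r] \<gamma>_\<iota>_grouplike[OF g] by metis
  interpret G: group_extension mul e "\<lambda>r. \<iota> r" grouplikes "\<lambda>g. \<gamma> g" w' "\<lambda>g h. g * h"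
  proof
    show "finite grouplikes" by (rule grouplikes_finite[OF cocomm])
    fix g h r x
    show "x \<in> A \<Longrightarrow> \<exists>r. x = (\<Sum>g\<in>grouplikes. \<iota> (r g) \<odot> \<gamma> g)"
      by (intro exI, rule grouplike_expansion)
    assume g: "g \<in> grouplikes"
    show "\<gamma> g \<in> A" by simp
    show "\<gamma> g \<odot> w' g = e" "w' g \<odot> \<gamma> g = e" using w' g by simp_all
    show "\<exists>r'. \<gamma> g \<odot> \<iota> r = \<iota> r' \<odot> \<gamma> g" using \<gamma>_\<iota>_grouplike[OF g] by blast
    show "\<exists>r'. \<iota> r \<odot> \<gamma> g = \<gamma> g \<odot> \<iota> r'" by (rule \<iota>_\<gamma>[OF g])
    show "bij_betw (\<lambda>h. g * h) grouplikes grouplikes" by (rule bij_mult_grouplike[OF cocomm g])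
    assume h: "h \<in> grouplikes"
    show "\<exists>r. \<gamma> g \<odot> \<gamma> h = \<iota> r \<odot> \<gamma> (g * h)" using \<gamma>_\<gamma>_grouplike[OF g h] by blast
  qed
  show "\<iota> x \<in> rad" if "x \<in> regular.rad" for x
    using that by (rule G.base_radical[rotated]) (use act_grouplike_radical \<gamma>_\<iota>_grouplike in blast)
  show "rad \<subseteq> rad_span"
  proof
    fix x assume x: "x \<in> rad"
    \<comment> \<open>\<open>radical_coefficients\<close> expects the coefficients to the right of
      \<open>\<gamma> g\<close>; surjectivity of \<open>act g\<close> provides them.\<close>
    have "\<forall>g. \<exists>s. g \<in> grouplikes \<longrightarrow> act g s = x (coord g)" using act_grouplike_bij(1) by blast
    then obtain r where r: "\<And>g. g \<in> grouplikes \<Longrightarrow> act g (r g) = x (coord g)" by metis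
    have x_eq: "x = (\<Sum>g\<in>grouplikes. \<gamma> g \<odot> \<iota> (r g))"
    proof -
      have "x = (\<Sum>g\<in>grouplikes. \<iota> (x (coord g)) \<odot> \<gamma> g)"
        by (rule grouplike_expansion) (rule radD(1)[OF x])
      also have "\<dots> = (\<Sum>g\<in>grouplikes. \<gamma> g \<odot> \<iota> (r g))"
        by (intro sum.cong) (auto simp: \<gamma>_\<iota>_grouplike r)
      finally show ?thesis .
    qed
    have free: "r g = s g" if eq: "(\<Sum>g\<in>grouplikes. \<gamma> g \<odot> \<iota> (r g)) = (\<Sum>g\<in>grouplikes. \<gamma> g \<odot> \<iota> (s g))"
      and g: "g \<in> grouplikes" for r s g
    proof -
      have sum: "(\<Sum>g\<in>grouplikes. \<gamma> g \<odot> \<iota> (r g)) = (\<Sum>g\<in>grouplikes. \<iota> (act g (r g)) \<odot> \<gamma> g)" for r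
        by (intro sum.cong) (auto simp: \<gamma>_\<iota>_grouplike)
      have "act g (r g) = act g (s g)"
        using arg_cong[OF eq, of "\<lambda>x. x (coord g)"] unfolding sum by (simp only: coord_sum[OF g])
      then show ?thesis by (rule act_grouplike_bij(2)[OF g])
    qed
    have "r g \<in> regular.rad" if g: "g \<in> grouplikes" for g
      using average[OF grouplikes_finite[OF cocomm]] free _ g
      by (rule G.radical_coefficients) (assumption | (subst x_eq[symmetric], rule x))+
    then have "(\<Sum>g\<in>grouplikes. basic (act g (r g)) g) \<in> rad_span"
      using act_grouplike_radical by (intro rad_span_sum rad_span_basic) auto
    also have "(\<Sum>g\<in>grouplikes. basic (act g (r g)) g) = (\<Sum>g\<in>grouplikes. \<iota> (x (coord g)) \<odot> \<gamma> g)"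
      by (intro sum.cong) (simp_all add: r \<iota>_mul_basic)
    also have "\<dots> = x" by (rule grouplike_expansion[symmetric]) (rule radD(1)[OF x])
    finally show "x \<in> rad_span" .
  qed
qed

end

section \<open>The commutative case: a group of characters acting by automorphisms\<close>

context
  assumes commutative: "\<And>g h :: 'h. g * h = h * g"
begin

text \<open>On \<open>A\<close> this is \<open>id \<otimes> translate \<chi>\<close>, written by
  transposition so that no representation of \<open>x\<close> has to be chosen.\<close>

definition \<theta> :: "('h \<Rightarrow> 'k) \<Rightarrow> (('h \<Rightarrow> 'k) \<Rightarrow> 'r) \<Rightarrow> (('h \<Rightarrow> 'k) \<Rightarrow> 'r)"
  where "\<theta> \<chi> x = (\<lambda>\<phi>. if lin sH (*) \<phi> then (e \<odot> x) (conv \<phi> \<chi>) else 0)"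

lemma \<theta>_unit: "\<theta> \<chi> (e \<odot> x) = \<theta> \<chi> x"
  unfolding \<theta>_def unit_mul ..

lemma lin_\<theta>: "lin sW sW (\<theta> \<chi>)"
  by (intro linI vector_space_W) (auto simp: \<theta>_def fun_eq_iff distribs linD(4)[OF lin_mul(2)[OF lin_ident[OF vector_space_W]]]
      , simp_all add: sW_def)

lemma \<theta>_basic:
  assumes "\<chi> \<in> characters"
  shows "\<theta> \<chi> (basic a h) = basic a (translate \<chi> h)"
  unfolding \<theta>_def A_unit_left[OF basic_A] using lin_conv[OF _ characterD(1)[OF assms]]
  by (auto simp: basic_def fun_eq_iff apply_translate)

lemma translate_mult:
  assumes \<chi>: "\<chi> \<in> characters"
  shows "translate \<chi> (g * h) = translate \<chi> g * translate \<chi> h"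
proof -
  note c = characterD[OF \<chi>]
  have "translate \<chi> (g * h) = SW (\<lambda>g1 g2. SW (\<lambda>h1 h2. sH (\<chi> g2) g1 * sH (\<chi> h2) h1) h) g"
    unfolding translate_def SW_mult[OF bil_translate[OF c(1)]]
    by (simp add: c(2) scale_mult_left scale_mult_right mult.commute)
  also have "\<dots> = SW (\<lambda>g1 g2. sH (\<chi> g2) g1 * translate \<chi> h) g"
    unfolding translate_def by (intro SW_cong SW_comp[OF lin_mult(2)[OF lin_ident[OF vector_space_H]], symmetric])
  also have "\<dots> = translate \<chi> g * translate \<chi> h"
    unfolding translate_def[of \<chi> g] by (rule SW_comp[OF lin_mult(1)[OF lin_ident[OF vector_space_H]], symmetric])
  finally show ?thesis .
qed

text \<open>By \<open>SW_translate\<close> a translation reaches only the last leg of each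
  comultiplication. In the product formula these are the factors \<open>h3\<close> and
  \<open>g2\<close> of the \<open>H\<close>-component, so the action and \<open>\<sigma>\<close>
  remain untouched.\<close>

lemma \<theta>_basic_mult:
  assumes \<chi>: "\<chi> \<in> characters"
  shows "\<theta> \<chi> (basic a h \<odot> basic b g) = \<theta> \<chi> (basic a h) \<odot> \<theta> \<chi> (basic b g)"
proof -
  note c = characterD(1)[OF \<chi>]
  let ?B = "\<lambda>h1 h2 g1 x. basic (a * act h1 b * \<sigma> h2 g1) x"
  have "basic_mult a (translate \<chi> h) b (translate \<chi> g) =
      SW (\<lambda>h1 h'. SW (\<lambda>h2 h3. SW (\<lambda>g1 g2. ?B h1 h2 g1 (h3 * g2)) (translate \<chi> g)) (translate \<chi> h')) h"
    unfolding basic_mult_def by (rule SW_translate[where sW = sW, OF _ c]) (intro bilinear_mapI; intro lin_intros c)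
  also have "\<dots> = SW (\<lambda>h1 h'. SW (\<lambda>h2 h3. SW (\<lambda>g1 g2. ?B h1 h2 g1 (translate \<chi> h3 * g2)) (translate \<chi> g)) h') h"
    by (intro SW_cong SW_translate[where sW = sW, OF _ c]) (intro bilinear_mapI; intro lin_intros c)
  also have "\<dots> = SW (\<lambda>h1 h'. SW (\<lambda>h2 h3. SW (\<lambda>g1 g2. ?B h1 h2 g1 (translate \<chi> h3 * translate \<chi> g2)) g) h') h"
    by (intro SW_cong SW_translate[where sW = sW, OF _ c]) (intro bilinear_mapI; intro lin_intros c)
  also have "\<dots> = \<theta> \<chi> (basic_mult a h b g)"
    unfolding basic_mult_def by (simp add: SW_comp[OF lin_\<theta>] \<theta>_basic[OF \<chi>] translate_mult[OF \<chi>])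
  finally show ?thesis by (simp add: \<theta>_basic[OF \<chi>] basic_mul)
qed

lemma \<theta>_mult:
  assumes \<chi>: "\<chi> \<in> characters"
  shows "\<theta> \<chi> (x \<odot> y) = \<theta> \<chi> x \<odot> \<theta> \<chi> y"
proof -
  obtain xs ys where xs: "e \<odot> x = val xs" "e \<odot> y = val ys" using A_closed(1) unfolding A_eq by blast
  have \<theta>_val: "\<theta> \<chi> (val zs) = (\<Sum>(a, h)\<leftarrow>zs. \<theta> \<chi> (basic a h))" for zs
    unfolding val_def by (simp add: lin_sum_list[OF lin_\<theta>] case_prod_unfold)
  have "x \<odot> y = (\<Sum>(a, h)\<leftarrow>xs. \<Sum>(b, g)\<leftarrow>ys. basic a h \<odot> basic b g)"
  proof -
    have "x \<odot> y = (e \<odot> x) \<odot> (e \<odot> y)" by (simp add: mul_assoc mul_unit_mul unit_mul)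
    then show ?thesis unfolding xs val_mul by (simp add: basic_mul)
  qed
  then have "\<theta> \<chi> (x \<odot> y) = (\<Sum>(a, h)\<leftarrow>xs. \<Sum>(b, g)\<leftarrow>ys. \<theta> \<chi> (basic a h) \<odot> \<theta> \<chi> (basic b g))"
    by (simp add: lin_sum_list[OF lin_\<theta>] case_prod_unfold \<theta>_basic_mult[OF \<chi>])
  also have "\<dots> = \<theta> \<chi> (val xs) \<odot> \<theta> \<chi> (val ys)"
    unfolding \<theta>_val sum_list_mul case_prod_unfold by (simp add: mul_sum_list)
  finally show ?thesis by (simp add: \<theta>_unit flip: xs)
qed

lemma \<theta>_A:
  assumes \<chi>: "\<chi> \<in> characters"
  shows "\<theta> \<chi> x \<in> A"
proof -
  obtain xs where xs: "e \<odot> x = val xs" using A_closed(1) unfolding A_eq by blast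
  have "\<theta> \<chi> (val xs) \<in> A"
    unfolding val_def by (auto simp: lin_sum_list[OF lin_\<theta>] case_prod_unfold \<theta>_basic[OF \<chi>])
  then show ?thesis by (simp add: \<theta>_unit flip: xs)
qed

lemma A_induct [consumes 1, case_names basic add zero]:
  assumes "x \<in> A" "\<And>a h. P (basic a h)" "\<And>x y. P x \<Longrightarrow> P y \<Longrightarrow> P (x + y)" "P 0"
  shows "P x"
proof -
  obtain xs where "x = val xs" using assms(1) by (auto simp: A_eq)
  then show ?thesis
    by (induction xs arbitrary: x) (auto simp: val_def assms(2-))
qed

lemma \<theta>_\<theta>:
  assumes \<chi>: "\<chi> \<in> characters" and \<psi>: "\<psi> \<in> characters" and x: "x \<in> A"
  shows "\<theta> \<chi> (\<theta> \<psi> x) = \<theta> (conv \<chi> \<psi>) x"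
  using x
proof (induction x rule: A_induct)
  case (basic a h)
  then show ?case
    by (simp add: \<theta>_basic \<chi> \<psi> conv_character translate_translate characterD(1))
qed (simp_all only: linD(3)[OF lin_\<theta>] lin_zero[OF lin_\<theta>])

lemma \<theta>_counit:
  assumes "x \<in> A"
  shows "\<theta> \<epsilon> x = x"
  using assms
  by (induction x rule: A_induct)
    (simp_all only: \<theta>_basic[OF counit_character] translate_counit linD(3)[OF lin_\<theta>] lin_zero[OF lin_\<theta>])

lemma \<theta>_\<iota>:
  assumes \<chi>: "\<chi> \<in> characters"
  shows "\<theta> \<chi> (\<iota> r) = \<iota> r"
proof -
  have "translate \<chi> 1 = 1"
    unfolding translate_def SW_one[OF bil_translate[OF characterD(1)[OF \<chi>]]] by (simp add: characterD(3)[OF \<chi>])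
  then show ?thesis by (simp add: \<theta>_basic[OF \<chi>])
qed

lemma \<theta>_surj:
  assumes \<chi>: "\<chi> \<in> characters" and y: "y \<in> A"
  shows "\<exists>x. \<theta> \<chi> x = y"
proof -
  obtain \<psi> where \<psi>: "\<psi> \<in> characters" "conv \<chi> \<psi> = \<epsilon>" by (rule character_inverse[OF \<chi>])
  then have "\<theta> \<chi> (\<theta> \<psi> y) = y" by (simp add: \<theta>_\<theta>[OF \<chi> \<psi>(1) y] \<theta>_counit[OF y])
  then show ?thesis by blast
qed

lemma \<theta>_rad:
  assumes \<chi>: "\<chi> \<in> characters" and x: "x \<in> rad"
  shows "\<theta> \<chi> x \<in> rad"
  unfolding rad_def
proof (intro CollectI conjI allI \<theta>_A[OF \<chi>])
  fix a
  obtain b where b: "\<theta> \<chi> b = e \<odot> a" using \<theta>_surj[OF \<chi>, of "e \<odot> a"] by auto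
  obtain u where u: "u \<odot> (e - b \<odot> x) = e" using x by (auto simp: rad_def)
  have "\<theta> \<chi> u \<odot> (e - a \<odot> \<theta> \<chi> x) = \<theta> \<chi> u \<odot> (\<theta> \<chi> e - \<theta> \<chi> b \<odot> \<theta> \<chi> x)"
    using \<theta>_\<iota>[OF \<chi>, of 1] by (simp add: b mul_assoc unit_mul)
  also have "\<dots> = \<theta> \<chi> e" by (simp add: u flip: \<theta>_mult[OF \<chi>] lin_diff[OF lin_\<theta>])
  finally show "\<exists>u. u \<odot> (e - a \<odot> \<theta> \<chi> x) = e" using \<theta>_\<iota>[OF \<chi>, of 1] by auto
qed

lemma trace_in_base: "\<exists>r. (\<Sum>\<chi>\<in>characters. \<theta> \<chi> x) = \<iota> r"
proof -
  have "\<exists>r. (\<Sum>\<chi>\<in>characters. \<theta> \<chi> x) = \<iota> r" if "x \<in> A" for x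
    using that
  proof (induction x rule: A_induct)
    case (basic a h)
    have "(\<Sum>\<chi>\<in>characters. \<theta> \<chi> (basic a h)) = (\<Sum>\<chi>\<in>characters. basic a (translate \<chi> h))"
      by (intro sum.cong) (simp_all add: \<theta>_basic)
    also have "\<dots> = basic a (sH (\<Sum>\<chi>\<in>characters. \<chi> h) 1)"
      by (simp add: sum_translate_characters[OF commutative] flip: lin_sum[OF bilinear_mapD(2)[OF bil_basic]])
    also have "\<dots> = \<iota> (sR (\<Sum>\<chi>\<in>characters. \<chi> h) a)"
      by (simp add: basic_scale linD(4)[OF bilinear_mapD(2)[OF bil_basic]])
    finally show ?case ..
  next
    case (add x y)
    then obtain r s where "(\<Sum>\<chi>\<in>characters. \<theta> \<chi> x) = \<iota> r" "(\<Sum>\<chi>\<in>characters. \<theta> \<chi> y) = \<iota> s" by blast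
    then have "(\<Sum>\<chi>\<in>characters. \<theta> \<chi> (x + y)) = \<iota> (r + s)"
      by (simp add: linD(3)[OF lin_\<theta>] sum.distrib \<iota>_add)
    then show ?case ..
  next
    case zero
    have "(\<Sum>\<chi>\<in>characters. \<theta> \<chi> 0) = \<iota> 0"
      by (simp only: lin_zero[OF lin_\<theta>] sum.neutral_const \<iota>_zero)
    then show ?case ..
  qed
  from this[of "e \<odot> x"] show ?thesis by (simp add: \<theta>_unit)
qed

lemma base_radical_commutative:
  assumes "x \<in> regular.rad"
  shows "\<iota> x \<in> rad"
proof -
  let ?k = "\<iota> (sR (inverse (of_nat (card characters))) 1)"
  note n = characters_finite card_characters_nonzero[OF commutative]
  have avg: "\<exists>r. ?k \<odot> (\<Sum>\<chi>\<in>characters. \<theta> \<chi> x) = \<iota> r" for x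
  proof -
    obtain r where "(\<Sum>\<chi>\<in>characters. \<theta> \<chi> x) = \<iota> r" using trace_in_base by blast
    then show ?thesis by (metis \<iota>_mult)
  qed
  show ?thesis
    by (rule fixed_ring_radical[of characters \<theta> ?k])
      (rule n \<theta>_mult \<theta>_surj \<theta>_\<iota> average[OF n] avg assms; assumption)+
qed

text \<open>
  The elements \<open>\<kappa>(t\<^sub>1)\<close> and \<open>\<gamma>(t\<^sub>2)\<close>, for an integral \<open>t\<close>, are Galois coordinates of \<open>A\<close> over \<open>R\<close>: \<open>\<kappa>\<close>
  is a left convolution inverse of \<open>\<gamma>\<close>, and characters other than \<open>\<epsilon>\<close> vanish on \<open>t\<close>.
\<close>

lemma galois_coordinates:
  "\<exists>\<kappa>. \<forall>t z. (\<forall>h. h * t = sH (\<epsilon> h) t) \<longrightarrow> \<epsilon> t = 1 \<longrightarrow> z \<in> A \<longrightarrow>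
    z = SW (\<lambda>t1 t2. (\<Sum>\<chi>\<in>characters. \<theta> \<chi> (z \<odot> \<kappa> t1)) \<odot> \<gamma> t2) t"
proof -
  obtain \<tau> where b: "bilinear_map sH sH sR \<tau>"
    and \<tau>: "\<And>h g. SW (\<lambda>h1 h2. SW (\<lambda>g1 g2. \<sigma> h1 g1 * \<tau> h2 g2) g) h = sR (\<epsilon> h * \<epsilon> g) 1"
      "\<And>h g. SW (\<lambda>h1 h2. SW (\<lambda>g1 g2. \<tau> h1 g1 * \<sigma> h2 g2) g) h = sR (\<epsilon> h * \<epsilon> g) 1"
      "\<And>h g r. act h (act g r) = SW (\<lambda>h1 h'. SW (\<lambda>h2 h3. SW (\<lambda>g1 g'. SW (\<lambda>g2 g3.
        \<sigma> h1 g1 * act (h2 * g2) r * \<tau> h3 g3) g') g) h') h"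
    by (rule twisted_inverse) (rule that)
  note [lin_intros] = bilinear_lin[OF b]
  have sWv: "lin sW sW (sW c)" for c by (rule lin_scale_fun[OF lin_ident[OF vector_space_W]])
  have left: "lin sW sW (\<lambda>x. y \<odot> x)" and right: "lin sW sW (\<lambda>x. x \<odot> y)" for y
    by (intro lin_intros)+
  \<comment> \<open>The product rule for \<open>\<gamma>\<close> solved for
    \<open>\<gamma>(h g)\<close>: the swaps and coassociativity steps bring \<open>\<tau>\<close>
    next to the \<open>\<sigma>\<close> hidden in \<open>\<gamma> h2 \<odot> \<gamma> g2\<close>,
    where the two cancel.\<close>
  have \<gamma>_product: "SW (\<lambda>h1 h2. SW (\<lambda>g1 g2. \<iota> (\<tau> h1 g1) \<odot> (\<gamma> h2 \<odot> \<gamma> g2)) g) h = \<gamma> (h * g)" for h g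
  proof -
    define K where "K h1 g1 a c b d = basic (\<tau> h1 g1 * \<sigma> a c) (b * d)" for h1 g1 a c b d
    have "SW (\<lambda>h1 h2. SW (\<lambda>g1 g2. \<iota> (\<tau> h1 g1) \<odot> (\<gamma> h2 \<odot> \<gamma> g2)) g) h =
        SW (\<lambda>h1 h2. SW (\<lambda>g1 g2. SW (\<lambda>a b. SW (\<lambda>c d. K h1 g1 a c b d) g2) h2) g) h"
      unfolding \<gamma>_mul_\<gamma> K_def by (simp add: SW_comp[OF left] \<iota>_mul_basic)
    also have "\<dots> = SW (\<lambda>h1 h2. SW (\<lambda>a b. SW (\<lambda>g1 g2. SW (\<lambda>c d. K h1 g1 a c b d) g2) g) h2) h"
      by (intro SW_cong SW_swap)
    also have "\<dots> = SW (\<lambda>h1 h2. SW (\<lambda>a b. SW (\<lambda>g' d. SW (\<lambda>g1 c. K h1 g1 a c b d) g') g) h2) h"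
      unfolding K_def by (intro SW_cong SW_coassoc[where sW = sW, symmetric]; intro lin_intros)
    also have "\<dots> = SW (\<lambda>h' b. SW (\<lambda>h1 a. SW (\<lambda>g' d. SW (\<lambda>g1 c. K h1 g1 a c b d) g') g) h') h"
      unfolding K_def by (rule SW_coassoc[where sW = sW, symmetric]; intro lin_intros)
    also have "\<dots> = SW (\<lambda>h' b. SW (\<lambda>g' d. SW (\<lambda>h1 a. SW (\<lambda>g1 c. K h1 g1 a c b d) g') h') g) h"
      by (intro SW_cong SW_swap)
    also have "\<dots> = SW (\<lambda>h' b. SW (\<lambda>g' d. sW (\<epsilon> h') (sW (\<epsilon> g') (\<gamma> (b * d)))) g) h"
    proof (intro SW_cong)
      fix h' b g' d
      have lin: "lin sR sW (\<lambda>r. basic r (b * d))" by (rule bilinear_mapD(1)[OF bil_basic])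
      have "SW (\<lambda>h1 a. SW (\<lambda>g1 c. K h1 g1 a c b d) g') h' = basic (sR (\<epsilon> h' * \<epsilon> g') 1) (b * d)"
        unfolding K_def \<tau>(2)[symmetric] by (simp add: SW_comp[OF lin])
      then show "SW (\<lambda>h1 a. SW (\<lambda>g1 c. K h1 g1 a c b d) g') h' = sW (\<epsilon> h') (sW (\<epsilon> g') (\<gamma> (b * d)))"
        by (simp add: basic_scale flip: R.scale_scale)
    qed
    also have "\<dots> = SW (\<lambda>h' b. sW (\<epsilon> h') (SW (\<lambda>g' d. sW (\<epsilon> g') (\<gamma> (b * d))) g)) h"
      by (simp add: SW_comp[OF sWv])
    also have "\<dots> = SW (\<lambda>g' d. sW (\<epsilon> g') (\<gamma> (h * d))) g"
      by (rule SW_counit_left) (intro lin_intros)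
    also have "\<dots> = \<gamma> (h * g)"
      by (rule SW_counit_left) (intro lin_intros)
    finally show ?thesis .
  qed
  \<comment> \<open>The usual inverse \<open>\<tau>(S(x2), x3) # S(x1)\<close> for a cleft
    extension, written with the comultiplication of \<open>S x1\<close> in place of the
    anticomultiplicativity of \<open>S\<close>.\<close>
  define \<kappa> where "\<kappa> x = SW (\<lambda>x1 x2. SW (\<lambda>y1 y2. \<iota> (\<tau> y1 x2) \<odot> \<gamma> y2) (S x1)) x" for x
  have lin_\<kappa>: "lin s sH f \<Longrightarrow> lin s sW (\<lambda>x. \<kappa> (f x))" for s and f :: "'z::ab_group_add \<Rightarrow> 'h"
    unfolding \<kappa>_def by (intro lin_intros)
  have \<kappa>_\<gamma>: "SW (\<lambda>x1 x2. \<kappa> x1 \<odot> \<gamma> x2) x = sW (\<epsilon> x) e" for x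
  proof -
    have "SW (\<lambda>x1 x2. \<kappa> x1 \<odot> \<gamma> x2) x =
        SW (\<lambda>x1 x2. SW (\<lambda>p q. SW (\<lambda>y1 y2. \<iota> (\<tau> y1 q) \<odot> (\<gamma> y2 \<odot> \<gamma> x2)) (S p)) x1) x"
      unfolding \<kappa>_def by (simp add: SW_comp[OF right] mul_assoc)
    also have "\<dots> = SW (\<lambda>p x'. SW (\<lambda>q x2. SW (\<lambda>y1 y2. \<iota> (\<tau> y1 q) \<odot> (\<gamma> y2 \<odot> \<gamma> x2)) (S p)) x') x"
      by (rule SW_coassoc[where sW = sW]; intro lin_intros)
    also have "\<dots> = SW (\<lambda>p x'. \<gamma> (S p * x')) x"
    proof (rule SW_cong)
      fix p x'
      show "SW (\<lambda>q x2. SW (\<lambda>y1 y2. \<iota> (\<tau> y1 q) \<odot> (\<gamma> y2 \<odot> \<gamma> x2)) (S p)) x' = \<gamma> (S p * x')"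
        by (subst SW_swap) (rule \<gamma>_product)
    qed
    also have "\<dots> = sW (\<epsilon> x) e"
      by (rule SW_antipode_left) (intro lin_intros)
    finally show ?thesis .
  qed
  show ?thesis
  proof (intro exI[of _ \<kappa>] allI impI)
    fix t z assume "\<forall>h. h * t = sH (\<epsilon> h) t" "\<epsilon> t = 1" and z: "z \<in> A"
    then have t: "\<And>h. h * t = sH (\<epsilon> h) t" "\<epsilon> t = 1" by simp_all
    have coord: "SW (\<lambda>t1 t2. \<theta> \<chi> (\<kappa> t1) \<odot> \<gamma> t2) t = (if \<chi> = \<epsilon> then e else 0)" if \<chi>: "\<chi> \<in> characters" for \<chi>
    proof -
      obtain \<psi> where \<psi>: "\<psi> \<in> characters" "conv \<chi> \<psi> = \<epsilon>" by (rule character_inverse[OF \<chi>])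
      note c = characterD(1)[OF \<psi>(1)]
      interpret W: vector_space sW by (rule vector_space_W)
      \<comment> \<open>With \<open>\<psi>\<close> inverse to \<open>\<chi>\<close>, the factor
        \<open>\<gamma> t2\<close> becomes a value of \<open>\<theta> \<chi>\<close>, which can then
        be taken out of the sum. The translation by \<open>\<psi>\<close> passes to
        \<open>t\<close>, and \<open>\<kappa>_\<gamma>\<close> leaves the scalar
        \<open>\<psi> t\<close>.\<close>
      have eq: "\<theta> \<chi> (\<gamma> (translate \<psi> t2)) = \<gamma> t2" for t2
        by (simp add: \<theta>_basic[OF \<chi>] translate_translate c characterD(1)[OF \<chi>] \<psi>(2) translate_counit)
      have "SW (\<lambda>t1 t2. \<theta> \<chi> (\<kappa> t1) \<odot> \<gamma> t2) t = \<theta> \<chi> (SW (\<lambda>t1 t2. \<kappa> t1 \<odot> \<gamma> (translate \<psi> t2)) t)"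
        by (simp add: SW_comp[OF lin_\<theta>] \<theta>_mult[OF \<chi>] eq)
      also have "SW (\<lambda>t1 t2. \<kappa> t1 \<odot> \<gamma> (translate \<psi> t2)) t = SW (\<lambda>t1 t2. \<kappa> t1 \<odot> \<gamma> t2) (translate \<psi> t)"
        by (rule SW_translate[where sW = sW, OF _ c, symmetric]) (intro bilinear_mapI; intro lin_intros lin_\<kappa>)
      also have "\<dots> = sW (\<psi> t) e"
        by (simp add: \<kappa>_\<gamma> apply_translate conv_counit(2)[OF c])
      also have "\<theta> \<chi> (sW (\<psi> t) e) = sW (\<psi> t) e"
        using \<theta>_\<iota>[OF \<chi>, of 1] by (simp add: linD(4)[OF lin_\<theta>])
      also have "\<psi> t = (if \<chi> = \<epsilon> then 1 else 0)"
      proof -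
        have "\<psi> = \<epsilon> \<longleftrightarrow> \<chi> = \<epsilon>"
          using \<psi>(2) conv_counit(1)[OF characterD(1)[OF \<chi>]] conv_counit(2)[OF c] by auto
        then show ?thesis using character_integral[OF t \<psi>(1)] by simp
      qed
      finally show ?thesis by (simp add: zero_fun_def)
    qed
    have "SW (\<lambda>t1 t2. (\<Sum>\<chi>\<in>characters. \<theta> \<chi> (z \<odot> \<kappa> t1)) \<odot> \<gamma> t2) t =
        (\<Sum>\<chi>\<in>characters. SW (\<lambda>t1 t2. \<theta> \<chi> (z \<odot> \<kappa> t1) \<odot> \<gamma> t2) t)"
      by (simp add: sum_mul SW_sum)
    also have "\<dots> = (\<Sum>\<chi>\<in>characters. \<theta> \<chi> z \<odot> SW (\<lambda>t1 t2. \<theta> \<chi> (\<kappa> t1) \<odot> \<gamma> t2) t)"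
      by (intro sum.cong) (simp_all add: SW_comp[OF left] \<theta>_mult mul_assoc)
    also have "\<dots> = (\<Sum>\<chi>\<in>characters. if \<chi> = \<epsilon> then z else 0)"
      using z \<theta>_A by (intro sum.cong) (simp_all add: coord \<theta>_counit)
    also have "\<dots> = z" using characters_finite counit_character by simp
    finally show "z = SW (\<lambda>t1 t2. (\<Sum>\<chi>\<in>characters. \<theta> \<chi> (z \<odot> \<kappa> t1)) \<odot> \<gamma> t2) t" ..
  qed
qed

lemma radical_commutative: "rad \<subseteq> rad_span"
proof
  fix x assume x: "x \<in> rad"
  obtain t where t: "\<And>h. h * t = sH (\<epsilon> h) t" "\<epsilon> t = 1"
    using integral_exists[OF semisimple] by blast
  obtain \<kappa> where \<kappa>: "x = SW (\<lambda>t1 t2. (\<Sum>\<chi>\<in>characters. \<theta> \<chi> (x \<odot> \<kappa> t1)) \<odot> \<gamma> t2) t"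
    using galois_coordinates t radD(1)[OF x] by blast
  have term_in: "(\<Sum>\<chi>\<in>characters. \<theta> \<chi> (x \<odot> y)) \<odot> \<gamma> h \<in> rad_span" for y h
  proof -
    obtain r where r: "(\<Sum>\<chi>\<in>characters. \<theta> \<chi> (x \<odot> y)) = \<iota> r" using trace_in_base by blast
    have "(\<Sum>\<chi>\<in>characters. \<theta> \<chi> (x \<odot> y)) \<in> rad"
      using rad_mul_right[OF x] \<theta>_rad by (intro lideal_sum[OF lideal_rad]) auto
    then have "r \<in> regular.rad" unfolding r by (rule base_mem_radical)
    then show ?thesis unfolding r by (simp add: \<iota>_mul_basic rad_span_basic)
  qed
  have "SW (\<lambda>t1 t2. (\<Sum>\<chi>\<in>characters. \<theta> \<chi> (x \<odot> \<kappa> t1)) \<odot> \<gamma> t2) t \<in> rad_span"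
    unfolding SW_def case_prod_unfold by (intro rad_span_sum_list term_in)
  then show "x \<in> rad_span" by (simp only: \<kappa>[symmetric])
qed

end

section \<open>Irreducible modules\<close>

lemma rad_span_base: "x \<in> rad_span \<Longrightarrow> x \<epsilon> \<in> regular.rad"
proof -
  assume "x \<in> rad_span"
  then obtain xs where xs: "x = val xs" "set xs \<subseteq> regular.rad \<times> UNIV" by (auto simp: rad_span_def)
  have "(\<Sum>(a, h)\<leftarrow>xs. sR (\<epsilon> h) a) \<in> regular.rad"
  proof (rule regular.lideal_sum_list[OF regular.lideal_rad])
    fix p assume "p \<in> set xs"
    moreover obtain a h where p: "p = (a, h)" by (cases p)
    ultimately have "a \<in> regular.rad" using xs(2) by auto
    then have "sR (\<epsilon> h) 1 * a \<in> regular.rad" by (rule regular.radD(4))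
    then show "(case p of (a, h) \<Rightarrow> sR (\<epsilon> h) a) \<in> regular.rad" by (simp add: p sR_one)
  qed
  then show ?thesis by (simp add: xs val_apply)
qed

text \<open>A module \<open>A / L\<close>, for a maximal left ideal \<open>L\<close>, is realised on a complement of \<open>L\<close> in \<open>A\<close>.\<close>

lemma quotient_annihilated:
  assumes L: "max_lideal L" and a: "a \<in> H_jacobson_radical sH \<Delta> sR act \<sigma>"
  shows "\<iota> a \<in> L"
proof -
  interpret W: vector_space sW by (rule vector_space_W)
  note L' = lidealD[OF max_lideal_lideal[OF L]]
  have "W.subspace L"
  proof (rule W.subspaceI)
    show "sW c x \<in> L" if "x \<in> L" for c x
      using L'(1,4)[OF that] by (simp add: sW_eq_mul)
  qed (use L' in auto)
  then obtain P where P: "lin sW sW P" "\<And>x. P x \<in> L" "\<And>x. x \<in> L \<Longrightarrow> P x = x"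
    by (rule W.projection_exists) (rule that)
  \<comment> \<open>The quotient map by \<open>L\<close>, realised on a linear complement.
    Multiplying and then applying \<open>q\<close> is an action because \<open>L\<close> absorbs
    left multiplication; this is \<open>q_q\<close>.\<close>
  define q where "q x = x - P x" for x
  have lin_q: "lin sW sW q"
    by (intro linI vector_space_W)
      (simp_all add: q_def linD(3,4)[OF P(1)] W.scale_right_diff_distrib del: minus_apply plus_fun_apply)
  note q_add = linD(3)[OF lin_q] and q_scale = linD(4)[OF lin_q] and q_diff = lin_diff[OF lin_q]
  have q_0: "q x = 0" if "x \<in> L" for x using P(3)[OF that] by (simp add: q_def)
  have q_L: "q x = 0 \<Longrightarrow> x \<in> L" for x using P(2)[of x] by (simp add: q_def)
  have q_A: "q x \<in> A" if "x \<in> A" for x using that L'(1)[OF P(2)] by (simp add: q_def)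
  have q_q: "q (y \<odot> q x) = q (y \<odot> x)" for x y
  proof -
    have "y \<odot> x = y \<odot> q x + y \<odot> P x" by (simp add: q_def distribs)
    then have "q (y \<odot> x) = q (y \<odot> q x) + q (y \<odot> P x)" by (simp only: q_add)
    then show ?thesis using q_0[OF L'(4)[OF P(2)], of y x] by simp
  qed
  have qq: "q (q x) = q x" if "x \<in> A" for x
    using q_q[of e x] q_A[OF that] that by simp
  define M where "M = q ` A"
  have M: "m \<in> A" "q m = m" if "m \<in> M" for m using that q_A qq by (auto simp: M_def)
  have q_M: "q (x \<odot> y) \<in> M" for x y unfolding M_def by (intro imageI A_closed)
  define rmul where "rmul b m = q (\<iota> b \<odot> m)" for b m
  define hmul where "hmul h m = q (\<gamma> h \<odot> m)" for h m
  have SW_q: "q (SW f h \<odot> m) = SW (\<lambda>x y. q (f x y \<odot> m)) h" for f h m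
    by (simp add: SW_comp[OF lin_comp[OF lin_q lin_mul(1)[OF lin_ident[OF vector_space_W]]]])
  interpret RH: RH_module sH \<Delta> sR act \<sigma> sW M rmul hmul
  proof unfold_locales
    have A: "W.subspace A" unfolding A_eq by (rule subspace_val)
    show "W.subspace M"
      unfolding M_def
    proof (rule W.subspaceI)
      show "0 \<in> q ` A" by (rule image_eqI[of _ _ 0]) (simp_all only: lin_zero[OF lin_q] A_closed)
      show "x + y \<in> q ` A" if xy: "x \<in> q ` A" "y \<in> q ` A" for x y
      proof -
        obtain u v where uv: "u \<in> A" "v \<in> A" "x = q u" "y = q v" using xy by blast
        show ?thesis by (rule image_eqI[of _ _ "u + v"]) (simp_all only: uv q_add A_closed)
      qed
      show "sW c x \<in> q ` A" if x: "x \<in> q ` A" for c x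
      proof -
        obtain u where u: "u \<in> A" "x = q u" using x by blast
        show ?thesis
          by (rule image_eqI[of _ _ "sW c u"]) (simp_all only: u q_scale W.subspace_scale[OF A])
      qed
    qed
    note b = bilinear_mapD[OF bil_basic]
    fix m n a b c h g assume m: "m \<in> M"
    show "rmul a m \<in> M" "hmul h m \<in> M" by (simp_all add: rmul_def hmul_def q_M)
    show "rmul (a + b) m = rmul a m + rmul b m"
      unfolding rmul_def by (simp only: \<iota>_add distribs q_add)
    show "hmul (h + g) m = hmul h m + hmul g m"
      unfolding hmul_def by (simp only: linD(3)[OF \<open>\<And>u. lin sH sW (basic u)\<close>] distribs q_add)
    show "rmul a (sW c m) = sW c (rmul a m)" "hmul h (sW c m) = sW c (hmul h m)"
      unfolding rmul_def hmul_def by (simp_all only: linD(4)[OF lin_mul(2)[OF lin_ident[OF vector_space_W]]] q_scale)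
    show "rmul (sR c a) m = sW c (rmul a m)"
      unfolding rmul_def by (simp only: basic_scale linD(4)[OF lin_mul(1)[OF lin_ident[OF vector_space_W]]] q_scale)
    show "hmul (sH c h) m = sW c (hmul h m)"
      unfolding hmul_def by (simp only: linD(4)[OF \<open>\<And>u. lin sH sW (basic u)\<close>] linD(4)[OF lin_mul(1)[OF lin_ident[OF vector_space_W]]] q_scale)
    show "rmul (a * b) m = rmul a (rmul b m)"
      unfolding rmul_def by (simp only: \<iota>_mult mul_assoc q_q)
    show "hmul 1 m = m" unfolding hmul_def using M[OF m] by simp
    show "hmul h (rmul a m) = (\<Sum>(h1, h2)\<leftarrow>sweedler \<Delta> h. rmul (act h1 a) (hmul h2 m))"
    proof -
      have "hmul h (rmul a m) = q ((\<gamma> h \<odot> \<iota> a) \<odot> m)"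
        unfolding hmul_def rmul_def by (simp only: q_q mul_assoc)
      also have "\<dots> = SW (\<lambda>h1 h2. q (\<iota> (act h1 a) \<odot> (\<gamma> h2 \<odot> m))) h"
        unfolding \<gamma>_mul_\<iota> SW_q by (simp add: \<iota>_mul_basic flip: mul_assoc)
      finally show ?thesis by (simp add: SW_def rmul_def hmul_def q_q)
    qed
    show "hmul h (hmul g m) = (\<Sum>(h1, h2)\<leftarrow>sweedler \<Delta> h. \<Sum>(g1, g2)\<leftarrow>sweedler \<Delta> g.
        rmul (\<sigma> h1 g1) (hmul (h2 * g2) m))"
    proof -
      have "hmul h (hmul g m) = q ((\<gamma> h \<odot> \<gamma> g) \<odot> m)"
        unfolding hmul_def by (simp only: q_q mul_assoc)
      also have "\<dots> = SW (\<lambda>h1 h2. SW (\<lambda>g1 g2. q (\<iota> (\<sigma> h1 g1) \<odot> (\<gamma> (h2 * g2) \<odot> m))) g) h"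
        unfolding \<gamma>_mul_\<gamma> SW_q by (simp add: \<iota>_mul_basic flip: mul_assoc)
      finally show ?thesis by (simp add: SW_def rmul_def hmul_def q_q)
    qed
    assume n: "n \<in> M"
    show "rmul a (m + n) = rmul a m + rmul a n" "hmul h (m + n) = hmul h m + hmul h n"
      unfolding rmul_def hmul_def by (simp_all only: distribs q_add)
  qed
  have e_L: "e \<notin> L" using L by (simp add: max_lideal_def)
  have "RH_irreducible sH \<Delta> sR act \<sigma> sW M rmul hmul"
  proof
    have "rmul 1 (q e) = q e" unfolding rmul_def by (simp add: q_q)
    moreover have "q e \<noteq> 0" using q_L e_L by blast
    moreover have "q e \<in> M" by (simp add: M_def)
    ultimately show "\<exists>a. \<exists>m\<in>M. rmul a m \<noteq> 0" by metis
  next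
    fix N assume "RH.RH_submodule N"
    then have N: "W.subspace N" "N \<subseteq> M" "\<And>a m. m \<in> N \<Longrightarrow> rmul a m \<in> N" "\<And>h m. m \<in> N \<Longrightarrow> hmul h m \<in> N"
      by (auto simp: RH.RH_submodule_def)
    \<comment> \<open>The preimage of a submodule is a left ideal between \<open>L\<close> and
      \<open>A\<close>, so maximality of \<open>L\<close> leaves only the two extremes.\<close>
    define J where "J = {x \<in> A. q x \<in> N}"
    have J: "lideal J"
      unfolding lideal_def
    proof (intro conjI ballI allI)
      show "0 \<in> J" using lin_zero[OF lin_q] W.subspace_0[OF N(1)] unfolding J_def by simp
      fix x y b assume x: "x \<in> J"
      then have qx: "q x \<in> N" "x \<in> A" by (simp_all add: J_def)
      show "x + y \<in> J" if "y \<in> J"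
        using x that W.subspace_add[OF N(1)] unfolding J_def by (simp add: q_add del: plus_fun_apply)
      obtain xs where xs: "e \<odot> b = val xs" using A_closed(1)[of e b] unfolding A_eq by blast
      have "b \<odot> x = e \<odot> b \<odot> x" using qx(2) by (simp add: mul_assoc unit_mul)
      then have "q (b \<odot> x) = (\<Sum>(a, h)\<leftarrow>xs. q (basic a h \<odot> x))"
        by (simp add: xs val_def sum_list_mul lin_sum_list[OF lin_q] case_prod_unfold)
      also have "\<dots> = (\<Sum>(a, h)\<leftarrow>xs. rmul a (hmul h (q x)))"
        by (simp add: rmul_def hmul_def q_q \<iota>_mul_basic flip: mul_assoc)
      also have "\<dots> \<in> N"
        using N(3,4) qx(1) by (induction xs) (auto intro: W.subspace_0[OF N(1)] W.subspace_add[OF N(1)])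
      finally show "b \<odot> x \<in> J" by (simp add: J_def)
    qed (simp add: J_def)
    have "L \<subseteq> J" using L'(1) q_0 W.subspace_0[OF N(1)] by (auto simp: J_def)
    then have "J = L \<or> e \<in> J" using L J unfolding max_lideal_def by blast
    then show "N = {0} \<or> N = M"
    proof
      assume JL: "J = L"
      have "n = 0" if n: "n \<in> N" for n
      proof -
        have "n \<in> J" using n N(2) M[of n] by (auto simp: J_def)
        then have "q n = 0" using JL q_0 by blast
        then show ?thesis using M(2)[of n] N(2) n by auto
      qed
      then show ?thesis using W.subspace_0[OF N(1)] by blast
    next
      assume "e \<in> J"
      then have "J = A" using lideal_eq_A[OF J] by blast
      then have "M \<subseteq> N" by (auto simp: M_def J_def)
      then show ?thesis using N(2) by blast
    qed
  qed
  then have "rmul a (q e) = 0"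
    by (rule H_jacobson_radical_annihilates) (use a in \<open>simp_all add: M_def\<close>)
  then show ?thesis using q_L unfolding rmul_def by (simp add: q_q)
qed

text \<open>Conversely, an \<open>R\<close>-\<open>H\<close>-module is a module over the crossed product, by \<open>(a # h) m = a (h m)\<close>.\<close>

lemma irreducible_annihilated:
  assumes "RH_irreducible sH \<Delta> sR act \<sigma> sM M rmul hmul"
    and x: "\<iota> x \<in> rad" and m: "m \<in> M"
  shows "rmul x m = 0"
proof (rule ccontr)
  assume ne: "rmul x m \<noteq> 0"
  interpret M: RH_irreducible sH \<Delta> sR act \<sigma> sM M rmul hmul by fact
  have Mv: "vector_space sM" by (rule M.vector_space_axioms)
  define ev where "ev xs m = (\<Sum>(a, h)\<leftarrow>xs. rmul a (hmul h m))" for xs m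
  note MM = M.rmul_closed M.hmul_closed
  have zero: "0 \<in> M" using M.subspace_0[OF M.subspace_M] .
  have plus: "m + n \<in> M" if "m \<in> M" "n \<in> M" for m n using M.subspace_add[OF M.subspace_M that] .
  have sum_M: "sum_list (map f xs) \<in> M" if "\<And>i. i \<in> set xs \<Longrightarrow> f i \<in> M" for f and xs :: "'z list"
    using that by (induction xs) (auto intro: zero plus)
  have ev_M: "ev xs m \<in> M" if "m \<in> M" for xs m
    unfolding ev_def using that MM by (intro sum_M) auto
  have rmul_0: "rmul a 0 = 0" and hmul_0: "hmul h 0 = 0" for a h
    using M.rmul_add_right[OF zero zero] M.hmul_add_right[OF zero zero] by simp_all
  have rmul_sum: "rmul a (sum_list (map f xs)) = (\<Sum>i\<leftarrow>xs. rmul a (f i))"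
    if "\<And>i. i \<in> set xs \<Longrightarrow> f i \<in> M" for a f and xs :: "'z list"
    using that by (induction xs) (auto simp: rmul_0 M.rmul_add_right sum_M)
  have hmul_sum: "hmul a (sum_list (map f xs)) = (\<Sum>i\<leftarrow>xs. hmul a (f i))"
    if "\<And>i. i \<in> set xs \<Longrightarrow> f i \<in> M" for a f and xs :: "'z list"
    using that by (induction xs) (auto simp: hmul_0 M.hmul_add_right sum_M)
  have bil: "bilinear_map sR sH sM (\<lambda>a h. rmul a (hmul h m))" if "m \<in> M" for m
    using that by (intro bilinear_mapI linI vector_space_R vector_space_H Mv)
      (simp_all add: MM M.rmul_add_left M.rmul_scale_left M.rmul_add_right M.rmul_scale_right
        M.hmul_add_left M.hmul_scale_left)
  have ev_cong: "ev xs m = ev ys m" if "val xs = val ys" "m \<in> M" for xs ys m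
    unfolding ev_def using that by (intro tensor_sum_cong[OF bil]) (simp_all add: val_eq_iff)
  \<comment> \<open>The product is formed on lists, so that its effect on \<open>M\<close> can be
    computed from the module axioms; \<open>ev_cong\<close> then passes to elements of
    \<open>A\<close>.\<close>
  define mult_list where "mult_list xs ys = [(a * act h1 b * \<sigma> h2 g1, h3 * g2).
         (a, h) \<leftarrow> xs, (b, g) \<leftarrow> ys, (h1, h2, h3) \<leftarrow> sweedler3 \<Delta> h, (g1, g2) \<leftarrow> sweedler \<Delta> g]" for xs ys
  have val_mult: "val (mult_list xs ys) = val xs \<odot> val ys" for xs ys
    unfolding val_mul
    by (simp add: mult_list_def val_def basic_mult_def SW_def sweedler3_def sum_list_concat_map case_prod_unfold o_def)
  have ev_mult: "ev (mult_list xs ys) m = ev xs (ev ys m)" if m: "m \<in> M" for xs ys m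
  proof -
    have "rmul a (hmul h (rmul b (hmul g m))) =
      SW (\<lambda>h1 h'. SW (\<lambda>h2 h3. SW (\<lambda>g1 g2. rmul (a * act h1 b * \<sigma> h2 g1) (hmul (h3 * g2) m)) g) h') h" for a h b g
    proof -
      have "rmul a (hmul h (rmul b (hmul g m))) = SW (\<lambda>h1 h'. rmul a (rmul (act h1 b) (hmul h' (hmul g m)))) h"
        unfolding SW_def case_prod_unfold
        by (subst M.hmul_rmul) (auto simp: m MM case_prod_unfold rmul_sum)
      also have "\<dots> = SW (\<lambda>h1 h'. rmul (a * act h1 b)
          (SW (\<lambda>h2 h3. SW (\<lambda>g1 g2. rmul (\<sigma> h2 g1) (hmul (h3 * g2) m)) g) h')) h"
      proof (rule SW_cong)
        fix h1 h'
        have z: "hmul h' (hmul g m) = SW (\<lambda>h2 h3. SW (\<lambda>g1 g2. rmul (\<sigma> h2 g1) (hmul (h3 * g2) m)) g) h'"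
          by (simp only: M.hmul_hmul[OF m] SW_def)
        show "rmul a (rmul (act h1 b) (hmul h' (hmul g m))) = rmul (a * act h1 b)
          (SW (\<lambda>h2 h3. SW (\<lambda>g1 g2. rmul (\<sigma> h2 g1) (hmul (h3 * g2) m)) g) h')"
          unfolding z[symmetric] by (rule M.rmul_mult[symmetric]) (intro MM m)
      qed
      also have "\<dots> = SW (\<lambda>h1 h'. SW (\<lambda>h2 h3. SW (\<lambda>g1 g2. rmul (a * act h1 b * \<sigma> h2 g1) (hmul (h3 * g2) m)) g) h') h"
        unfolding SW_def case_prod_unfold
        by (simp add: rmul_sum sum_M m MM M.rmul_mult[of _ "_ * _"])
      finally show ?thesis .
    qed
    then have "ev (mult_list xs ys) m = (\<Sum>(a, h)\<leftarrow>xs. \<Sum>(b, g)\<leftarrow>ys. rmul a (hmul h (rmul b (hmul g m))))"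
      by (simp add: ev_def mult_list_def SW_def sweedler3_def sum_list_concat_map case_prod_unfold o_def)
    also have "\<dots> = ev xs (ev ys m)"
      unfolding ev_def case_prod_unfold by (simp add: hmul_sum rmul_sum m MM)
    finally show ?thesis .
  qed
  \<comment> \<open>The submodule \<open>A y\<close> is nonzero, hence equal to \<open>M\<close>, so
    \<open>m = a x m\<close> for some \<open>a\<close> in \<open>A\<close>. Since
    \<open>e - a \<odot> \<iota> x\<close> is left invertible, \<open>1 m = 0\<close> follows, and
    therefore \<open>x m = 0\<close>.\<close>
  define y where "y = rmul x m"
  have y: "y \<in> M" using m MM by (simp add: y_def)
  define N where "N = range (\<lambda>xs. ev xs y)"
  have "M.RH_submodule N"
    unfolding M.RH_submodule_def
  proof (intro conjI allI ballI M.subspaceI)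
    show "0 \<in> N" unfolding N_def by (rule range_eqI[of _ _ "[]"]) (simp add: ev_def)
    fix u v assume u: "u \<in> N"
    then obtain xs where xs: "u = ev xs y" by (auto simp: N_def)
    show "rmul a u \<in> N" for a
    proof -
      have "ev [(a, 1)] u = rmul a u" using ev_M[OF y] by (simp add: ev_def xs M.hmul_one)
      then show ?thesis unfolding N_def xs ev_mult[OF y, symmetric] by (metis rangeI)
    qed
    show "hmul h u \<in> N" for h
    proof -
      have "ev (mult_list [(1, h)] xs) y = rmul 1 (hmul h u)" unfolding ev_mult[OF y] by (simp add: ev_def xs)
      \<comment> \<open>The module axioms do not state that \<open>1\<close> acts as the identity.
        On \<open>N\<close> it does, and \<open>h (1 u) = \<Sum> (h1 \<cdot> 1)(h2 u)\<close>
        together with \<open>h1 \<cdot> 1 = \<epsilon>(h1)\<close> carries this over to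
        \<open>h u\<close>.\<close>
      moreover have "hmul h u = rmul 1 (hmul h u)"
      proof -
        have "rmul 1 u = u" unfolding xs ev_def using y
          by (simp add: rmul_sum MM case_prod_unfold flip: M.rmul_mult)
        then have "hmul h u = hmul h (rmul 1 u)" by simp
        also have "\<dots> = SW (\<lambda>h1 h2. sM (\<epsilon> h1) (rmul 1 (hmul h2 u))) h"
          using ev_M[OF y] by (simp add: xs M.hmul_rmul SW_def act_one_right M.rmul_scale_left MM)
        also have "\<dots> = rmul 1 (hmul h u)"
          by (rule SW_counit_left) (use bilinear_mapD(2)[OF bil] ev_M[OF y] xs in auto)
        finally show ?thesis .
      qed
      ultimately show ?thesis unfolding N_def by (metis rangeI)
    qed
    show "sM c u \<in> N" for c
    proof -
      have "sM c u = ev (map (\<lambda>(a, h). (sR c a, h)) xs) y"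
        unfolding xs ev_def
        by (simp add: lin_sum_list[OF lin_scale_fun[OF lin_ident[OF Mv]]] case_prod_unfold o_def
            M.rmul_scale_left MM y)
      then show ?thesis by (simp add: N_def)
    qed
    assume "v \<in> N"
    then obtain ys where "v = ev ys y" by (auto simp: N_def)
    then have "u + v = ev (xs @ ys) y" by (simp add: xs ev_def)
    then show "u + v \<in> N" by (simp add: N_def)
  qed (use ev_M[OF y] in \<open>auto simp: N_def\<close>)
  moreover have "y \<in> N"
  proof -
    have "ev [(1, 1)] y = y" using m MM by (simp add: ev_def y_def M.hmul_one flip: M.rmul_mult)
    then show ?thesis unfolding N_def by (metis rangeI)
  qed
  ultimately have "N = M" using M.irreducible ne by (auto simp: y_def)
  then obtain xs where xs: "m = ev xs y" using m by (auto simp: N_def)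
  obtain u where u: "u \<in> A" "u \<odot> (e - val xs \<odot> \<iota> x) = e"
  proof -
    have "val xs \<odot> \<iota> x \<in> rad" using radD(4)[OF x] .
    then show thesis using rad_quasi_regular that by metis
  qed
  obtain us where us: "u = val us" using u(1) by (auto simp: A_eq)
  let ?zs = "(1, 1) # map (\<lambda>(a, h). (- a, h)) (mult_list xs [(x, 1)])"
  have neg_val: "val (map (\<lambda>(a, h). (- a, h)) ys) = - val ys" for ys
  proof (induction ys)
    case (Cons p ys)
    have "basic (- a) h = - basic a h" for a h
      using lin_diff[OF bilinear_mapD(1)[OF bil_basic], of 0 a h] lin_zero[OF bilinear_mapD(1)[OF bil_basic], of h] by simp
    with Cons show ?case by (auto simp: val_def case_prod_unfold simp del: uminus_apply plus_fun_apply)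
  qed (simp add: val_def)
  have neg_ev: "ev (map (\<lambda>(a, h). (- a, h)) ys) m = - ev ys m" if "m \<in> M" for ys m
  proof (induction ys)
    case (Cons p ys)
    have "rmul (- a) (hmul h m) = - rmul a (hmul h m)" for a h
      using lin_diff[OF bilinear_mapD(1)[OF bil[OF that]], of 0 a h] lin_zero[OF bilinear_mapD(1)[OF bil[OF that]], of h] by simp
    with Cons show ?case by (auto simp: ev_def case_prod_unfold)
  qed (simp add: ev_def)
  have "val (mult_list us ?zs) = val [(1, 1)]"
  proof -
    have "val ?zs = e + val (map (\<lambda>(a, h). (- a, h)) (mult_list xs [(x, 1)]))" by (simp add: val_def)
    also have "\<dots> = e - val xs \<odot> \<iota> x"
      unfolding neg_val val_mult by (simp add: val_def)
    finally have "val ?zs = e - val xs \<odot> \<iota> x" .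
    then show ?thesis unfolding val_mult us[symmetric] using u(2) by (simp add: val_def)
  qed
  then have "ev (mult_list us ?zs) m = rmul 1 m"
    using ev_cong[OF _ m] m by (simp add: ev_def M.hmul_one)
  moreover have "ev ?zs m = 0"
  proof -
    have "ev ?zs m = rmul 1 m + ev (map (\<lambda>(a, h). (- a, h)) (mult_list xs [(x, 1)])) m"
      by (simp add: ev_def M.hmul_one m)
    also have "\<dots> = rmul 1 m - ev xs y"
      unfolding neg_ev[OF m] ev_mult[OF m] by (simp add: ev_def y_def M.hmul_one m)
    also have "\<dots> = 0"
    proof -
      have "rmul 1 (ev xs y) = ev xs y" unfolding ev_def using y
        by (simp add: rmul_sum MM case_prod_unfold flip: M.rmul_mult)
      then show ?thesis by (simp flip: xs)
    qed
    finally show ?thesis .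
  qed
  ultimately have "rmul 1 m = 0" unfolding ev_mult[OF m] by (simp add: ev_def hmul_0 rmul_0 case_prod_unfold)
  then have "rmul x m = 0" using M.rmul_mult[OF m, of x 1] rmul_0 by simp
  with ne show False by blast
qed

text \<open>The equality with \<open>r_jH\<close> amounts to stability of \<open>J(R)\<close> under
  \<open>H\<close>: for \<open>x\<close> in \<open>J(R)\<close> the element
  \<open>\<gamma> h \<odot> \<iota> x\<close> lies in \<open>J(A)\<close>, hence in
  \<open>J(R) # H\<close>, and the counit on the second factor returns
  \<open>act h x\<close>.\<close>

lemma radical_equalities:
  assumes base: "\<And>x. x \<in> regular.rad \<Longrightarrow> \<iota> x \<in> rad" and span: "rad \<subseteq> rad_span"
  shows "jacobson_radical (type_ring :: 'r ring) = H_jacobson_radical sH \<Delta> sR act \<sigma> \<and>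
         H_jacobson_radical sH \<Delta> sR act \<sigma> = r_jH act \<and>
         jacobson_radical CP = crossed_subspace sH sR (H_jacobson_radical sH \<Delta> sR act \<sigma>)"
proof -
  have rHj: "H_jacobson_radical sH \<Delta> sR act \<sigma> = regular.rad"
  proof (intro equalityI subsetI)
    fix a assume "a \<in> H_jacobson_radical sH \<Delta> sR act \<sigma>"
    then have "\<iota> a \<in> rad" unfolding rad_eq using quotient_annihilated by blast
    then show "a \<in> regular.rad" by (rule base_mem_radical)
  next
    fix a :: 'r assume "a \<in> regular.rad"
    then show "a \<in> H_jacobson_radical sH \<Delta> sR act \<sigma>"
      unfolding H_jacobson_radical_def using irreducible_annihilated base by blast
  qed
  have "act h x \<in> regular.rad" if "x \<in> regular.rad" for h x
  proof -
    have "\<gamma> h \<odot> \<iota> x \<in> rad_span" using radD(4)[OF base[OF that]] span by blast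
    then have "(\<gamma> h \<odot> \<iota> x) \<epsilon> \<in> regular.rad" by (rule rad_span_base)
    also have "(\<gamma> h \<odot> \<iota> x) \<epsilon> = SW (\<lambda>h1 h2. sR (\<epsilon> h2) (act h1 x)) h"
      by (simp add: \<gamma>_mul_\<iota> SW_apply basic_apply)
    also have "\<dots> = act h x"
      by (rule SW_counit_right) (intro lin_intros)
    finally show ?thesis .
  qed
  then have rjH: "r_jH act = regular.rad"
    unfolding r_jH_def stable_part_def jacobson_radical_type_ring
  proof (intro equalityI subsetI CollectI allI)
    fix x assume "x \<in> {x. \<forall>h. act h x \<in> regular.rad}"
    then have "act 1 x \<in> regular.rad" by blast
    then show "x \<in> regular.rad" by (simp only: act_one_left)
  qed
  have "rad_span \<subseteq> rad"
  proof
    fix x assume "x \<in> rad_span"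
    then obtain xs where xs: "x = val xs" "set xs \<subseteq> regular.rad \<times> UNIV" by (auto simp: rad_span_def)
    have "basic a h \<in> rad" if "a \<in> regular.rad" for a h
      using rad_mul_right[OF base[OF that], of "\<gamma> h"] by (simp add: \<iota>_mul_basic)
    then show "x \<in> rad" unfolding xs(1) val_def using xs(2) by (intro lideal_sum_list[OF lideal_rad]) auto
  qed
  then have "emb ` jacobson_radical CP = emb ` crossed_subspace sH sR regular.rad"
    using span unfolding emb_jacobson_radical emb_crossed_subspace rad_span_def by blast
  moreover have "jacobson_radical CP \<subseteq> carrier CP" by (auto simp: jacobson_radical_def)
  moreover have "crossed_subspace sH sR regular.rad \<subseteq> carrier CP"
    by (auto simp: crossed_subspace_def carrier_CP)
  ultimately have "jacobson_radical CP = crossed_subspace sH sR regular.rad"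
    using inj_on_image_eq_iff[OF emb_inj] by blast
  then show ?thesis unfolding rHj rjH by (simp add: jacobson_radical_type_ring)
qed

end

theorem corollary2p8:
  fixes sH :: "'k::alg_closed_field \<Rightarrow> 'h::ring_1 \<Rightarrow> 'h"
    and \<Delta> :: "'h \<Rightarrow> ('h \<times> 'h) list set"
    and \<epsilon> :: "'h \<Rightarrow> 'k"
    and S :: "'h \<Rightarrow> 'h"
    and sR :: "'k \<Rightarrow> 'r::{ring, monoid_mult} \<Rightarrow> 'r"
    and act :: "'h \<Rightarrow> 'r \<Rightarrow> 'r"
    and \<sigma> :: "'h \<Rightarrow> 'h \<Rightarrow> 'r"
  assumes "hopf_algebra sH \<Delta> \<epsilon> S"
    and "semisimple_ring (type_ring :: 'h ring)"
    and "cosemisimple sH \<Delta>"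
    and "(\<forall>g h :: 'h. g * h = h * g) \<or> cocommutative sH \<Delta>"
    and "k_algebra sR"
    and "twisted_module_algebra sH \<Delta> \<epsilon> sR act \<sigma>"
    and "ring (crossed_product sH \<Delta> sR act \<sigma>)"
  shows "jacobson_radical (type_ring :: 'r ring) = H_jacobson_radical sH \<Delta> sR act \<sigma> \<and>
         H_jacobson_radical sH \<Delta> sR act \<sigma> = r_jH act \<and>
         jacobson_radical (crossed_product sH \<Delta> sR act \<sigma>) =
           crossed_subspace sH sR (H_jacobson_radical sH \<Delta> sR act \<sigma>)"
proof -
  interpret crossed_product_ring sH \<Delta> \<epsilon> S sR act \<sigma>
    using assms by (intro crossed_product_ring.intro alg_closed_hopf.intro
      alg_closed_hopf_axioms.intro crossed_product_ring_axioms.intro)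
  from assms(4) show ?thesis
  proof
    assume "\<forall>g h :: 'h. g * h = h * g"
    then have comm: "\<And>g h :: 'h. g * h = h * g" by blast
    show ?thesis
      using base_radical_commutative[OF comm] radical_commutative[OF comm] by (rule radical_equalities)
  next
    assume "cocommutative sH \<Delta>"
    then show ?thesis
      using radical_cocommutative by (intro radical_equalities) auto
  qed
qed

end
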